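(* Let $r,q\in\mathbb{N}$ with $r\geq 2$, $q\geq 2$, and let $Y_r$, $Y_{r-1}$ and $\phi_r:Y_r\to Y_{r-1}$ be as defined in the context. Then there are line bundles $\mathcal{L}_{0},\ldots,\mathcal{L}_{r-1}$ on $Y_{r-1}$ and an isomorphism $\Psi:Y_{r}\longrightarrow \mathbb{P}(\mathcal{E})$ over $Y_{r-1}$ (i.e. $\bar\pi\circ\Psi=\phi_r$, where $\bar\pi:\mathbb{P}(\mathcal{E})\to Y_{r-1}$ is the projection), where $$\mathcal{E}=\mathcal{L}_{0}^{\oplus q}\oplus\Big(\bigoplus_{j=1}^{r-1} \mathcal{L}_{j}^{\oplus (q-1)}\Big).$$
   Context: All varieties are over $\mathbb{C}$. Put $n_r=rq+1$, $n_{r-1}=(r-1)q+1$. Let $G=PSL(n_r,\mathbb{C})$, $T\subset B\subset G$ a maximal torus and Borel subgroup (say, images of diagonal and upper triangular matrices), simple roots $\alpha_i$, simple reflections $s_i$, fundamental weights $\omega_i$, and one-parameter subgroups $\lambda_i$ of $T$ dual to the simple roots ($\langle\alpha_i,\lambda_j\rangle=\delta_{ij}$). Let $P$ be the maximal parabolic corresponding to $\alpha_r$, so $G/P=G_{r,n_r}$ is the Grassmannian. Let $G'=PSL(n_{r-1},\mathbb{C})$ with analogous data $T',B',\alpha_i',s_i',\omega_i',\lambda'_i$, and $Q$ the maximal parabolic corresponding to $\alpha'_{r-1}$. $\mathcal{L}(n_r\omega_r)$ is $\mathcal{O}(n_r)$ for the Plücker embedding of $G/P$ with its natural $G$-linearization;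 similarly $\mathcal{L}(n_{r-1}\omega'_{r-1})$ on $G'/Q$. Let $w_r=(s_q\cdots s_1)(s_{2q}\cdots s_2)\cdots(s_{rq}\cdots s_r)$ and $w_{r-1}=(s'_q\cdots s'_1)\cdots(s'_{(r-1)q}\cdots s'_{r-1})$, with Schubert varieties $X(w_r)=\overline{Bw_rP/P}$, $X(w_{r-1})=\overline{B'w_{r-1}Q/Q}$. Let $T_{J_r}\subseteq T$ be generated by $\lambda_{jq}(\mathbb{G}_m)$, $1\le j\le r$, and $T'_{J_{r-1}}\subseteq T'$ by $\lambda'_{jq}(\mathbb{G}_m)$, $1\le j\le r-1$. For a reductive $H$ acting on projective $X$ with linearized ample $\mathcal{L}$, $X^{ss}_H(\mathcal{L})$ is the set of points where some $H$-invariant section of some positive power of $\mathcal{L}$ does not vanish. Put $V_r=X(w_r)^{ss}_{T_{J_r}}(\mathcal{L}(n_r\omega_r))$, $V_{r-1}=X(w_{r-1})^{ss}_{T'_{J_{r-1}}}(\mathcal{L}(n_{r-1}\omega'_{r-1}))$, and let $\pi_r:V_r\to Y_r$, $\pi_{r-1}:V_{r-1}\to Y_{r-1}$ be the GIT quotients by $T_{J_r}$ and $T'_{J_{r-1}}$ respectively. Definition of $\phi_r$: for $1\le j\le r$ let $C_j=\{1,\dots,jq+1\}\setminus\{lq+1:1\le l\le j\}$, and for $i\in C_j$ let $\beta_{i,j}=\sum_{l=i}^{jq}\alpha_l$, and (for $j\le r-1$) $\gamma_{i,j}=\sum_{l=i}^{jq}\alpha'_l$. These are exactly the positive roots made negative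 by $w_r^{-1}$, resp. $w_{r-1}^{-1}$. Let $u_\beta:\mathbb{C}\to U_\beta$, $u'_\gamma:\mathbb{C}\to U'_\gamma$ be the standard root subgroup isomorphisms. The set $V_r$ lies in the open cell $Bw_rP/P$, each point of which is uniquely $x=\prod_{1\le j\le r,\,i\in C_j}u_{\beta_{i,j}}(a_{i,j})\,w_rP/P$ (the factors commute); similarly for $V_{r-1}$. Put $x[r-1]=\prod_{1\le j\le r-1,\,i\in C_j}u'_{\gamma_{i,j}}(a_{i,j})\,w_{r-1}Q/Q$. If $x\in V_r$ then $x[r-1]\in V_{r-1}$, and $x\mapsto\pi_{r-1}(x[r-1])$ is constant on $T_{J_r}$-orbits; $\phi_r:Y_r\to Y_{r-1}$ is the induced morphism, $\phi_r(\pi_r(x))=\pi_{r-1}(x[r-1])$. For a vector bundle $\mathcal{E}$ of rank $m$ with transition functions $g_{ij}:U_i\cap U_j\to GL(m,\mathbb{C})$, $\mathbb{P}(\mathcal{E})$ is obtained by gluing the $U_i\times\mathbb{P}^{m-1}$ via $(x,[v])\mapsto(x,[g_{ij}(x)v])$ (lines in the fibres of $\mathcal{E}$). *)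

theory Defs
  imports
    "HOL-Analysis.Abstract_Topology"
    "HOL-Combinatorics.Transposition"
    "HOL-Algebra.Generated_Groups"
    "HOL-Algebra.Coset"
    "Jordan_Normal_Form.Determinant"
    "Jordan_Normal_Form.DL_Submatrix"
begin

section \<open>Spaces with functions\<close>

text \<open>Varieties over the complex numbers are treated classically: a topological space together
  with, for each open set, the complex-valued functions that are regular on it.  Functions are
  total, and only the values on the open set matter.\<close>

record 'a fspace =
  Top :: "'a topology"
  Reg :: "'a set \<Rightarrow> ('a \<Rightarrow> complex) set"

abbreviation pts :: "('a, 'b) fspace_scheme \<Rightarrow> 'a set" where
  "pts X \<equiv> topspace (Top X)"

definition space_with_functions :: "'a fspace \<Rightarrow> bool" where
  "space_with_functions X \<longleftrightarrow> (\<forall>U. openin (Top X) U \<longrightarrow>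
     (\<forall>f g. f \<in> Reg X U \<longrightarrow> (\<forall>x\<in>U. f x = g x) \<longrightarrow> g \<in> Reg X U) \<and>
     (\<forall>f V. f \<in> Reg X U \<longrightarrow> openin (Top X) V \<longrightarrow> V \<subseteq> U \<longrightarrow> f \<in> Reg X V) \<and>
     (\<forall>f. (\<forall>x\<in>U. \<exists>V. openin (Top X) V \<and> x \<in> V \<and> V \<subseteq> U \<and> f \<in> Reg X V) \<longrightarrow> f \<in> Reg X U) \<and>
     (\<forall>c. (\<lambda>_. c) \<in> Reg X U) \<and>
     (\<forall>f\<in>Reg X U. \<forall>g\<in>Reg X U. (\<lambda>x. f x + g x) \<in> Reg X U \<and> (\<lambda>x. f x * g x) \<in> Reg X U) \<and>
     (\<forall>f\<in>Reg X U. openin (Top X) {x\<in>U. f x \<noteq> 0} \<and>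
        (\<lambda>x. 1 / f x) \<in> Reg X {x\<in>U. f x \<noteq> 0}))"

definition fs_morphism :: "'a fspace \<Rightarrow> 'b fspace \<Rightarrow> ('a \<Rightarrow> 'b) \<Rightarrow> bool" where
  "fs_morphism X Z f \<longleftrightarrow> continuous_map (Top X) (Top Z) f \<and>
     (\<forall>U h. openin (Top Z) U \<longrightarrow> h \<in> Reg Z U \<longrightarrow> h \<circ> f \<in> Reg X {x\<in>pts X. f x \<in> U})"

definition fs_isomorphism :: "'a fspace \<Rightarrow> 'b fspace \<Rightarrow> ('a \<Rightarrow> 'b) \<Rightarrow> bool" where
  "fs_isomorphism X Z f \<longleftrightarrow> fs_morphism X Z f \<and>
     (\<exists>g. fs_morphism Z X g \<and> (\<forall>x\<in>pts X. g (f x) = x) \<and> (\<forall>z\<in>pts Z. f (g z) = z))"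

definition open_subspace :: "'a fspace \<Rightarrow> 'a set \<Rightarrow> 'a fspace" where
  "open_subspace X U = \<lparr>Top = subtopology (Top X) U, Reg = Reg X\<rparr>"

text \<open>Products: basic open sets and regular functions come from finite sums
  \<open>\<Sum> f(x) g(z)\<close> with \<open>f\<close>, \<open>g\<close> regular, as in the affine case
  where the coordinate ring of a product is the tensor product.\<close>

definition tensor :: "(('a \<Rightarrow> complex) \<times> ('b \<Rightarrow> complex)) list \<Rightarrow> 'a \<times> 'b \<Rightarrow> complex" where
  "tensor fgs xz = (\<Sum>(f, g)\<leftarrow>fgs. f (fst xz) * g (snd xz))"

definition prod_basic :: "'a set \<Rightarrow> 'b set \<Rightarrow> (('a \<Rightarrow> complex) \<times> ('b \<Rightarrow> complex)) list \<Rightarrow> ('a \<times> 'b) set"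
  where "prod_basic U W fgs = {xz \<in> U \<times> W. tensor fgs xz \<noteq> 0}"

definition fs_prod :: "'a fspace \<Rightarrow> 'b fspace \<Rightarrow> ('a \<times> 'b) fspace" where
  "fs_prod X Z = \<lparr>
     Top = topology_generated_by {prod_basic U W fgs | U W fgs.
       openin (Top X) U \<and> openin (Top Z) W \<and> set fgs \<subseteq> Reg X U \<times> Reg Z W},
     Reg = (\<lambda>D. {h. \<forall>xz\<in>D. \<exists>U W num den.
       openin (Top X) U \<and> openin (Top Z) W \<and>
       set num \<subseteq> Reg X U \<times> Reg Z W \<and> set den \<subseteq> Reg X U \<times> Reg Z W \<and>
       xz \<in> prod_basic U W den \<and>
       (\<forall>yw \<in> D \<inter> prod_basic U W den. h yw = tensor num yw / tensor den yw)})\<rparr>"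

text \<open>Gluing of spaces \<open>X k\<close> along maps \<open>\<kappa> k\<close> to a common set of points.\<close>

definition glue_topology :: "'k set \<Rightarrow> ('k \<Rightarrow> 'a topology) \<Rightarrow> ('k \<Rightarrow> 'a \<Rightarrow> 'c) \<Rightarrow> 'c topology" where
  "glue_topology I T \<kappa> = topology (\<lambda>D. D \<subseteq> (\<Union>k\<in>I. \<kappa> k ` topspace (T k)) \<and>
     (\<forall>k\<in>I. openin (T k) {x \<in> topspace (T k). \<kappa> k x \<in> D}))"

lemma openin_glue_topology:
  "openin (glue_topology I T \<kappa>) D \<longleftrightarrow> D \<subseteq> (\<Union>k\<in>I. \<kappa> k ` topspace (T k)) \<and>
     (\<forall>k\<in>I. openin (T k) {x \<in> topspace (T k). \<kappa> k x \<in> D})"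
proof -
  define P where "P D \<longleftrightarrow> D \<subseteq> (\<Union>k\<in>I. \<kappa> k ` topspace (T k)) \<and>
     (\<forall>k\<in>I. openin (T k) {x \<in> topspace (T k). \<kappa> k x \<in> D})" for D
  have int: "P (S \<inter> S')" if "P S" "P S'" for S S'
  proof -
    have "{x \<in> topspace (T k). \<kappa> k x \<in> S \<inter> S'} =
        {x \<in> topspace (T k). \<kappa> k x \<in> S} \<inter> {x \<in> topspace (T k). \<kappa> k x \<in> S'}" for k
      by auto
    then show ?thesis using that unfolding P_def by (auto intro: openin_Int)
  qed
  have un: "P (\<Union>\<K>)" if "\<forall>S\<in>\<K>. P S" for \<K>
  proof -
    have "{x \<in> topspace (T k). \<kappa> k x \<in> \<Union>\<K>} = (\<Union>S\<in>\<K>. {x \<in> topspace (T k). \<kappa> k x \<in> S})" for k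
      by auto
    moreover have "openin (T k) (\<Union>S\<in>\<K>. {x \<in> topspace (T k). \<kappa> k x \<in> S})" if "k \<in> I" for k
      using \<open>\<forall>S\<in>\<K>. P S\<close> that unfolding P_def by (intro openin_Union) blast
    moreover have "\<Union>\<K> \<subseteq> (\<Union>k\<in>I. \<kappa> k ` topspace (T k))"
      using that unfolding P_def by blast
    ultimately show ?thesis unfolding P_def by simp
  qed
  have "istopology P"
    unfolding istopology_def using int un by blast
  then have "openin (topology P) D \<longleftrightarrow> P D"
    by (simp add: topology_inverse')
  moreover have "glue_topology I T \<kappa> = topology P"
    unfolding glue_topology_def P_def ..
  ultimately show ?thesis unfolding P_def by simp
qed

definition fs_glue :: "'k set \<Rightarrow> ('k \<Rightarrow> 'a fspace) \<Rightarrow> ('k \<Rightarrow> 'a \<Rightarrow> 'c) \<Rightarrow> 'c fspace" where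
  "fs_glue I X \<kappa> = \<lparr>
     Top = glue_topology I (\<lambda>k. Top (X k)) \<kappa>,
     Reg = (\<lambda>D. {h. \<forall>k\<in>I. h \<circ> \<kappa> k \<in> Reg (X k) {x \<in> pts (X k). \<kappa> k x \<in> D}})\<rparr>"


section \<open>Projective space and its locally closed subsets\<close>

text \<open>Homogeneous coordinates are indexed by a finite set \<open>I\<close>; vectors vanish off \<open>I\<close>.
  A point is the set of all nonzero vectors on a line, so that \<open>\<Union>X\<close> is the affine
  cone without the origin over a set \<open>X\<close> of points.\<close>

definition line :: "('i \<Rightarrow> complex) \<Rightarrow> ('i \<Rightarrow> complex) set" where
  "line v = {\<lambda>i. c * v i | c. c \<noteq> 0}"

definition proj_points :: "'i set \<Rightarrow> ('i \<Rightarrow> complex) set set" where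
  "proj_points I = {line v | v. (\<forall>i. i \<notin> I \<longrightarrow> v i = 0) \<and> (\<exists>i\<in>I. v i \<noteq> 0)}"

inductive hpoly :: "'i set \<Rightarrow> nat \<Rightarrow> (('i \<Rightarrow> complex) \<Rightarrow> complex) \<Rightarrow> bool" for I where
  const: "hpoly I 0 (\<lambda>v. c)"
| coord: "i \<in> I \<Longrightarrow> hpoly I 1 (\<lambda>v. v i)"
| add: "hpoly I d F \<Longrightarrow> hpoly I d H \<Longrightarrow> hpoly I d (\<lambda>v. F v + H v)"
| mult: "hpoly I d F \<Longrightarrow> hpoly I e H \<Longrightarrow> hpoly I (d + e) (\<lambda>v. F v * H v)"

definition zariski :: "'i set \<Rightarrow> ('i \<Rightarrow> complex) set topology" where
  "zariski I = topology_generated_by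
     {{p \<in> proj_points I. \<forall>v\<in>p. F v \<noteq> 0} | F. \<exists>d. hpoly I d F}"

text \<open>Sections of \<open>\<O>(d)\<close> over \<open>X\<close> are functions on the punctured cone that are locally
  quotients of homogeneous polynomials whose degrees differ by \<open>d\<close>.\<close>

definition twist_sections ::
    "'i set \<Rightarrow> ('i \<Rightarrow> complex) set set \<Rightarrow> nat \<Rightarrow> (('i \<Rightarrow> complex) \<Rightarrow> complex) set" where
  "twist_sections I X d = {f. \<forall>p\<in>X. \<exists>e F H. hpoly I (d + e) F \<and> hpoly I e H \<and>
     (\<forall>v\<in>p. H v \<noteq> 0) \<and> (\<forall>v\<in>\<Union>X. H v \<noteq> 0 \<longrightarrow> f v = F v / H v)}"

definition quasiprojective ::
    "'i set \<Rightarrow> ('i \<Rightarrow> complex) set set \<Rightarrow> ('i \<Rightarrow> complex) set fspace" where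
  "quasiprojective I X = \<lparr>
     Top = subtopology (zariski I) X,
     Reg = (\<lambda>U. {h. (\<lambda>v. h (line v)) \<in> twist_sections I U 0})\<rparr>"

definition proj_space :: "nat \<Rightarrow> (nat \<Rightarrow> complex) set fspace" where
  "proj_space m = quasiprojective {..<m} (proj_points {..<m})"


section \<open>Vector bundles and projective bundles\<close>

text \<open>A rank \<open>m\<close> bundle is given by transition functions \<open>g i k\<close>, from the fibre
  coordinates over \<open>U k\<close> to those over \<open>U i\<close>, for an open cover \<open>(U i)\<^sub>i\<^sub>\<in>\<^sub>I\<close>.\<close>

type_synonym 'y transition = "nat \<Rightarrow> nat \<Rightarrow> 'y \<Rightarrow> complex mat"

definition open_cover :: "'y fspace \<Rightarrow> nat set \<Rightarrow> (nat \<Rightarrow> 'y set) \<Rightarrow> bool" where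
  "open_cover Y I U \<longleftrightarrow> (\<forall>i\<in>I. openin (Top Y) (U i)) \<and> (\<Union>i\<in>I. U i) = pts Y"

definition vector_bundle ::
    "'y fspace \<Rightarrow> nat set \<Rightarrow> (nat \<Rightarrow> 'y set) \<Rightarrow> nat \<Rightarrow> 'y transition \<Rightarrow> bool" where
  "vector_bundle Y I U m g \<longleftrightarrow> open_cover Y I U \<and>
     (\<forall>i\<in>I. \<forall>k\<in>I.
        (\<forall>y \<in> U i \<inter> U k. g i k y \<in> carrier_mat m m \<and> invertible_mat (g i k y)) \<and>
        (\<forall>a<m. \<forall>b<m. (\<lambda>y. g i k y $$ (a, b)) \<in> Reg Y (U i \<inter> U k))) \<and>
     (\<forall>i\<in>I. \<forall>k\<in>I. \<forall>l\<in>I. \<forall>y \<in> U i \<inter> U k \<inter> U l. g i k y * g k l y = g i l y)"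

abbreviation line_bundle ::
    "'y fspace \<Rightarrow> nat set \<Rightarrow> (nat \<Rightarrow> 'y set) \<Rightarrow> 'y transition \<Rightarrow> bool" where
  "line_bundle Y I U g \<equiv> vector_bundle Y I U 1 g"

definition direct_sum :: "'y transition list \<Rightarrow> 'y transition" where
  "direct_sum gs = (\<lambda>i k y. diag_block_mat (map (\<lambda>g. g i k y) gs))"

definition mat_act :: "complex mat \<Rightarrow> (nat \<Rightarrow> complex) \<Rightarrow> nat \<Rightarrow> complex" where
  "mat_act A v = (\<lambda>a. if a < dim_row A then \<Sum>b<dim_col A. A $$ (a, b) * v b else 0)"

text \<open>A point of the projective bundle is the set of all its local representatives
  \<open>(i, y, \<ell>)\<close>, where \<open>\<ell>\<close> is a line in the fibre coordinates over \<open>U i\<close>.\<close>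

definition pb_chart :: "nat set \<Rightarrow> (nat \<Rightarrow> 'y set) \<Rightarrow> 'y transition \<Rightarrow>
    nat \<Rightarrow> 'y \<times> (nat \<Rightarrow> complex) set \<Rightarrow> (nat \<times> 'y \<times> (nat \<Rightarrow> complex) set) set" where
  "pb_chart I U g k = (\<lambda>(y, l). {(i, y, mat_act (g i k y) ` l) | i. i \<in> I \<and> y \<in> U i})"

definition proj_bundle :: "'y fspace \<Rightarrow> nat set \<Rightarrow> (nat \<Rightarrow> 'y set) \<Rightarrow> nat \<Rightarrow> 'y transition \<Rightarrow>
    (nat \<times> 'y \<times> (nat \<Rightarrow> complex) set) set fspace" where
  "proj_bundle Y I U m g =
     fs_glue I (\<lambda>k. fs_prod (open_subspace Y (U k)) (proj_space m)) (pb_chart I U g)"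

definition pb_proj :: "(nat \<times> 'y \<times> (nat \<Rightarrow> complex) set) set \<Rightarrow> 'y" where
  "pb_proj C = (THE y. \<exists>i l. (i, y, l) \<in> C)"


section \<open>Semistable points and quotients\<close>

text \<open>\<open>\<Gamma>\<close> is the set of linear maps of the cone through which the group acts; it defines
  the linearization of \<open>\<O>(d)\<close>.\<close>

definition semistable :: "'i set \<Rightarrow> ('i \<Rightarrow> complex) set set \<Rightarrow> nat \<Rightarrow>
    (('i \<Rightarrow> complex) \<Rightarrow> ('i \<Rightarrow> complex)) set \<Rightarrow> ('i \<Rightarrow> complex) set set" where
  "semistable I X d \<Gamma> = {p \<in> X. \<exists>k\<ge>1. \<exists>f \<in> twist_sections I X (k * d).
     (\<forall>\<gamma>\<in>\<Gamma>. \<forall>v\<in>\<Union>X. f (\<gamma> v) = f v) \<and> (\<forall>v\<in>p. f v \<noteq> 0)}"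

text \<open>Good quotients in the sense of geometric invariant theory, for a group acting on \<open>X\<close>
  through the set \<open>\<Gamma>\<close> of transformations.  The conditions determine \<open>(Y, \<pi>)\<close> up to unique
  isomorphism, so the quotient of a semistable locus is the (quasi-)projective variety given by
  the invariant sections.\<close>

definition good_quotient :: "('a \<Rightarrow> 'a) set \<Rightarrow> 'a fspace \<Rightarrow> 'b fspace \<Rightarrow> ('a \<Rightarrow> 'b) \<Rightarrow> bool" where
  "good_quotient \<Gamma> X Y \<pi> \<longleftrightarrow>
     space_with_functions Y \<and> fs_morphism X Y \<pi> \<and> \<pi> ` pts X = pts Y \<and>
     (\<forall>\<gamma>\<in>\<Gamma>. \<forall>x\<in>pts X. \<pi> (\<gamma> x) = \<pi> x) \<and>
     (\<forall>U h. openin (Top Y) U \<longrightarrow> h \<in> Reg X {x\<in>pts X. \<pi> x \<in> U} \<longrightarrow>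
        (\<forall>\<gamma>\<in>\<Gamma>. \<forall>x\<in>pts X. \<pi> x \<in> U \<longrightarrow> h (\<gamma> x) = h x) \<longrightarrow>
        (\<exists>f\<in>Reg Y U. \<forall>x\<in>pts X. \<pi> x \<in> U \<longrightarrow> h x = f (\<pi> x))) \<and>
     (\<forall>W. closedin (Top X) W \<longrightarrow> (\<forall>\<gamma>\<in>\<Gamma>. \<gamma> ` W \<subseteq> W) \<longrightarrow> closedin (Top Y) (\<pi> ` W)) \<and>
     (\<forall>W W'. closedin (Top X) W \<longrightarrow> closedin (Top X) W' \<longrightarrow>
        (\<forall>\<gamma>\<in>\<Gamma>. \<gamma> ` W \<subseteq> W \<and> \<gamma> ` W' \<subseteq> W') \<longrightarrow> W \<inter> W' = {} \<longrightarrow> \<pi> ` W \<inter> \<pi> ` W' = {})"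


section \<open>The group, the Grassmannian and Schubert varieties\<close>

text \<open>Matrix positions are 0-based while simple roots, simple reflections and parameters
  \<open>i, j\<close> are numbered from 1: the basis vector \<open>e\<^sub>i\<close> has position \<open>i - 1\<close>.\<close>

definition SL :: "nat \<Rightarrow> complex mat monoid" where
  "SL n = \<lparr>carrier = {A \<in> carrier_mat n n. det A = 1}, monoid.mult = (*), one = 1\<^sub>m n\<rparr>"

definition SL_center :: "nat \<Rightarrow> complex mat set" where
  "SL_center n = {A \<in> carrier (SL n). \<exists>c. A = c \<cdot>\<^sub>m 1\<^sub>m n}"

definition PSL :: "nat \<Rightarrow> complex mat set monoid" where
  "PSL n = SL n Mod SL_center n"

definition borel_SL :: "nat \<Rightarrow> complex mat set" where
  "borel_SL n = {A \<in> carrier (SL n). upper_triangular A}"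

text \<open>The simple root \<open>\<alpha>\<^sub>i\<close> is the ratio of the \<open>i\<close>-th and \<open>(i+1)\<close>-st diagonal
  entries, so the following coset is the value at \<open>t\<close> of the one-parameter subgroup
  \<open>\<lambda>\<^sub>j\<close> of the torus of \<open>PSL n\<close> dual to the simple roots.\<close>

definition one_param :: "nat \<Rightarrow> nat \<Rightarrow> complex \<Rightarrow> complex mat set" where
  "one_param n j t = {A \<in> carrier (SL n). diagonal_mat A \<and>
     (\<forall>i\<in>{1..<n}. A $$ (i - 1, i - 1) / A $$ (i, i) = (if i = j then t else 1))}"

definition plucker_idx :: "nat \<Rightarrow> nat \<Rightarrow> nat set set" where
  "plucker_idx n r = {K. K \<subseteq> {..<n} \<and> card K = r}"

text \<open>The maximal parabolic \<open>P\<close> of \<open>\<alpha>\<^sub>r\<close> is the stabilizer of the span of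
  \<open>e\<^sub>1, \<dots>, e\<^sub>r\<close>.  The point \<open>gP/P\<close> is represented by its image under the Plucker embedding, whose
  coordinates are the maximal minors of the first \<open>r\<close> columns of \<open>g\<close>.  This depends on
  \<open>g\<close> only up to a nonzero scalar.\<close>

definition plucker_pt :: "nat \<Rightarrow> nat \<Rightarrow> complex mat \<Rightarrow> (nat set \<Rightarrow> complex) set" where
  "plucker_pt n r g = line (\<lambda>K. if K \<in> plucker_idx n r then det (submatrix g K {..<r}) else 0)"

definition grassmannian :: "nat \<Rightarrow> nat \<Rightarrow> (nat set \<Rightarrow> complex) set set" where
  "grassmannian n r = plucker_pt n r ` carrier (SL n)"

text \<open>Action of a matrix on the \<open>r\<close>-th exterior power, in Plucker coordinates.\<close>

definition ext_act :: "nat \<Rightarrow> nat \<Rightarrow> complex mat \<Rightarrow> (nat set \<Rightarrow> complex) \<Rightarrow> nat set \<Rightarrow> complex" where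
  "ext_act n r A v = (\<lambda>K. if K \<in> plucker_idx n r
     then \<Sum>M\<in>plucker_idx n r. det (submatrix A K M) * v M else 0)"

text \<open>The permutation matrix sending \<open>e\<^sub>i\<close> to \<open>e\<^bsub>w i\<^esub>\<close>; its determinant may be \<open>-1\<close>,
  which is irrelevant for the point \<open>wP/P\<close>.\<close>

definition weyl_rep :: "nat \<Rightarrow> (nat \<Rightarrow> nat) \<Rightarrow> complex mat" where
  "weyl_rep n w = mat n n (\<lambda>(a, b). if a + 1 = w (b + 1) then 1 else 0)"

definition schubert_variety :: "nat \<Rightarrow> nat \<Rightarrow> (nat \<Rightarrow> nat) \<Rightarrow> (nat set \<Rightarrow> complex) set set" where
  "schubert_variety n r w =
     subtopology (zariski (plucker_idx n r)) (grassmannian n r) closure_of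
       {plucker_pt n r (b * weyl_rep n w) | b. b \<in> borel_SL n}"


section \<open>The varieties of the theorem\<close>

text \<open>All notions are in terms of \<open>r\<close> and \<open>q\<close>; those for \<open>G'\<close> and \<open>Q\<close> arise by
  replacing \<open>r\<close> with \<open>r - 1\<close>.\<close>

definition dim_n :: "nat \<Rightarrow> nat \<Rightarrow> nat" where
  "dim_n r q = r * q + 1"

definition simple_reflection :: "nat \<Rightarrow> nat \<Rightarrow> nat" where
  "simple_reflection i = Transposition.transpose i (i + 1)"

text \<open>The \<open>j\<close>-th factor of the word is \<open>s\<^bsub>jq\<^esub> \<dots> s\<^sub>j\<close>.\<close>

definition w_elt :: "nat \<Rightarrow> nat \<Rightarrow> nat \<Rightarrow> nat" where
  "w_elt r q = foldr (\<circ>)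
     (map simple_reflection (concat (map (\<lambda>j. rev [j..<j * q + 1]) [1..<r + 1]))) id"

definition X_w :: "nat \<Rightarrow> nat \<Rightarrow> (nat set \<Rightarrow> complex) set set" where
  "X_w r q = schubert_variety (dim_n r q) r (w_elt r q)"

definition T_J :: "nat \<Rightarrow> nat \<Rightarrow> complex mat set set" where
  "T_J r q = generate (PSL (dim_n r q))
     {one_param (dim_n r q) (j * q) t | j t. j \<in> {1..r} \<and> t \<noteq> 0}"

text \<open>The torus acts through all matrices representing its elements.  Scalar matrices in
  \<open>SL n\<close> fix the points of the Grassmannian and the sections of \<open>\<O>(n k)\<close>, so this is
  the natural linearization of \<open>\<O>(n)\<close> for \<open>PSL n\<close>.\<close>

definition T_J_act :: "nat \<Rightarrow> nat \<Rightarrow> ((nat set \<Rightarrow> complex) \<Rightarrow> (nat set \<Rightarrow> complex)) set" where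
  "T_J_act r q = {ext_act (dim_n r q) r A | A. A \<in> \<Union>(T_J r q)}"

definition V_ss :: "nat \<Rightarrow> nat \<Rightarrow> (nat set \<Rightarrow> complex) set set" where
  "V_ss r q = semistable (plucker_idx (dim_n r q) r) (X_w r q) (dim_n r q) (T_J_act r q)"

definition GIT_quotient ::
    "nat \<Rightarrow> nat \<Rightarrow> 'y fspace \<Rightarrow> ((nat set \<Rightarrow> complex) set \<Rightarrow> 'y) \<Rightarrow> bool" where
  "GIT_quotient r q Y \<pi> \<longleftrightarrow>
     good_quotient {(`) \<gamma> | \<gamma>. \<gamma> \<in> T_J_act r q}
       (quasiprojective (plucker_idx (dim_n r q) r) (V_ss r q)) Y \<pi>"

definition C_set :: "nat \<Rightarrow> nat \<Rightarrow> nat set" where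
  "C_set q j = {1..j * q + 1} - {l * q + 1 | l. l \<in> {1..j}}"

text \<open>The root \<open>\<beta>\<^sub>i\<^sub>,\<^sub>j = \<alpha>\<^sub>i + \<dots> + \<alpha>\<^bsub>jq\<^esub>\<close> has its root subgroup in row \<open>i\<close> and
  column \<open>jq + 1\<close>, and \<open>u_beta n q a i j\<close> is its element with parameter \<open>a\<close>.\<close>

definition u_beta :: "nat \<Rightarrow> nat \<Rightarrow> complex \<Rightarrow> nat \<Rightarrow> nat \<Rightarrow> complex mat" where
  "u_beta n q a i j = addrow_mat n a (i - 1) (j * q)"

text \<open>The factors commute, so the order chosen here does not matter.\<close>

definition cell_pt :: "nat \<Rightarrow> nat \<Rightarrow> (nat \<Rightarrow> nat \<Rightarrow> complex) \<Rightarrow> (nat set \<Rightarrow> complex) set" where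
  "cell_pt r q a = plucker_pt (dim_n r q) r
     (foldr (*)
        (concat (map (\<lambda>j. map (\<lambda>i. u_beta (dim_n r q) q (a i j) i j) (sorted_list_of_set (C_set q j)))
           [1..<r + 1]))
        (weyl_rep (dim_n r q) (w_elt r q)))"

text \<open>With \<open>x = cell_pt r q a\<close> the truncation \<open>x[r-1]\<close> is \<open>cell_pt (r - 1) q a\<close>, which
  only uses the parameters \<open>a i j\<close> with \<open>j \<le> r - 1\<close>.\<close>

definition phi :: "nat \<Rightarrow> nat \<Rightarrow> ((nat set \<Rightarrow> complex) set \<Rightarrow> 'y) \<Rightarrow>
    ((nat set \<Rightarrow> complex) set \<Rightarrow> 'z) \<Rightarrow> 'y \<Rightarrow> 'z" where
  "phi r q \<pi> \<pi>' y = (THE z. \<exists>a. cell_pt r q a \<in> V_ss r q \<and> \<pi> (cell_pt r q a) = y \<and>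
     z = \<pi>' (cell_pt (r - 1) q a))"

end

theory Submission
  imports Defs
begin

text \<open>Points of the open cell are \<open>n\<^sub>r \<times> r\<close> matrices whose column \<open>j\<close> has a \<open>1\<close> in row \<open>jq + 1\<close>
  and free entries \<open>a\<^sub>i\<^sub>j\<close> in the rows \<open>i \<in> C\<^sub>j\<close>.  Cut the rows into blocks of \<open>q\<close>, the last row being a block of
  its own: \<open>T\<^sub>J\<close> consists of the block-scalar matrices, and \<open>u\<close> multiplies \<open>a\<^sub>i\<^sub>j\<close> by
  \<open>u\<^bsub>block i\<^esub> / u\<^sub>j\<close>.  One-parameter subgroups show that a semistable point lies in the cell and has
  no zero column; conversely, a product of maximal minors that each miss exactly one block is an
  invariant section, and it can be chosen nonzero at a given point of the cell without zero columns.
  Hence \<open>V\<^sub>r\<close> is \<open>V\<^bsub>r-1\<^esub>\<close> times the nonzero vectors \<open>(a\<^sub>i\<^sub>r)\<^sub>i\<close>, and \<open>u\<^sub>r\<close> acts by scaling these.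

  Choosing an entry \<open>a\<^bsub>s(j), j\<^esub> \<noteq> 0\<close> in every column of a point of \<open>V\<^bsub>r-1\<^esub>\<close> gives semi-invariants
  \<open>t\<^sub>0 = 1\<close>, \<open>t\<^sub>j = t\<^bsub>block s(j)\<^esub> a\<^bsub>s(j), j\<^esub>\<close> of weight \<open>u\<^sub>0 / u\<^sub>j\<close>.  The vector
  \<open>(t\<^bsub>block i\<^esub> a\<^sub>i\<^sub>r)\<^sub>i\<close> then has a single weight and trivializes \<open>\<phi>\<^sub>r\<close> over the chart of \<open>s\<close>; the
  transition functions of \<open>\<L>\<^sub>j\<close> are the quotients of the functions \<open>t\<^sub>j\<close> of two charts.\<close>

section \<open>Spaces with functions\<close>

text \<open>Nothing is known of Y beyond \<open>good_quotient\<close>, so every function, open set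
  or map on Y is produced on V and descended. This needs the fibres of \<pi> to be single orbits,
  hence closed orbits: scaling a point by its own t_j gives a normal form whose entries are regular
  invariants that tell the orbits of a chart apart. The same normal form is a local section of the
  quotient map, from which the inverse of the isomorphism is built. Two recursions rest on one
  inequality: a free row of column j lies in a block below j. It makes the recursion for t_j end at
  block 0, and it lets a walk from any block down to 0 produce the minors that miss one prescribed
  block. The exponents of the invariant section come from weights: the minor missing block m has
  weight (u_0 ... u_r) / u_m, and with multiplicity 1 for m < r and n - r for m = r the degree is n
  and the total weight is det^r = 1. The ranks q and q - 1 count free rows of the last column: block
  0 is free, while each block j from 1 to r - 1 begins with the pivot row of column j.\<close>

lemma swf_cong:
  assumes "space_with_functions X" "openin (Top X) U" "f \<in> Reg X U" "\<And>x. x \<in> U \<Longrightarrow> f x = g x"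
  shows "g \<in> Reg X U"
  by (rule assms(1)[unfolded space_with_functions_def, THEN spec, THEN mp, OF assms(2),
        THEN conjunct1, rule_format, OF assms(3,4)])

lemma swf_mono:
  assumes "space_with_functions X" "openin (Top X) U" "f \<in> Reg X U" "openin (Top X) V" "V \<subseteq> U"
  shows "f \<in> Reg X V"
  by (rule assms(1)[unfolded space_with_functions_def, THEN spec, THEN mp, OF assms(2),
        THEN conjunct2, THEN conjunct1, rule_format, OF assms(3-5)])

lemma swf_local:
  assumes "space_with_functions X" "openin (Top X) U"
    "\<And>x. x \<in> U \<Longrightarrow> \<exists>V. openin (Top X) V \<and> x \<in> V \<and> V \<subseteq> U \<and> f \<in> Reg X V"
  shows "f \<in> Reg X U"
  using assms(1)[unfolded space_with_functions_def, THEN spec, THEN mp, OF assms(2),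
        THEN conjunct2, THEN conjunct2, THEN conjunct1] assms(3) by simp

lemma swf_const:
  assumes "space_with_functions X" "openin (Top X) U"
  shows "(\<lambda>_. c) \<in> Reg X U"
  by (rule assms(1)[unfolded space_with_functions_def, THEN spec, THEN mp, OF assms(2),
        THEN conjunct2, THEN conjunct2, THEN conjunct2, THEN conjunct1, THEN spec])

lemma swf_add_mult:
  assumes "space_with_functions X" "openin (Top X) U" "f \<in> Reg X U" "g \<in> Reg X U"
  shows swf_add: "(\<lambda>x. f x + g x) \<in> Reg X U" and swf_mult: "(\<lambda>x. f x * g x) \<in> Reg X U"
  using assms(1)[unfolded space_with_functions_def, THEN spec, THEN mp, OF assms(2),
        THEN conjunct2, THEN conjunct2, THEN conjunct2, THEN conjunct2, THEN conjunct1,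
        THEN bspec, OF assms(3), THEN bspec, OF assms(4)] by simp_all

lemma swf_nonzero_inverse:
  assumes "space_with_functions X" "openin (Top X) U" "f \<in> Reg X U"
  shows swf_nonzero_open: "openin (Top X) {x\<in>U. f x \<noteq> 0}"
    and swf_inverse: "(\<lambda>x. 1 / f x) \<in> Reg X {x\<in>U. f x \<noteq> 0}"
  using assms(1)[unfolded space_with_functions_def, THEN spec, THEN mp, OF assms(2),
        THEN conjunct2, THEN conjunct2, THEN conjunct2, THEN conjunct2, THEN conjunct2,
        THEN bspec, OF assms(3)] by simp_all

lemma swf_divide:
  assumes X: "space_with_functions X" and U: "openin (Top X) U"
    and f: "f \<in> Reg X U" and g: "g \<in> Reg X U" and nz: "\<And>x. x \<in> U \<Longrightarrow> g x \<noteq> 0"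
  shows "(\<lambda>x. f x / g x) \<in> Reg X U"
proof -
  have "{x\<in>U. g x \<noteq> 0} = U" using nz by auto
  then have "(\<lambda>x. 1 / g x) \<in> Reg X U" using swf_inverse[OF X U g] by simp
  from swf_mult[OF X U f this] show ?thesis by simp
qed

lemma swf_sum:
  assumes X: "space_with_functions X" and U: "openin (Top X) U"
    and f: "\<And>k. k \<in> K \<Longrightarrow> f k \<in> Reg X U"
  shows "(\<lambda>x. \<Sum>k\<in>K. f k x) \<in> Reg X U"
  using f
proof (induction K rule: infinite_finite_induct)
  case (insert k K)
  then have "(\<lambda>x. f k x + (\<Sum>k\<in>K. f k x)) \<in> Reg X U" by (intro swf_add[OF X U]) auto
  then show ?case using insert by simp
qed (simp_all add: swf_const[OF X U])

lemma swf_prod: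
  assumes X: "space_with_functions X" and U: "openin (Top X) U"
    and f: "\<And>k. k \<in> K \<Longrightarrow> f k \<in> Reg X U"
  shows "(\<lambda>x. \<Prod>k\<in>K. f k x) \<in> Reg X U"
  using f
proof (induction K rule: infinite_finite_induct)
  case (insert k K)
  then have "(\<lambda>x. f k x * (\<Prod>k\<in>K. f k x)) \<in> Reg X U" by (intro swf_mult[OF X U]) auto
  then show ?case using insert by simp
qed (simp_all add: swf_const[OF X U])

text \<open>The Leibniz expansion writes a determinant as a polynomial in its entries. Through this
  rule the Plucker coordinates of a matrix with regular entries are regular.\<close>

lemma swf_det:
  assumes X: "space_with_functions X" and U: "openin (Top X) U"
    and A: "\<And>i l. i < m \<Longrightarrow> l < m \<Longrightarrow> (\<lambda>x. A x i l) \<in> Reg X U"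
  shows "(\<lambda>x. det (mat m m (\<lambda>(i, l). A x i l))) \<in> Reg X U"
proof -
  have eq: "det (mat m m (\<lambda>(i, l). A x i l)) =
      (\<Sum>p | p permutes {0..<m}. signof p * (\<Prod>i = 0..<m. A x i (p i)))" for x
  proof -
    have "(\<Prod>i = 0..<m. mat m m (\<lambda>(i, l). A x i l) $$ (i, p i)) = (\<Prod>i = 0..<m. A x i (p i))"
      if "p permutes {0..<m}" for p
      using permutes_in_image[OF that] by (intro prod.cong) auto
    then show ?thesis
      by (subst det_def'[of _ m]) (auto intro!: sum.cong)
  qed
  have "(\<lambda>x. A x i (p i)) \<in> Reg X U" if "p permutes {0..<m}" "i \<in> {0..<m}" for p i
    using A permutes_in_image[OF that(1)] that by auto
  then show ?thesis unfolding eq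
    by (intro swf_sum[OF X U] swf_mult[OF X U] swf_prod[OF X U] swf_const[OF X U]) auto
qed

lemma swf_nonzero_all_open:
  assumes X: "space_with_functions X" and U: "openin (Top X) U" and "finite K"
    and f: "\<And>k. k \<in> K \<Longrightarrow> f k \<in> Reg X U"
  shows "openin (Top X) {x\<in>U. \<forall>k\<in>K. f k x \<noteq> 0}"
proof -
  have "openin (Top X) {x\<in>U. (\<Prod>k\<in>K. f k x) \<noteq> 0}"
    by (rule swf_nonzero_open[OF X U swf_prod[OF X U f]])
  then show ?thesis using \<open>finite K\<close> by simp
qed

text \<open>Separates a point from an orbit: an invariant that is c on the orbit and differs from c
  at the point gives a neighbourhood of the point that avoids the orbit.\<close>

lemma swf_neq_open:
  assumes X: "space_with_functions X" and U: "openin (Top X) U" and f: "f \<in> Reg X U"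
  shows "openin (Top X) {x\<in>U. f x \<noteq> c}"
proof -
  have "openin (Top X) {x\<in>U. f x + (- c) \<noteq> 0}"
    by (rule swf_nonzero_open[OF X U swf_add[OF X U f swf_const[OF X U]]])
  then show ?thesis by (simp add: eq_neg_iff_add_eq_0[symmetric])
qed

section \<open>Open subspaces and morphisms\<close>

lemma openin_subspace:
  assumes "openin (Top X) U"
  shows "openin (Top (open_subspace X U)) V \<longleftrightarrow> openin (Top X) V \<and> V \<subseteq> U"
  using assms by (auto simp: open_subspace_def openin_open_subtopology)

lemma pts_subspace: "openin (Top X) U \<Longrightarrow> pts (open_subspace X U) = U"
  using openin_subset by (fastforce simp: open_subspace_def)

lemma Reg_subspace [simp]: "Reg (open_subspace X U) = Reg X"
  by (simp add: open_subspace_def)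

lemma swf_open_subspace:
  assumes X: "space_with_functions X" and U: "openin (Top X) U"
  shows "space_with_functions (open_subspace X U)"
  unfolding space_with_functions_def
proof (intro allI impI conjI ballI)
  fix W assume W': "openin (Top (open_subspace X U)) W"
  then have W: "openin (Top X) W" "W \<subseteq> U" using openin_subspace[OF U] by auto
  { fix f g assume "f \<in> Reg (open_subspace X U) W" "\<forall>x\<in>W. f x = g x"
    then show "g \<in> Reg (open_subspace X U) W" using swf_cong[OF X W(1), of f g] by simp }
  { fix f V assume "f \<in> Reg (open_subspace X U) W" "openin (Top (open_subspace X U)) V" "V \<subseteq> W"
    then show "f \<in> Reg (open_subspace X U) V"
      using swf_mono[OF X W(1)] openin_subspace[OF U] by simp }
  { fix f assume "\<forall>x\<in>W. \<exists>V. openin (Top (open_subspace X U)) V \<and> x \<in> V \<and> V \<subseteq> W \<and>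
      f \<in> Reg (open_subspace X U) V"
    then show "f \<in> Reg (open_subspace X U) W"
      using swf_local[OF X W(1), of f] openin_subspace[OF U] by fastforce }
  { fix c show "(\<lambda>_. c) \<in> Reg (open_subspace X U) W" using swf_const[OF X W(1)] by simp }
  { fix f g assume "f \<in> Reg (open_subspace X U) W" "g \<in> Reg (open_subspace X U) W"
    then show "(\<lambda>x. f x + g x) \<in> Reg (open_subspace X U) W"
      and "(\<lambda>x. f x * g x) \<in> Reg (open_subspace X U) W"
      using swf_add[OF X W(1)] swf_mult[OF X W(1)] by simp_all }
  { fix f assume "f \<in> Reg (open_subspace X U) W"
    then show "openin (Top (open_subspace X U)) {x \<in> W. f x \<noteq> 0}"
      and "(\<lambda>x. 1 / f x) \<in> Reg (open_subspace X U) {x \<in> W. f x \<noteq> 0}"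
      using swf_nonzero_open[OF X W(1)] swf_inverse[OF X W(1)] W(2) openin_subspace[OF U] by auto }
qed

lemma fs_morphismD:
  assumes "fs_morphism X Z f"
  shows "x \<in> pts X \<Longrightarrow> f x \<in> pts Z"
    and "openin (Top Z) U \<Longrightarrow> openin (Top X) {x\<in>pts X. f x \<in> U}"
    and "openin (Top Z) U \<Longrightarrow> h \<in> Reg Z U \<Longrightarrow> (\<lambda>x. h (f x)) \<in> Reg X {x\<in>pts X. f x \<in> U}"
  using assms unfolding fs_morphism_def continuous_map_def by (auto simp: comp_def)

lemma fs_morphism_comp:
  assumes f: "fs_morphism X Y f" and g: "fs_morphism Y Z g"
  shows "fs_morphism X Z (\<lambda>x. g (f x))"
  unfolding fs_morphism_def
proof (intro conjI allI impI)
  show "continuous_map (Top X) (Top Z) (\<lambda>x. g (f x))"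
    using continuous_map_compose[of "Top X" "Top Y" f "Top Z" g] f g
    by (simp add: fs_morphism_def comp_def)
  fix U h assume U: "openin (Top Z) U" and h: "h \<in> Reg Z U"
  have "(\<lambda>x. h (g (f x))) \<in> Reg X {x\<in>pts X. f x \<in> {y\<in>pts Y. g y \<in> U}}"
    using fs_morphismD(3)[OF f fs_morphismD(2)[OF g U] fs_morphismD(3)[OF g U h]] .
  moreover have "{x\<in>pts X. f x \<in> {y\<in>pts Y. g y \<in> U}} = {x \<in> pts X. g (f x) \<in> U}"
    using fs_morphismD(1)[OF f] by auto
  ultimately show "h \<circ> (\<lambda>x. g (f x)) \<in> Reg X {x \<in> pts X. g (f x) \<in> U}"
    by (simp add: comp_def)
qed

lemma fs_morphism_subspace:
  assumes X: "space_with_functions X" and U: "openin (Top X) U" and f: "fs_morphism X Z f"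
  shows "fs_morphism (open_subspace X U) Z f"
  unfolding fs_morphism_def
proof (intro conjI allI impI)
  show "continuous_map (Top (open_subspace X U)) (Top Z) f"
    using f by (simp add: fs_morphism_def open_subspace_def continuous_map_from_subtopology)
  fix W h assume W: "openin (Top Z) W" "h \<in> Reg Z W"
  have "{x \<in> U. f x \<in> W} = U \<inter> {x\<in>pts X. f x \<in> W}" using openin_subset[OF U] by auto
  moreover have "(\<lambda>x. h (f x)) \<in> Reg X (U \<inter> {x\<in>pts X. f x \<in> W})"
    by (rule swf_mono[OF X fs_morphismD(2)[OF f W(1)] fs_morphismD(3)[OF f W]])
      (auto intro: openin_Int U fs_morphismD(2)[OF f W(1)])
  ultimately show "h \<circ> f \<in> Reg (open_subspace X U) {x \<in> pts (open_subspace X U). f x \<in> W}"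
    by (simp add: pts_subspace[OF U] comp_def)
qed

lemma fs_morphism_into_subspace:
  assumes Z: "openin (Top Z) W" and f: "fs_morphism X Z f" and im: "\<And>x. x \<in> pts X \<Longrightarrow> f x \<in> W"
  shows "fs_morphism X (open_subspace Z W) f"
  using f im unfolding fs_morphism_def
  by (auto simp: open_subspace_def continuous_map_in_subtopology openin_open_subtopology[OF Z])

section \<open>Products\<close>

text \<open>Intersection-stable generators form a base, so openness becomes a pointwise test with
  one generator. The generators of the product topology and of the Zariski topology are both stable:
  two functions are nonzero exactly where their product is.\<close>

lemma openin_generated_by_basis:
  assumes Int: "\<And>A B. A \<in> S \<Longrightarrow> B \<in> S \<Longrightarrow> A \<inter> B \<in> S"
  shows "openin (topology_generated_by S) U \<longleftrightarrow> (\<forall>x\<in>U. \<exists>B\<in>S. x \<in> B \<and> B \<subseteq> U)"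
proof
  assume "openin (topology_generated_by S) U"
  then have "generate_topology_on S U" by (simp add: openin_topology_generated_by_iff)
  then show "\<forall>x\<in>U. \<exists>B\<in>S. x \<in> B \<and> B \<subseteq> U"
  proof induction
    case (Int a b)
    show ?case
    proof
      fix x assume "x \<in> a \<inter> b"
      then obtain A B where "A \<in> S" "x \<in> A" "A \<subseteq> a" "B \<in> S" "x \<in> B" "B \<subseteq> b" using Int.IH by blast
      then show "\<exists>B\<in>S. x \<in> B \<and> B \<subseteq> a \<inter> b" using assms by (intro bexI[of _ "A \<inter> B"]) auto
    qed
  next
    case (UN K)
    then show ?case by (meson UnionE Union_upper subset_trans)
  next
    case (Basis s)
    then show ?case by blast
  qed simp
next
  assume R: "\<forall>x\<in>U. \<exists>B\<in>S. x \<in> B \<and> B \<subseteq> U"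
  have "openin (topology_generated_by S) (\<Union>{B\<in>S. B \<subseteq> U})"
    by (intro openin_Union) (auto intro: topology_generated_by_Basis)
  moreover have "\<Union>{B\<in>S. B \<subseteq> U} = U" using R by blast
  ultimately show "openin (topology_generated_by S) U" by simp
qed

lemma tensor_append: "tensor (fs @ gs) x = tensor fs x + tensor gs x"
  by (simp add: tensor_def)

text \<open>Multiplication in the tensor product of two function algebras, carried out on lists of
  pure tensors.\<close>

definition tensor_mult where
  "tensor_mult fs gs = concat (map (\<lambda>(f, g). map (\<lambda>(f', g'). (\<lambda>x. f x * f' x, \<lambda>z. g z * g' z)) gs) fs)"

lemma tensor_mult: "tensor (tensor_mult fs gs) x = tensor fs x * tensor gs x"
proof (induction fs)
  case Nil then show ?case by (simp add: tensor_mult_def tensor_def)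
next
  case (Cons p fs)
  obtain f g where p: "p = (f, g)" by (cases p)
  have "tensor (map (\<lambda>(f', g'). (\<lambda>x. f x * f' x, \<lambda>z. g z * g' z)) gs) x =
      f (fst x) * g (snd x) * tensor gs x"
    by (induction gs) (auto simp: tensor_def algebra_simps)
  then have "tensor (tensor_mult (p # fs) gs) x =
     f (fst x) * g (snd x) * tensor gs x + tensor (tensor_mult fs gs) x"
    unfolding tensor_mult_def by (simp add: tensor_append p)
  also have "tensor (tensor_mult fs gs) x = tensor fs x * tensor gs x" by (rule Cons)
  finally show ?case by (simp add: tensor_def p algebra_simps)
qed

section \<open>Products of two spaces with functions\<close>

locale fs_product =
  fixes X :: "'a fspace" and Z :: "'b fspace"
  assumes X: "space_with_functions X" and Z: "space_with_functions Z"
begin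

definition box :: "'a set \<Rightarrow> 'b set \<Rightarrow> bool" where
  "box U W \<longleftrightarrow> openin (Top X) U \<and> openin (Top Z) W"

lemma box_Int: "box U W \<Longrightarrow> box U' W' \<Longrightarrow> box (U \<inter> U') (W \<inter> W')"
  unfolding box_def by auto

lemma tensor_mult_Reg:
  assumes "box U W" "set fs \<subseteq> Reg X U \<times> Reg Z W" "set gs \<subseteq> Reg X U \<times> Reg Z W"
  shows "set (tensor_mult fs gs) \<subseteq> Reg X U \<times> Reg Z W"
proof
  fix p assume "p \<in> set (tensor_mult fs gs)"
  then obtain f g f' g' where p: "p = (\<lambda>x. f x * f' x, \<lambda>z. g z * g' z)"
    and "(f, g) \<in> set fs" "(f', g') \<in> set gs"
    by (auto simp: tensor_mult_def)
  then have "f \<in> Reg X U" "g \<in> Reg Z W" "f' \<in> Reg X U" "g' \<in> Reg Z W"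
    using assms by auto
  then show "p \<in> Reg X U \<times> Reg Z W"
    using assms(1) unfolding p box_def by (auto intro: swf_mult[OF X] swf_mult[OF Z])
qed

lemma tensor_mono_Reg:
  assumes "box U W" "set fs \<subseteq> Reg X U \<times> Reg Z W" "box U' W'" "U' \<subseteq> U" "W' \<subseteq> W"
  shows "set fs \<subseteq> Reg X U' \<times> Reg Z W'"
proof
  fix p assume p: "p \<in> set fs"
  obtain f g where p': "p = (f, g)" by (cases p)
  then have "f \<in> Reg X U" "g \<in> Reg Z W" using p assms(2) by auto
  then have "f \<in> Reg X U'" "g \<in> Reg Z W'"
    using swf_mono[OF X, of U f U'] swf_mono[OF Z, of W g W'] assms(1,3-5) by (auto simp: box_def)
  then show "p \<in> Reg X U' \<times> Reg Z W'" by (simp add: p')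
qed

definition nbhd :: "('a \<times> 'b) set \<Rightarrow> 'a \<times> 'b \<Rightarrow> 'a set \<Rightarrow> 'b set \<Rightarrow>
    (('a \<Rightarrow> complex) \<times> ('b \<Rightarrow> complex)) list \<Rightarrow> bool" where
  "nbhd D x U W e \<longleftrightarrow> box U W \<and> set e \<subseteq> Reg X U \<times> Reg Z W \<and>
     x \<in> prod_basic U W e \<and> prod_basic U W e \<subseteq> D"

definition frac :: "('a \<times> 'b \<Rightarrow> complex) \<Rightarrow> ('a \<times> 'b) set \<Rightarrow> 'a \<times> 'b \<Rightarrow> 'a set \<Rightarrow> 'b set \<Rightarrow>
    (('a \<Rightarrow> complex) \<times> ('b \<Rightarrow> complex)) list \<Rightarrow> (('a \<Rightarrow> complex) \<times> ('b \<Rightarrow> complex)) list \<Rightarrow> bool" where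
  "frac h D x U W num den \<longleftrightarrow> box U W \<and> set num \<subseteq> Reg X U \<times> Reg Z W \<and>
     set den \<subseteq> Reg X U \<times> Reg Z W \<and> x \<in> prod_basic U W den \<and>
     (\<forall>y \<in> D \<inter> prod_basic U W den. h y = tensor num y / tensor den y)"

lemma openin_prod_iff:
  "openin (Top (fs_prod X Z)) D \<longleftrightarrow> (\<forall>x\<in>D. \<exists>U W e. nbhd D x U W e)"
proof -
  let ?S = "{prod_basic U W fgs | U W fgs.
       openin (Top X) U \<and> openin (Top Z) W \<and> set fgs \<subseteq> Reg X U \<times> Reg Z W}"
  have "A \<inter> B \<in> ?S" if A: "A \<in> ?S" and B: "B \<in> ?S" for A B
  proof -
    from A obtain U W fs where A: "A = prod_basic U W fs" "box U W" "set fs \<subseteq> Reg X U \<times> Reg Z W"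
      unfolding box_def by blast
    from B obtain U' W' gs where B: "B = prod_basic U' W' gs" "box U' W'"
      "set gs \<subseteq> Reg X U' \<times> Reg Z W'"
      unfolding box_def by blast
    have "A \<inter> B = prod_basic (U \<inter> U') (W \<inter> W') (tensor_mult fs gs)"
      unfolding A B prod_basic_def by (auto simp: tensor_mult)
    moreover have "set (tensor_mult fs gs) \<subseteq> Reg X (U \<inter> U') \<times> Reg Z (W \<inter> W')"
      by (intro tensor_mult_Reg box_Int A B tensor_mono_Reg[OF A(2,3)] tensor_mono_Reg[OF B(2,3)]) auto
    ultimately show ?thesis using box_Int[OF A(2) B(2)] unfolding box_def by blast
  qed
  from openin_generated_by_basis[of ?S, OF this]
  have "openin (Top (fs_prod X Z)) D \<longleftrightarrow> (\<forall>x\<in>D. \<exists>B\<in>?S. x \<in> B \<and> B \<subseteq> D)"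
    unfolding fs_prod_def by simp
  moreover have "(\<exists>B\<in>?S. x \<in> B \<and> B \<subseteq> D) \<longleftrightarrow> (\<exists>U W e. nbhd D x U W e)" for x
    unfolding nbhd_def box_def by auto
  ultimately show ?thesis by simp
qed

lemma openin_prod_basic:
  assumes "box U W" "set fgs \<subseteq> Reg X U \<times> Reg Z W"
  shows "openin (Top (fs_prod X Z)) (prod_basic U W fgs)"
proof -
  have "nbhd (prod_basic U W fgs) x U W fgs" if "x \<in> prod_basic U W fgs" for x
    unfolding nbhd_def using assms that by simp
  then show ?thesis unfolding openin_prod_iff by blast
qed

lemma one_Reg: "box U W \<Longrightarrow> set [(\<lambda>_. c, \<lambda>_. 1)] \<subseteq> Reg X U \<times> Reg Z W"
  using swf_const[OF X] swf_const[OF Z] by (auto simp: box_def)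

lemma openin_Times:
  assumes "box U W" shows "openin (Top (fs_prod X Z)) (U \<times> W)"
proof -
  have "prod_basic U W [(\<lambda>_. 1, \<lambda>_. 1)] = U \<times> W" by (auto simp: prod_basic_def tensor_def)
  then show ?thesis using openin_prod_basic[OF assms one_Reg[OF assms]] by metis
qed

lemma pts_prod: "pts (fs_prod X Z) = pts X \<times> pts Z"
proof
  show "pts (fs_prod X Z) \<subseteq> pts X \<times> pts Z"
  proof
    fix x assume "x \<in> pts (fs_prod X Z)"
    then obtain U W e where "nbhd (pts (fs_prod X Z)) x U W e"
      using openin_prod_iff[of "pts (fs_prod X Z)"] by auto
    then show "x \<in> pts X \<times> pts Z"
      unfolding nbhd_def box_def prod_basic_def by (auto dest: openin_subset)
  qed
  show "pts X \<times> pts Z \<subseteq> pts (fs_prod X Z)"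
    by (rule openin_subset, rule openin_Times) (simp add: box_def)
qed

lemma Reg_prod_iff:
  "h \<in> Reg (fs_prod X Z) D \<longleftrightarrow> (\<forall>x\<in>D. \<exists>U W num den. frac h D x U W num den)"
  unfolding fs_prod_def box_def frac_def by simp

text \<open>Numerator and denominator are multiplied by the same tensor \<open>e\<close>, which
  shrinks the domain of the fraction and keeps its value. With \<open>e\<close> the denominator of a
  second function, both functions get fractions on one domain; with \<open>e\<close> the equation of
  a basic open set, the domain moves inside a given open set.\<close>

lemma frac_refine:
  assumes 1: "frac h D x U W num den" and b: "box U' W'" and e: "set e \<subseteq> Reg X U' \<times> Reg Z W'"
    and x: "x \<in> prod_basic U' W' e"
  shows "frac h D x (U \<inter> U') (W \<inter> W') (tensor_mult num e) (tensor_mult den e)"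
proof -
  note 1 = 1[unfolded frac_def]
  have bb: "box U W" using 1 by simp
  note bi = box_Int[OF bb b]
  note m1 = tensor_mono_Reg[OF bb _ bi Int_lower1 Int_lower1]
  note m2 = tensor_mono_Reg[OF b _ bi Int_lower2 Int_lower2]
  have "x \<in> prod_basic (U \<inter> U') (W \<inter> W') (tensor_mult den e)"
    using 1 x by (auto simp: prod_basic_def tensor_mult)
  moreover have "\<forall>y \<in> D \<inter> prod_basic (U \<inter> U') (W \<inter> W') (tensor_mult den e).
      h y = tensor (tensor_mult num e) y / tensor (tensor_mult den e) y"
    using 1 by (auto simp: prod_basic_def tensor_mult)
  moreover have n: "set num \<subseteq> Reg X U \<times> Reg Z W" and d: "set den \<subseteq> Reg X U \<times> Reg Z W"
    using 1 by simp_all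
  ultimately show ?thesis unfolding frac_def using bi
      tensor_mult_Reg[OF bi m1[OF n] m2[OF e]] tensor_mult_Reg[OF bi m1[OF d] m2[OF e]] by simp
qed

lemma frac_mono: "frac h D x U W num den \<Longrightarrow> V \<subseteq> D \<Longrightarrow> frac h V x U W num den"
  unfolding frac_def by blast

lemma frac_cong: "frac h D x U W num den \<Longrightarrow> (\<And>y. y \<in> D \<Longrightarrow> h y = g y) \<Longrightarrow> frac g D x U W num den"
  unfolding frac_def by (metis IntD1)

lemma swf_fs_prod: "space_with_functions (fs_prod X Z)"
  unfolding space_with_functions_def
proof (intro allI impI conjI ballI)
  let ?P = "fs_prod X Z"
  fix D assume D: "openin (Top ?P) D"
  have Dsub: "D \<subseteq> pts X \<times> pts Z" using openin_subset[OF D] pts_prod by simp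
  have loc2: "\<exists>U W nf df ng dg. frac f D x U W nf df \<and> frac g D x U W ng dg"
    if f: "f \<in> Reg ?P D" and g: "g \<in> Reg ?P D" and x: "x \<in> D" for f g x
  proof -
    obtain U W nf df where 1: "frac f D x U W nf df" using f x unfolding Reg_prod_iff by blast
    obtain U' W' ng dg where 2: "frac g D x U' W' ng dg" using g x unfolding Reg_prod_iff by blast
    have "frac f D x (U \<inter> U') (W \<inter> W') (tensor_mult nf dg) (tensor_mult df dg)"
      by (rule frac_refine[OF 1]) (use 2 in \<open>simp_all add: frac_def\<close>)
    moreover have "frac g D x (U' \<inter> U) (W' \<inter> W) (tensor_mult ng df) (tensor_mult dg df)"
      by (rule frac_refine[OF 2]) (use 1 in \<open>simp_all add: frac_def\<close>)
    ultimately show ?thesis by (auto simp: Int_commute)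
  qed
  have locnb: "\<exists>U W n d. frac f V x U W n d \<and> prod_basic U W d \<subseteq> V"
    if f: "f \<in> Reg ?P V" and x: "x \<in> V" and V: "openin (Top ?P) V" for f V x
  proof -
    obtain U W num den where 1: "frac f V x U W num den" using f x unfolding Reg_prod_iff by blast
    obtain U' W' e where 2: "nbhd V x U' W' e" using V x openin_prod_iff by blast
    have "frac f V x (U \<inter> U') (W \<inter> W') (tensor_mult num e) (tensor_mult den e)"
      by (rule frac_refine[OF 1]) (use 2 in \<open>simp_all add: nbhd_def\<close>)
    moreover have "prod_basic (U \<inter> U') (W \<inter> W') (tensor_mult den e) \<subseteq> V"
      using 2 by (auto simp: nbhd_def prod_basic_def tensor_mult)
    ultimately show ?thesis by blast
  qed
  { fix f g assume f: "f \<in> Reg ?P D" and eq: "\<forall>x\<in>D. f x = g x"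
    show "g \<in> Reg ?P D"
      using f frac_cong[of f D _ _ _ _ _ g] eq unfolding Reg_prod_iff by blast }
  { fix f V assume f: "f \<in> Reg ?P D" and V: "openin (Top ?P) V" "V \<subseteq> D"
    show "f \<in> Reg ?P V"
      using f frac_mono[of f D _ _ _ _ _ V] V unfolding Reg_prod_iff by blast }
  { fix f assume loc: "\<forall>x\<in>D. \<exists>V. openin (Top ?P) V \<and> x \<in> V \<and> V \<subseteq> D \<and> f \<in> Reg ?P V"
    show "f \<in> Reg ?P D" unfolding Reg_prod_iff
    proof
      fix x assume x: "x \<in> D"
      then obtain V where V: "openin (Top ?P) V" "x \<in> V" "V \<subseteq> D" "f \<in> Reg ?P V" using loc by blast
      obtain U W n d where "frac f V x U W n d" "prod_basic U W d \<subseteq> V"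
        using locnb[OF V(4,2,1)] by blast
      \<comment> \<open>The nonvanishing locus of \<open>d\<close> lies inside V, so the formula
        valid on V holds on all of D where \<open>d\<close> is nonzero.\<close>
      then have "frac f D x U W n d" unfolding frac_def by auto
      then show "\<exists>U W n d. frac f D x U W n d" by blast
    qed }
  { fix c show "(\<lambda>_. c) \<in> Reg ?P D" unfolding Reg_prod_iff
    proof
      fix x assume x: "x \<in> D"
      have b: "box (pts X) (pts Z)" by (simp add: box_def)
      have "frac (\<lambda>_. c) D x (pts X) (pts Z) [(\<lambda>_. c, \<lambda>_. 1)] [(\<lambda>_. 1, \<lambda>_. 1)]"
        unfolding frac_def using b one_Reg[OF b] x Dsub by (auto simp: prod_basic_def tensor_def)
      then show "\<exists>U W num den. frac (\<lambda>_. c) D x U W num den" by blast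
    qed }
  { fix f g assume f: "f \<in> Reg ?P D" and g: "g \<in> Reg ?P D"
    have key: "\<exists>U W num den. frac (\<lambda>x. f x + g x) D x U W num den"
      "\<exists>U W num den. frac (\<lambda>x. f x * g x) D x U W num den" if x: "x \<in> D" for x
    proof -
      obtain U W nf df ng dg where "frac f D x U W nf df" "frac g D x U W ng dg"
        using loc2[OF f g x] by blast
      note fr = this[unfolded frac_def]
      have b: "box U W" using fr by simp
      note tm = tensor_mult_Reg[OF b]
      have "frac (\<lambda>x. f x + g x) D x U W (tensor_mult nf dg @ tensor_mult ng df) (tensor_mult df dg)"
        unfolding frac_def using fr tm[of nf dg] tm[of ng df] tm[of df dg]
        by (simp add: tensor_append tensor_mult prod_basic_def add_frac_eq)
      then show "\<exists>U W num den. frac (\<lambda>x. f x + g x) D x U W num den" by blast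
      have "frac (\<lambda>x. f x * g x) D x U W (tensor_mult nf ng) (tensor_mult df dg)"
        unfolding frac_def using fr tm[of nf ng] tm[of df dg]
        by (simp add: tensor_append tensor_mult prod_basic_def)
      then show "\<exists>U W num den. frac (\<lambda>x. f x * g x) D x U W num den" by blast
    qed
    show "(\<lambda>x. f x + g x) \<in> Reg ?P D" and "(\<lambda>x. f x * g x) \<in> Reg ?P D"
      unfolding Reg_prod_iff using key by simp_all }
  { fix f assume f: "f \<in> Reg ?P D"
    have loc: "\<exists>U W n d. frac f D x U W n d \<and> nbhd {x \<in> D. f x \<noteq> 0} x U W (tensor_mult n d)"
      if x: "x \<in> D" "f x \<noteq> 0" for x
    proof -
      obtain U W n d where 1: "frac f D x U W n d" "prod_basic U W d \<subseteq> D"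
        using locnb[OF f x(1) D] by blast
      note fr = 1(1)[unfolded frac_def]
      have "nbhd {x \<in> D. f x \<noteq> 0} x U W (tensor_mult n d)"
        unfolding nbhd_def using fr x 1(2) tensor_mult_Reg[of U W n d]
        by (auto simp: prod_basic_def tensor_mult)
      then show ?thesis using 1 by blast
    qed
    show "openin (Top ?P) {x \<in> D. f x \<noteq> 0}" unfolding openin_prod_iff using loc by blast
    show "(\<lambda>x. 1 / f x) \<in> Reg ?P {x \<in> D. f x \<noteq> 0}" unfolding Reg_prod_iff
    proof
      fix x assume "x \<in> {x \<in> D. f x \<noteq> 0}"
      then obtain U W n d where 1: "frac f D x U W n d" "nbhd {x \<in> D. f x \<noteq> 0} x U W (tensor_mult n d)"
        using loc by blast
      \<comment> \<open>The inverse of n / d is written d d / (n d): the extra factor d confines the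
        domain to points where the fraction for f is valid.\<close>
      have "frac (\<lambda>x. 1 / f x) {x \<in> D. f x \<noteq> 0} x U W (tensor_mult d d) (tensor_mult n d)"
        using 1 tensor_mult_Reg[of U W d d] unfolding frac_def nbhd_def
        by (simp add: prod_basic_def tensor_mult)
      then show "\<exists>U W n d. frac (\<lambda>x. 1 / f x) {x \<in> D. f x \<noteq> 0} x U W n d" by blast
    qed }
qed

section \<open>Projections and pairing\<close>

lemma Reg_fst:
  assumes f: "f \<in> Reg X U" and U: "openin (Top X) U" and D: "D \<subseteq> U \<times> pts Z"
  shows "(\<lambda>x. f (fst x)) \<in> Reg (fs_prod X Z) D"
  unfolding Reg_prod_iff
proof
  fix x assume "x \<in> D"
  then have "frac (\<lambda>x. f (fst x)) D x U (pts Z) [(f, \<lambda>_. 1)] [(\<lambda>_. 1, \<lambda>_. 1)]"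
    unfolding frac_def using D f U swf_const[OF X] swf_const[OF Z]
    by (auto simp: box_def prod_basic_def tensor_def)
  then show "\<exists>U W n d. frac (\<lambda>x. f (fst x)) D x U W n d" by blast
qed

lemma Reg_snd:
  assumes f: "f \<in> Reg Z W" and W: "openin (Top Z) W" and D: "D \<subseteq> pts X \<times> W"
  shows "(\<lambda>x. f (snd x)) \<in> Reg (fs_prod X Z) D"
  unfolding Reg_prod_iff
proof
  fix x assume "x \<in> D"
  then have "frac (\<lambda>x. f (snd x)) D x (pts X) W [(\<lambda>_. 1, f)] [(\<lambda>_. 1, \<lambda>_. 1)]"
    unfolding frac_def using D f W swf_const[OF X] swf_const[OF Z]
    by (auto simp: box_def prod_basic_def tensor_def)
  then show "\<exists>U W n d. frac (\<lambda>x. f (snd x)) D x U W n d" by blast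
qed

text \<open>A tensor pulled back along the pair is a sum of products of pulled back functions, hence
  regular; nonvanishing loci and fractions of tensors follow.\<close>

lemma fs_morphism_Pair:
  assumes S: "space_with_functions S" and f: "fs_morphism S X f" and g: "fs_morphism S Z g"
  shows "fs_morphism S (fs_prod X Z) (\<lambda>s. (f s, g s))"
proof -
  have tens: "(\<lambda>s. tensor fgs (f s, g s)) \<in> Reg S {s\<in>pts S. f s \<in> U \<and> g s \<in> W}"
    and opn: "openin (Top S) {s\<in>pts S. f s \<in> U \<and> g s \<in> W}"
    if b: "box U W" and fgs: "set fgs \<subseteq> Reg X U \<times> Reg Z W" for U W fgs
  proof -
    let ?D = "{s\<in>pts S. f s \<in> U \<and> g s \<in> W}"
    have U: "openin (Top X) U" and W: "openin (Top Z) W" using b by (auto simp: box_def)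
    have eq: "?D = {s\<in>pts S. f s \<in> U} \<inter> {s\<in>pts S. g s \<in> W}" by auto
    show D: "openin (Top S) ?D" unfolding eq
      by (intro openin_Int fs_morphismD(2)[OF f U] fs_morphismD(2)[OF g W])
    show "(\<lambda>s. tensor fgs (f s, g s)) \<in> Reg S ?D"
      using fgs
    proof (induction fgs)
      case Nil then show ?case by (simp add: tensor_def swf_const[OF S D])
    next
      case (Cons p fgs)
      obtain u v where p: "p = (u, v)" by (cases p)
      then have uv: "u \<in> Reg X U" "v \<in> Reg Z W" using Cons by auto
      have "(\<lambda>s. u (f s)) \<in> Reg S ?D" "(\<lambda>s. v (g s)) \<in> Reg S ?D"
        by (rule swf_mono[OF S fs_morphismD(2)[OF f U] fs_morphismD(3)[OF f U uv(1)] D]; auto)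
          (rule swf_mono[OF S fs_morphismD(2)[OF g W] fs_morphismD(3)[OF g W uv(2)] D]; auto)
      moreover have "(\<lambda>s. tensor fgs (f s, g s)) \<in> Reg S ?D" using Cons by auto
      ultimately have "(\<lambda>s. u (f s) * v (g s) + tensor fgs (f s, g s)) \<in> Reg S ?D"
        by (intro swf_add[OF S D] swf_mult[OF S D])
      then show ?case by (simp add: p tensor_def)
    qed
  qed
  have pre: "openin (Top S) {s\<in>pts S. (f s, g s) \<in> prod_basic U W fgs}"
    if b: "box U W" and fgs: "set fgs \<subseteq> Reg X U \<times> Reg Z W" for U W fgs
  proof -
    have "{s\<in>pts S. (f s, g s) \<in> prod_basic U W fgs} =
      {s \<in> {s\<in>pts S. f s \<in> U \<and> g s \<in> W}. tensor fgs (f s, g s) \<noteq> 0}"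
      by (auto simp: prod_basic_def)
    then show ?thesis using swf_nonzero_open[OF S opn[OF that] tens[OF that]] by simp
  qed
  have pred: "openin (Top S) {s\<in>pts S. (f s, g s) \<in> D}" if D: "openin (Top (fs_prod X Z)) D" for D
  proof (subst openin_subopen, intro ballI)
    fix s assume s: "s \<in> {s\<in>pts S. (f s, g s) \<in> D}"
    then obtain U W fgs where "nbhd D (f s, g s) U W fgs"
      using D unfolding openin_prod_iff by blast
    then have "box U W" "set fgs \<subseteq> Reg X U \<times> Reg Z W"
      "(f s, g s) \<in> prod_basic U W fgs" "prod_basic U W fgs \<subseteq> D"
      unfolding nbhd_def by simp_all
    then show "\<exists>T. openin (Top S) T \<and> s \<in> T \<and> T \<subseteq> {s\<in>pts S. (f s, g s) \<in> D}"
      using s by (intro exI[of _ "{s\<in>pts S. (f s, g s) \<in> prod_basic U W fgs}"]) (auto intro: pre)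
  qed
  show ?thesis unfolding fs_morphism_def continuous_map_def
  proof (intro conjI allI impI)
    show "(\<lambda>s. (f s, g s)) \<in> pts S \<rightarrow> pts (fs_prod X Z)"
      using fs_morphismD(1)[OF f] fs_morphismD(1)[OF g] by (auto simp: pts_prod)
    show "openin (Top S) {s\<in>pts S. (f s, g s) \<in> D}" if "openin (Top (fs_prod X Z)) D" for D
      by (rule pred[OF that])
    fix D h assume D: "openin (Top (fs_prod X Z)) D" and h: "h \<in> Reg (fs_prod X Z) D"
    show "h \<circ> (\<lambda>s. (f s, g s)) \<in> Reg S {s \<in> pts S. (f s, g s) \<in> D}"
    proof (rule swf_local[OF S pred[OF D]])
      fix s assume s: "s \<in> {s \<in> pts S. (f s, g s) \<in> D}"
      then obtain U W num den where "frac h D (f s, g s) U W num den"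
        using h unfolding Reg_prod_iff by blast
      then have 1: "box U W" "set num \<subseteq> Reg X U \<times> Reg Z W"
        "set den \<subseteq> Reg X U \<times> Reg Z W" "(f s, g s) \<in> prod_basic U W den"
        "\<forall>y \<in> D \<inter> prod_basic U W den. h y = tensor num y / tensor den y"
        unfolding frac_def by simp_all
      let ?B = "{s\<in>pts S. (f s, g s) \<in> prod_basic U W den}"
      let ?V = "{s \<in> pts S. (f s, g s) \<in> D} \<inter> ?B"
      have V: "openin (Top S) ?V" by (intro openin_Int pred[OF D] pre[OF 1(1,3)])
      have sub: "?V \<subseteq> {s\<in>pts S. f s \<in> U \<and> g s \<in> W}" by (auto simp: prod_basic_def)
      have "(\<lambda>s. tensor num (f s, g s) / tensor den (f s, g s)) \<in> Reg S ?V"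
        by (rule swf_divide[OF S V])
          (use swf_mono[OF S opn[OF 1(1,2)] _ V sub] tens[OF 1(1,2)] tens[OF 1(1,3)] in
           \<open>auto simp: prod_basic_def\<close>)
      then have "h \<circ> (\<lambda>s. (f s, g s)) \<in> Reg S ?V"
        by (rule swf_cong[OF S V]) (use 1(5) in auto)
      then show "\<exists>V. openin (Top S) V \<and> s \<in> V \<and> V \<subseteq> {s \<in> pts S. (f s, g s) \<in> D} \<and>
           h \<circ> (\<lambda>s. (f s, g s)) \<in> Reg S V"
        using V s 1(4) by (intro exI[of _ ?V]) auto
    qed
  qed
qed

end

section \<open>Quasiprojective varieties\<close>

lemma line_iff: "u \<in> line v \<longleftrightarrow> (\<exists>c. c \<noteq> 0 \<and> u = (\<lambda>i. c * v i))"
  unfolding line_def by auto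

lemma in_line_self: "v \<in> line v"
  unfolding line_iff by (intro exI[of _ 1]) simp

lemma line_scale: assumes "c \<noteq> 0" shows "line (\<lambda>i. c * v i) = line v"
proof (rule equalityI; rule subsetI)
  fix u assume "u \<in> line (\<lambda>i. c * v i)"
  then obtain d where "d \<noteq> 0" "u = (\<lambda>i. d * (c * v i))" unfolding line_iff by auto
  then show "u \<in> line v" unfolding line_iff using assms
    by (intro exI[of _ "d * c"]) (auto simp: mult.assoc)
next
  fix u assume "u \<in> line v"
  then obtain d where "d \<noteq> 0" "u = (\<lambda>i. d * v i)" unfolding line_iff by auto
  then show "u \<in> line (\<lambda>i. c * v i)" unfolding line_iff using assms
    by (intro exI[of _ "d / c"]) auto
qed

lemma line_eq: "u \<in> line v \<Longrightarrow> line u = line v"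
  unfolding line_iff using line_scale by metis

lemma proj_point_vec:
  assumes "p \<in> proj_points I" "v \<in> p"
  shows "line v = p" and "\<exists>i\<in>I. v i \<noteq> 0" and "i \<notin> I \<Longrightarrow> v i = 0"
proof -
  obtain w where w: "p = line w" "\<forall>i. i \<notin> I \<longrightarrow> w i = 0" "\<exists>i\<in>I. w i \<noteq> 0"
    using assms(1) unfolding proj_points_def by auto
  then show "line v = p" using assms(2) line_eq by auto
  obtain c where "c \<noteq> 0" "v = (\<lambda>i. c * w i)" using assms(2) w(1) line_iff by auto
  then show "\<exists>i\<in>I. v i \<noteq> 0" "i \<notin> I \<Longrightarrow> v i = 0" using w by auto
qed

lemma line_in_proj_points:
  "line v \<in> proj_points I \<longleftrightarrow> (\<forall>i. i \<notin> I \<longrightarrow> v i = 0) \<and> (\<exists>i\<in>I. v i \<noteq> 0)"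
proof
  assume p: "line v \<in> proj_points I"
  show "(\<forall>i. i \<notin> I \<longrightarrow> v i = 0) \<and> (\<exists>i\<in>I. v i \<noteq> 0)"
    using proj_point_vec(2,3)[OF p in_line_self] by simp
qed (auto simp: proj_points_def)

lemma proj_point_ex: assumes "p \<in> proj_points I" obtains v where "p = line v"
  using assms unfolding proj_points_def by auto

lemma hpoly_scale: "hpoly I d F \<Longrightarrow> F (\<lambda>i. c * v i) = c ^ d * F v"
  by (induction rule: hpoly.induct) (auto simp: algebra_simps power_add)

lemma hpoly_eq_0_iff: "hpoly I d F \<Longrightarrow> c \<noteq> 0 \<Longrightarrow> F (\<lambda>i. c * v i) = 0 \<longleftrightarrow> F v = 0"
  by (simp add: hpoly_scale)

lemma hpoly_nonzero_on_line:
  assumes "hpoly I d F" shows "(\<forall>u\<in>line v. F u \<noteq> 0) \<longleftrightarrow> F v \<noteq> 0"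
proof
  assume "F v \<noteq> 0"
  then show "\<forall>u\<in>line v. F u \<noteq> 0" using hpoly_eq_0_iff[OF assms] by (auto simp: line_iff)
qed (simp add: in_line_self)

lemma hpoly_cong: "hpoly I d F \<Longrightarrow> (\<And>i. i \<in> I \<Longrightarrow> v i = w i) \<Longrightarrow> F v = F w"
  by (induction rule: hpoly.induct) auto

text \<open>The torus acts diagonally in Plucker coordinates, so this is how a form is transported
  by a torus element.\<close>

lemma hpoly_diagonal: "hpoly I d F \<Longrightarrow> hpoly I d (\<lambda>v. F (\<lambda>i. s i * v i))"
proof (induction rule: hpoly.induct)
  case (coord i)
  show ?case using hpoly.mult[OF hpoly.const[of I "s i"] hpoly.coord[OF coord]] by simp
qed (auto intro: hpoly.intros)

lemma hpoly_prod_power: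
  assumes "finite K" "\<And>k. k \<in> K \<Longrightarrow> g k \<in> I"
  shows "hpoly I (card K) (\<lambda>v. \<Prod>k\<in>K. v (g k))"
  using assms
proof (induction K rule: finite_induct)
  case empty then show ?case using hpoly.const[of I 1] by simp
next
  case (insert k K)
  then show ?case using hpoly.mult[OF hpoly.coord[of "g k" I] insert.IH] by simp
qed

lemma hpoly_power: "i \<in> I \<Longrightarrow> hpoly I m (\<lambda>v. v i ^ m)"
  using hpoly_prod_power[of "{..<m}" "\<lambda>_. i" I] by simp

text \<open>Forms are continuous for the ordinary topology. A limit along a one-parameter subgroup
  can therefore be compared with Zariski open sets.\<close>

lemma hpoly_tendsto:
  assumes "hpoly I d H" "\<And>i. i \<in> I \<Longrightarrow> ((\<lambda>t. y t i) \<longlongrightarrow> l i) \<F>"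
  shows "((\<lambda>t. H (y t)) \<longlongrightarrow> H l) \<F>"
  using assms by (induction rule: hpoly.induct) (auto intro: tendsto_intros)

lemma swf_hpoly:
  assumes X: "space_with_functions X" and U: "openin (Top X) U" and "hpoly I d F"
    and v: "\<And>i. i \<in> I \<Longrightarrow> (\<lambda>x. v x i) \<in> Reg X U"
  shows "(\<lambda>x. F (v x)) \<in> Reg X U"
  using assms(3)
  by (induction rule: hpoly.induct)
    (auto intro!: swf_const[OF X U] v swf_add[OF X U] swf_mult[OF X U])

section \<open>The Zariski topology and the regular functions on its subsets\<close>

definition nonvanishing :: "'i set \<Rightarrow> (('i \<Rightarrow> complex) \<Rightarrow> complex) \<Rightarrow> ('i \<Rightarrow> complex) set set" where
  "nonvanishing I F = {p \<in> proj_points I. \<forall>v\<in>p. F v \<noteq> 0}"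

lemma line_in_nonvanishing:
  "hpoly I d F \<Longrightarrow> line v \<in> nonvanishing I F \<longleftrightarrow> line v \<in> proj_points I \<and> F v \<noteq> 0"
  unfolding nonvanishing_def using hpoly_nonzero_on_line[of I d F v] by simp

lemma openin_zariski_iff:
  "openin (zariski I) U \<longleftrightarrow>
     (\<forall>p\<in>U. \<exists>d F. hpoly I d F \<and> p \<in> nonvanishing I F \<and> nonvanishing I F \<subseteq> U)"
proof -
  let ?S = "{{p \<in> proj_points I. \<forall>v\<in>p. F v \<noteq> 0} | F. \<exists>d. hpoly I d F}"
  have "A \<inter> B \<in> ?S" if "A \<in> ?S" "B \<in> ?S" for A B
  proof -
    from that(1) obtain F d where A: "A = {p \<in> proj_points I. \<forall>v\<in>p. F v \<noteq> 0}" "hpoly I d F"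
      by blast
    from that(2) obtain G e where B: "B = {p \<in> proj_points I. \<forall>v\<in>p. G v \<noteq> 0}" "hpoly I e G"
      by blast
    have "A \<inter> B = {p \<in> proj_points I. \<forall>v\<in>p. F v * G v \<noteq> 0}" unfolding A B by auto
    then show ?thesis using hpoly.mult[OF A(2) B(2)]
      by (intro CollectI exI[of _ "\<lambda>v. F v * G v"]) auto
  qed
  from openin_generated_by_basis[of ?S, OF this]
  have "openin (zariski I) U \<longleftrightarrow> (\<forall>x\<in>U. \<exists>B\<in>?S. x \<in> B \<and> B \<subseteq> U)"
    unfolding zariski_def by simp
  moreover have "(\<exists>B\<in>?S. p \<in> B \<and> B \<subseteq> U) \<longleftrightarrow>
      (\<exists>d F. hpoly I d F \<and> p \<in> nonvanishing I F \<and> nonvanishing I F \<subseteq> U)" (is "?L \<longleftrightarrow> ?R") for p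
  proof
    assume ?L
    then obtain B where "B \<in> ?S" "p \<in> B \<and> B \<subseteq> U" by (rule bexE)
    moreover from this(1) obtain F d where "B = nonvanishing I F" "hpoly I d F"
      unfolding nonvanishing_def by blast
    ultimately show ?R by (intro exI[of _ d] exI[of _ F]) simp
  next
    assume ?R
    then obtain d F where F: "hpoly I d F" "p \<in> nonvanishing I F \<and> nonvanishing I F \<subseteq> U" by (elim exE conjE) simp
    then have "nonvanishing I F \<in> ?S" unfolding nonvanishing_def by (intro CollectI exI[of _ F]) auto
    then show ?L using F(2) by (rule rev_bexI)
  qed
  ultimately show ?thesis by simp
qed

lemma openin_nonvanishing: "hpoly I d F \<Longrightarrow> openin (zariski I) (nonvanishing I F)"
  unfolding openin_zariski_iff by blast

lemma topspace_zariski: "topspace (zariski I) = proj_points I"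
proof
  show "topspace (zariski I) \<subseteq> proj_points I"
  proof
    fix p assume "p \<in> topspace (zariski I)"
    then obtain F where "p \<in> nonvanishing I F"
      using openin_zariski_iff[of I "topspace (zariski I)"] by auto
    then show "p \<in> proj_points I" unfolding nonvanishing_def by simp
  qed
  have "nonvanishing I (\<lambda>_. 1) = proj_points I" unfolding nonvanishing_def by auto
  then show "proj_points I \<subseteq> topspace (zariski I)"
    using openin_subset[OF openin_nonvanishing[OF hpoly.const[of I 1]]] by simp
qed

lemma pts_quasiprojective: "X \<subseteq> proj_points I \<Longrightarrow> pts (quasiprojective I X) = X"
  by (auto simp: quasiprojective_def topspace_zariski)

lemma openin_quasiprojective_subset:
  assumes "X \<subseteq> proj_points I" "openin (Top (quasiprojective I X)) U"
  shows "U \<subseteq> X" "U \<subseteq> proj_points I"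
proof -
  show "U \<subseteq> X" using openin_subset[OF assms(2)] by (simp add: pts_quasiprojective[OF assms(1)])
  then show "U \<subseteq> proj_points I" using assms(1) by (rule subset_trans)
qed

lemma openin_quasiprojective_iff:
  assumes "X \<subseteq> proj_points I"
  shows "openin (Top (quasiprojective I X)) U \<longleftrightarrow> U \<subseteq> X \<and>
     (\<forall>p\<in>U. \<exists>d F. hpoly I d F \<and> p \<in> nonvanishing I F \<and> X \<inter> nonvanishing I F \<subseteq> U)"
proof
  assume "openin (Top (quasiprojective I X)) U"
  then obtain S where S: "openin (zariski I) S" "U = S \<inter> X"
    by (auto simp: quasiprojective_def openin_subtopology)
  then show "U \<subseteq> X \<and> (\<forall>p\<in>U. \<exists>d F. hpoly I d F \<and> p \<in> nonvanishing I F \<and> X \<inter> nonvanishing I F \<subseteq> U)"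
    unfolding openin_zariski_iff by (meson Int_iff Int_greatest Int_lower1 Int_lower2 subset_trans subset_iff)
next
  assume R: "U \<subseteq> X \<and> (\<forall>p\<in>U. \<exists>d F. hpoly I d F \<and> p \<in> nonvanishing I F \<and> X \<inter> nonvanishing I F \<subseteq> U)"
  let ?S = "\<Union>{nonvanishing I F | F. (\<exists>d. hpoly I d F) \<and> X \<inter> nonvanishing I F \<subseteq> U}"
  have "openin (zariski I) ?S" by (rule openin_Union) (auto intro: openin_nonvanishing)
  moreover have "U = ?S \<inter> X" using R by blast
  ultimately show "openin (Top (quasiprojective I X)) U"
    by (auto simp: quasiprojective_def openin_subtopology)
qed

text \<open>The local condition of \<open>twist_sections\<close> in degree 0, read on points of
  projective space instead of vectors of the cone.\<close>

definition qfrac :: "'i set \<Rightarrow> (('i \<Rightarrow> complex) set \<Rightarrow> complex) \<Rightarrow> ('i \<Rightarrow> complex) set set \<Rightarrow>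
    ('i \<Rightarrow> complex) set \<Rightarrow> nat \<Rightarrow> (('i \<Rightarrow> complex) \<Rightarrow> complex) \<Rightarrow> (('i \<Rightarrow> complex) \<Rightarrow> complex) \<Rightarrow> bool" where
  "qfrac I h U p e F H \<longleftrightarrow> hpoly I e F \<and> hpoly I e H \<and> (\<forall>v\<in>p. H v \<noteq> 0) \<and>
     (\<forall>p'\<in>U. \<forall>v\<in>p'. H v \<noteq> 0 \<longrightarrow> h p' = F v / H v)"

lemma Reg_quasiprojective_iff:
  assumes "U \<subseteq> proj_points I"
  shows "h \<in> Reg (quasiprojective I X) U \<longleftrightarrow> (\<forall>p\<in>U. \<exists>e F H. qfrac I h U p e F H)"
proof -
  have "(\<forall>v\<in>\<Union>U. H v \<noteq> 0 \<longrightarrow> h (line v) = F v / H v) \<longleftrightarrow>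
      (\<forall>p'\<in>U. \<forall>v\<in>p'. H v \<noteq> 0 \<longrightarrow> h p' = F v / H v)" for F H
  proof -
    have "line v = p'" if "p' \<in> U" "v \<in> p'" for p' v using proj_point_vec(1) assms that by blast
    then show ?thesis by auto
  qed
  then show ?thesis
    unfolding quasiprojective_def twist_sections_def qfrac_def by simp
qed

lemma qfrac_mono: "qfrac I h U p e F H \<Longrightarrow> V \<subseteq> U \<Longrightarrow> qfrac I h V p e F H"
  unfolding qfrac_def by blast

lemma qfrac_mult:
  assumes "qfrac I h U p e F H" "hpoly I d K" "\<forall>v\<in>p. K v \<noteq> 0"
  shows "qfrac I h U p (e + d) (\<lambda>v. F v * K v) (\<lambda>v. H v * K v)"
  using assms unfolding qfrac_def by (auto intro: hpoly.mult)

lemma swf_quasiprojective: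
  assumes XI: "X \<subseteq> proj_points I"
  shows "space_with_functions (quasiprojective I X)"
  unfolding space_with_functions_def
proof (intro allI impI conjI ballI)
  let ?P = "quasiprojective I X"
  fix U assume U: "openin (Top ?P) U"
  note UX = openin_quasiprojective_subset(1)[OF XI U] and UI = openin_quasiprojective_subset(2)[OF XI U]
  note RU = Reg_quasiprojective_iff[OF UI, of _ X]
  have locnb: "\<exists>e F H. qfrac I f V p e F H \<and> X \<inter> nonvanishing I H \<subseteq> V"
    if f: "f \<in> Reg ?P V" and p: "p \<in> V" and V: "openin (Top ?P) V" for f V p
  proof -
    note VI = openin_quasiprojective_subset(2)[OF XI V]
    obtain e F H where 1: "qfrac I f V p e F H"
      using f p unfolding Reg_quasiprojective_iff[OF VI] by blast
    obtain d K where K: "hpoly I d K" "p \<in> nonvanishing I K" "X \<inter> nonvanishing I K \<subseteq> V"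
      using V p unfolding openin_quasiprojective_iff[OF XI] by blast
    have "qfrac I f V p (e + d) (\<lambda>v. F v * K v) (\<lambda>v. H v * K v)"
      by (rule qfrac_mult[OF 1 K(1)]) (use K(2) in \<open>auto simp: nonvanishing_def\<close>)
    moreover have "X \<inter> nonvanishing I (\<lambda>v. H v * K v) \<subseteq> V"
      using K(3) by (auto simp: nonvanishing_def)
    ultimately show ?thesis by blast
  qed
  { fix f g assume "f \<in> Reg ?P U" "\<forall>x\<in>U. f x = g x"
    then show "g \<in> Reg ?P U" unfolding RU qfrac_def by simp }
  { fix f V assume f: "f \<in> Reg ?P U" and V: "openin (Top ?P) V" "V \<subseteq> U"
    have VI: "V \<subseteq> proj_points I" using V UI by auto
    show "f \<in> Reg ?P V"
      using f V qfrac_mono[of I f U _ _ _ _ V] unfolding RU Reg_quasiprojective_iff[OF VI] by blast }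
  { fix f assume loc: "\<forall>x\<in>U. \<exists>V. openin (Top ?P) V \<and> x \<in> V \<and> V \<subseteq> U \<and> f \<in> Reg ?P V"
    show "f \<in> Reg ?P U" unfolding RU
    proof
      fix p assume p: "p \<in> U"
      then obtain V where V: "openin (Top ?P) V" "p \<in> V" "V \<subseteq> U" "f \<in> Reg ?P V" using loc by blast
      obtain e F H where 1: "qfrac I f V p e F H" "X \<inter> nonvanishing I H \<subseteq> V"
        using locnb[OF V(4,2,1)] by blast
      \<comment> \<open>The denominator H is nonzero on X only over V, so the formula known on V
        holds wherever H is nonzero over U.\<close>
      have "p' \<in> V" if "p' \<in> U" "v \<in> p'" "H v \<noteq> 0" for p' v
      proof -
        have "line v = p'" using proj_point_vec(1) UI that by blast
        then have "p' \<in> nonvanishing I H"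
          using line_in_nonvanishing[of I e H v] that 1(1) UI by (auto simp: qfrac_def)
        then show ?thesis using 1(2) UX that by auto
      qed
      then have "qfrac I f U p e F H" using 1(1) unfolding qfrac_def by blast
      then show "\<exists>e F H. qfrac I f U p e F H" by blast
    qed }
  { fix c
    have "qfrac I (\<lambda>_. c) U p 0 (\<lambda>_. c) (\<lambda>_. 1)" for p
      unfolding qfrac_def by (auto intro: hpoly.const)
    then show "(\<lambda>_. c) \<in> Reg ?P U" unfolding RU by blast }
  { fix f g assume f: "f \<in> Reg ?P U" and g: "g \<in> Reg ?P U"
    have key: "\<exists>e F H. qfrac I (\<lambda>x. f x + g x) U p e F H"
      "\<exists>e F H. qfrac I (\<lambda>x. f x * g x) U p e F H" if p: "p \<in> U" for p
    proof -
      obtain e F H where 1: "qfrac I f U p e F H" using f p unfolding RU by blast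
      obtain d G K where 2: "qfrac I g U p d G K" using g p unfolding RU by blast
      have "hpoly I (e + d) (\<lambda>v. G v * H v)"
        using hpoly.mult[of I d G e H] 1 2 unfolding qfrac_def by (simp add: add.commute)
      then have "qfrac I (\<lambda>x. f x + g x) U p (e + d) (\<lambda>v. F v * K v + G v * H v) (\<lambda>v. H v * K v)"
        using 1 2 unfolding qfrac_def by (auto intro: hpoly.intros simp: add_frac_eq)
      then show "\<exists>e F H. qfrac I (\<lambda>x. f x + g x) U p e F H" by blast
      have "qfrac I (\<lambda>x. f x * g x) U p (e + d) (\<lambda>v. F v * G v) (\<lambda>v. H v * K v)"
        using 1 2 unfolding qfrac_def by (auto intro: hpoly.intros)
      then show "\<exists>e F H. qfrac I (\<lambda>x. f x * g x) U p e F H" by blast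
    qed
    show "(\<lambda>x. f x + g x) \<in> Reg ?P U" and "(\<lambda>x. f x * g x) \<in> Reg ?P U"
      unfolding RU using key by simp_all }
  { fix f assume f: "f \<in> Reg ?P U"
    have NI: "{x \<in> U. f x \<noteq> 0} \<subseteq> proj_points I" using UI by auto
    have loc: "\<exists>e F H. qfrac I f U p e F H \<and> (\<forall>v\<in>p. F v \<noteq> 0) \<and>
        X \<inter> nonvanishing I (\<lambda>v. F v * H v) \<subseteq> {x \<in> U. f x \<noteq> 0}" if p: "p \<in> U" "f p \<noteq> 0" for p
    proof -
      obtain e F H where 1: "qfrac I f U p e F H" "X \<inter> nonvanishing I H \<subseteq> U"
        using locnb[OF f p(1) U] by blast
      have "X \<inter> nonvanishing I (\<lambda>v. F v * H v) \<subseteq> {x \<in> U. f x \<noteq> 0}"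
      proof
        fix p' assume p': "p' \<in> X \<inter> nonvanishing I (\<lambda>v. F v * H v)"
        then have "p' \<in> U" using 1(2) by (auto simp: nonvanishing_def)
        moreover obtain v where "p' = line v" using p' XI proj_point_ex by blast
        ultimately show "p' \<in> {x \<in> U. f x \<noteq> 0}"
          using p' 1(1) in_line_self[of v] by (auto simp: nonvanishing_def qfrac_def)
      qed
      moreover have "\<forall>v\<in>p. F v \<noteq> 0" using 1(1) p unfolding qfrac_def by auto
      ultimately show ?thesis using 1(1) by blast
    qed
    show "openin (Top ?P) {x \<in> U. f x \<noteq> 0}" unfolding openin_quasiprojective_iff[OF XI]
    proof (intro conjI ballI)
      show "{x \<in> U. f x \<noteq> 0} \<subseteq> X" using UX by auto
      fix p assume p: "p \<in> {x \<in> U. f x \<noteq> 0}"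
      then obtain e F H where 1: "qfrac I f U p e F H" "\<forall>v\<in>p. F v \<noteq> 0"
        "X \<inter> nonvanishing I (\<lambda>v. F v * H v) \<subseteq> {x \<in> U. f x \<noteq> 0}"
        using loc by blast
      have "hpoly I (e + e) (\<lambda>v. F v * H v)" using 1(1) by (auto simp: qfrac_def intro: hpoly.mult)
      moreover have "p \<in> nonvanishing I (\<lambda>v. F v * H v)"
        using 1 p UI by (auto simp: qfrac_def nonvanishing_def)
      ultimately show "\<exists>d F. hpoly I d F \<and> p \<in> nonvanishing I F \<and>
          X \<inter> nonvanishing I F \<subseteq> {x \<in> U. f x \<noteq> 0}" using 1(3) by blast
    qed
    show "(\<lambda>x. 1 / f x) \<in> Reg ?P {x \<in> U. f x \<noteq> 0}" unfolding Reg_quasiprojective_iff[OF NI]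
    proof
      fix p assume p: "p \<in> {x \<in> U. f x \<noteq> 0}"
      then obtain e F H where 1: "qfrac I f U p e F H" "\<forall>v\<in>p. F v \<noteq> 0" using loc by blast
      have "qfrac I (\<lambda>x. 1 / f x) {x \<in> U. f x \<noteq> 0} p (e + e) (\<lambda>v. H v * H v) (\<lambda>v. F v * H v)"
        using 1 unfolding qfrac_def by (auto intro: hpoly.mult)
      then show "\<exists>e F H. qfrac I (\<lambda>x. 1 / f x) {x \<in> U. f x \<noteq> 0} p e F H" by blast
    qed }
qed

text \<open>Forms in regular homogeneous coordinates are regular, so preimages of nonvanishing loci
  are open and fractions of forms pull back to fractions of regular functions.\<close>

lemma fs_morphism_to_quasiprojective:
  assumes S: "space_with_functions S" and XI: "X \<subseteq> proj_points I"
    and v: "\<And>i. i \<in> I \<Longrightarrow> (\<lambda>x. v x i) \<in> Reg S (pts S)"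
    and im: "\<And>x. x \<in> pts S \<Longrightarrow> line (v x) \<in> X"
  shows "fs_morphism S (quasiprojective I X) (\<lambda>x. line (v x))"
proof -
  have opn: "openin (Top S) (pts S)" by simp
  have nz: "openin (Top S) {x\<in>pts S. line (v x) \<in> nonvanishing I F}" if "hpoly I d F" for d F
  proof -
    have "{x\<in>pts S. line (v x) \<in> nonvanishing I F} = {x\<in>pts S. F (v x) \<noteq> 0}"
      using line_in_nonvanishing[OF that] im XI by auto
    then show ?thesis using swf_nonzero_open[OF S opn swf_hpoly[OF S opn that v]] by simp
  qed
  have pre: "openin (Top S) {x\<in>pts S. line (v x) \<in> U}"
    if U: "openin (Top (quasiprojective I X)) U" for U
  proof (subst openin_subopen, intro ballI)
    fix x assume x: "x \<in> {x\<in>pts S. line (v x) \<in> U}"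
    then obtain d F where F: "hpoly I d F" "line (v x) \<in> nonvanishing I F" "X \<inter> nonvanishing I F \<subseteq> U"
      using U unfolding openin_quasiprojective_iff[OF XI] by blast
    then show "\<exists>T. openin (Top S) T \<and> x \<in> T \<and> T \<subseteq> {x\<in>pts S. line (v x) \<in> U}"
      using x im by (intro exI[of _ "{x\<in>pts S. line (v x) \<in> nonvanishing I F}"]) (auto intro: nz)
  qed
  show ?thesis unfolding fs_morphism_def continuous_map_def
  proof (intro conjI allI impI)
    show "(\<lambda>x. line (v x)) \<in> pts S \<rightarrow> pts (quasiprojective I X)"
      using im by (auto simp: pts_quasiprojective[OF XI])
    show "openin (Top S) {x\<in>pts S. line (v x) \<in> U}"
      if "openin (Top (quasiprojective I X)) U" for U by (rule pre[OF that])
    fix U h assume U: "openin (Top (quasiprojective I X)) U" and h: "h \<in> Reg (quasiprojective I X) U"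
    note UI = openin_quasiprojective_subset(2)[OF XI U]
    show "h \<circ> (\<lambda>x. line (v x)) \<in> Reg S {x\<in>pts S. line (v x) \<in> U}"
    proof (rule swf_local[OF S pre[OF U]])
      fix x assume x: "x \<in> {x\<in>pts S. line (v x) \<in> U}"
      then obtain e F H where 1: "qfrac I h U (line (v x)) e F H"
        using h unfolding Reg_quasiprojective_iff[OF UI] by blast
      then have F: "hpoly I e F" and H: "hpoly I e H" by (auto simp: qfrac_def)
      let ?V = "{x\<in>pts S. line (v x) \<in> U} \<inter> {x\<in>pts S. line (v x) \<in> nonvanishing I H}"
      have V: "openin (Top S) ?V" by (intro openin_Int pre[OF U] nz[OF H])
      have vV: "(\<lambda>x. v x i) \<in> Reg S ?V" if "i \<in> I" for i
        by (rule swf_mono[OF S opn v[OF that] V]) auto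
      have "(\<lambda>x. F (v x) / H (v x)) \<in> Reg S ?V"
        by (rule swf_divide[OF S V swf_hpoly[OF S V F vV] swf_hpoly[OF S V H vV]])
          (auto simp: line_in_nonvanishing[OF H])
      then have "h \<circ> (\<lambda>x. line (v x)) \<in> Reg S ?V"
      proof (rule swf_cong[OF S V])
        fix x assume "x \<in> ?V"
        then have "line (v x) \<in> U" "H (v x) \<noteq> 0" by (auto simp: line_in_nonvanishing[OF H])
        then show "F (v x) / H (v x) = (h \<circ> (\<lambda>x. line (v x))) x"
          using 1 in_line_self[of "v x"] by (auto simp: qfrac_def)
      qed
      moreover have "x \<in> ?V"
        using x 1 UI by (auto simp: line_in_nonvanishing[OF H] qfrac_def in_line_self)
      ultimately show "\<exists>V. openin (Top S) V \<and> x \<in> V \<and> V \<subseteq> {x\<in>pts S. line (v x) \<in> U} \<and>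
          h \<circ> (\<lambda>x. line (v x)) \<in> Reg S V"
        using V by (intro exI[of _ ?V]) auto
    qed
  qed
qed

lemma proj_space_facts:
  "pts (proj_space m) = proj_points {..<m}" "space_with_functions (proj_space m)"
  unfolding proj_space_def using pts_quasiprojective swf_quasiprojective by blast+

lemma proj_space_ratio:
  assumes "e < m" "e' < m"
  defines "W \<equiv> {l \<in> proj_points {..<m}. \<forall>v\<in>l. v e \<noteq> 0}"
  shows "openin (Top (proj_space m)) W"
    and "(\<forall>l\<in>W. \<forall>v\<in>l. h l = v e' / v e) \<Longrightarrow> h \<in> Reg (proj_space m) W"
proof -
  have h: "hpoly {..<m} 1 (\<lambda>v. v e)" "hpoly {..<m} 1 (\<lambda>v. v e')"
    by (rule hpoly.coord, simp add: assms)+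
  have W: "W = nonvanishing {..<m} (\<lambda>v. v e)" by (simp add: W_def nonvanishing_def)
  have "openin (Top (quasiprojective {..<m} (proj_points {..<m}))) W"
    unfolding openin_quasiprojective_iff[OF subset_refl] using h(1) W
    by (auto simp: nonvanishing_def)
  then show "openin (Top (proj_space m)) W" by (simp add: proj_space_def)
  assume hl: "\<forall>l\<in>W. \<forall>v\<in>l. h l = v e' / v e"
  have "W \<subseteq> proj_points {..<m}" by (auto simp: W_def)
  moreover have "qfrac {..<m} h W p 1 (\<lambda>v. v e') (\<lambda>v. v e)" if "p \<in> W" for p
    unfolding qfrac_def using h hl that by (auto simp: W_def)
  ultimately show "h \<in> Reg (proj_space m) W"
    unfolding proj_space_def using Reg_quasiprojective_iff[of W "{..<m}" h] by blast
qed

section \<open>Good quotients\<close>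

locale quotient =
  fixes \<Gamma> :: "('a \<Rightarrow> 'a) set" and X :: "'a fspace" and Y :: "'b fspace" and \<pi> :: "'a \<Rightarrow> 'b"
  assumes X: "space_with_functions X"
    and gq: "good_quotient \<Gamma> X Y \<pi>"
    and \<Gamma>: "\<gamma> \<in> \<Gamma> \<Longrightarrow> x \<in> pts X \<Longrightarrow> \<gamma> x \<in> pts X"
begin

lemma Y: "space_with_functions Y" and mor: "fs_morphism X Y \<pi>" and surj: "\<pi> ` pts X = pts Y"
  and inv: "\<gamma> \<in> \<Gamma> \<Longrightarrow> x \<in> pts X \<Longrightarrow> \<pi> (\<gamma> x) = \<pi> x"
  and descend: "openin (Top Y) U \<Longrightarrow> h \<in> Reg X {x\<in>pts X. \<pi> x \<in> U} \<Longrightarrow>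
        (\<And>\<gamma> x. \<gamma>\<in>\<Gamma> \<Longrightarrow> x\<in>pts X \<Longrightarrow> \<pi> x \<in> U \<Longrightarrow> h (\<gamma> x) = h x) \<Longrightarrow>
        \<exists>f\<in>Reg Y U. \<forall>x\<in>pts X. \<pi> x \<in> U \<longrightarrow> h x = f (\<pi> x)"
  and closed_image: "closedin (Top X) W \<Longrightarrow> (\<And>\<gamma>. \<gamma>\<in>\<Gamma> \<Longrightarrow> \<gamma> ` W \<subseteq> W) \<Longrightarrow> closedin (Top Y) (\<pi> ` W)"
  and separate: "closedin (Top X) W \<Longrightarrow> closedin (Top X) W' \<Longrightarrow>
        (\<And>\<gamma>. \<gamma>\<in>\<Gamma> \<Longrightarrow> \<gamma> ` W \<subseteq> W) \<Longrightarrow> (\<And>\<gamma>. \<gamma>\<in>\<Gamma> \<Longrightarrow> \<gamma> ` W' \<subseteq> W') \<Longrightarrow> W \<inter> W' = {} \<Longrightarrow> \<pi> ` W \<inter> \<pi> ` W' = {}"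
  using gq unfolding good_quotient_def by simp_all

text \<open>The complement of the preimage of D is closed and stable under \<Gamma>, so its image is
  closed, and by surjectivity this image is the complement of D. Thus Y carries the quotient
  topology.\<close>

lemma openin_iff:
  "openin (Top Y) D \<longleftrightarrow> D \<subseteq> pts Y \<and> openin (Top X) {x\<in>pts X. \<pi> x \<in> D}"
proof
  assume "openin (Top Y) D"
  then show "D \<subseteq> pts Y \<and> openin (Top X) {x\<in>pts X. \<pi> x \<in> D}"
    using openin_subset fs_morphismD(2)[OF mor] by blast
next
  assume D: "D \<subseteq> pts Y \<and> openin (Top X) {x\<in>pts X. \<pi> x \<in> D}"
  let ?W = "pts X - {x\<in>pts X. \<pi> x \<in> D}"
  have "closedin (Top Y) (\<pi> ` ?W)"
    by (rule closed_image) (use D inv \<Gamma> in \<open>auto simp: closedin_def\<close>)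
  moreover have "\<pi> ` ?W = pts Y - D" using surj by auto
  ultimately have "openin (Top Y) (pts Y - (pts Y - D))" by (metis openin_diff openin_topspace)
  moreover have "pts Y - (pts Y - D) = D" using D by auto
  ultimately show "openin (Top Y) D" by simp
qed

text \<open>Descent provides some regular function with the same pullback, and surjectivity of \<pi>
  identifies it with h on D.\<close>

lemma Reg_iff:
  assumes D: "openin (Top Y) D"
  shows "h \<in> Reg Y D \<longleftrightarrow> (\<lambda>x. h (\<pi> x)) \<in> Reg X {x\<in>pts X. \<pi> x \<in> D}"
proof
  assume "h \<in> Reg Y D"
  then show "(\<lambda>x. h (\<pi> x)) \<in> Reg X {x\<in>pts X. \<pi> x \<in> D}" by (rule fs_morphismD(3)[OF mor D])
next
  assume "(\<lambda>x. h (\<pi> x)) \<in> Reg X {x\<in>pts X. \<pi> x \<in> D}"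
  then obtain f where f: "f \<in> Reg Y D" "\<forall>x\<in>pts X. \<pi> x \<in> D \<longrightarrow> h (\<pi> x) = f (\<pi> x)"
    using descend[OF D, of "\<lambda>x. h (\<pi> x)"] inv by auto
  show "h \<in> Reg Y D"
  proof (rule swf_cong[OF Y D f(1)])
    fix y assume "y \<in> D"
    moreover have "y \<in> \<pi> ` pts X" using \<open>y \<in> D\<close> openin_subset[OF D] surj by auto
    ultimately show "f y = h y" using f(2) by auto
  qed
qed

end

section \<open>Plucker coordinates\<close>

lemma pick_bij:
  assumes "card K = r" "finite K" shows "bij_betw (pick K) {..<r} K"
proof -
  have "inj_on (pick K) {..<r}"
    by (rule strict_mono_on_imp_inj_on) (auto simp: strict_mono_on_def assms intro: pick_mono)
  moreover have "pick K ` {..<r} \<subseteq> K" using assms by (auto intro: pick_in_set)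
  ultimately show ?thesis
    unfolding bij_betw_def using card_subset_eq[OF assms(2)] assms(1) by (simp add: card_image)
qed

lemma pick_lessThan: "j < r \<Longrightarrow> pick {..<r} j = j"
proof -
  assume j: "j < r"
  then have "{a \<in> {..<r}. a < j} = {..<j}" by auto
  then show ?thesis using pick_card_in_set[of j "{..<r}"] j by simp
qed

text \<open>A matrix is a function of row and column, so that rows can be scaled or replaced without
  reshaping it. The rows of K are taken in increasing order by \<open>pick\<close>, as in
  \<open>submatrix\<close>.\<close>

definition minor :: "nat \<Rightarrow> (nat \<Rightarrow> nat \<Rightarrow> complex) \<Rightarrow> nat set \<Rightarrow> complex" where
  "minor r G K = det (mat r r (\<lambda>(i, l). G (pick K i) l))"

definition pvec :: "nat \<Rightarrow> nat \<Rightarrow> (nat \<Rightarrow> nat \<Rightarrow> complex) \<Rightarrow> nat set \<Rightarrow> complex" where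
  "pvec n r G = (\<lambda>K. if K \<in> plucker_idx n r then minor r G K else 0)"

lemma plucker_idxD:
  assumes "K \<in> plucker_idx n r" shows "K \<subseteq> {..<n}" "card K = r" "finite K" "bij_betw (pick K) {..<r} K"
proof -
  show K: "K \<subseteq> {..<n}" "card K = r" using assms by (auto simp: plucker_idx_def)
  then show "finite K" using finite_subset by blast
  then show "bij_betw (pick K) {..<r} K" using K(2) pick_bij by blast
qed

lemma pick_in_idx: "K \<in> plucker_idx n r \<Longrightarrow> i < r \<Longrightarrow> pick K i \<in> K"
  using plucker_idxD(4) bij_betwE by blast

lemma det_mat_leibniz:
  "det (mat r r (\<lambda>(i, l). A i l)) = (\<Sum>p | p permutes {0..<r}. signof p * (\<Prod>i = 0..<r. A i (p i :: nat) :: complex))"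
proof -
  have "(\<Prod>i = 0..<r. mat r r (\<lambda>(i, l). A i l) $$ (i, p i)) = (\<Prod>i = 0..<r. A i (p i))"
    if "p permutes {0..<r}" for p
    using permutes_in_image[OF that] by (intro prod.cong) auto
  then show ?thesis by (subst det_def'[of _ r]) (auto intro!: sum.cong)
qed

lemma minor_cong:
  assumes "card K = r" "finite K" "\<And>p l. p \<in> K \<Longrightarrow> l < r \<Longrightarrow> G p l = H p l"
  shows "minor r G K = minor r H K"
proof -
  have "G (pick K i) l = H (pick K i) l" if "i < r" "l < r" for i l
    using that assms pick_in_set[of i K] by auto
  then have "mat r r (\<lambda>(i, l). G (pick K i) l) = mat r r (\<lambda>(i, l). H (pick K i) l)" by auto
  then show ?thesis unfolding minor_def by simp
qed

lemma pvec_cong: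
  assumes "\<And>p l. p < n \<Longrightarrow> l < r \<Longrightarrow> G p l = H p l"
  shows "pvec n r G = pvec n r H"
proof
  fix K
  show "pvec n r G K = pvec n r H K"
    unfolding pvec_def using minor_cong[of K r G H] plucker_idxD(1-3)[of K n r] assms by auto
qed

lemma submatrix_minor:
  assumes A: "A \<in> carrier_mat n n" and K: "K \<in> plucker_idx n r" and M: "M \<in> plucker_idx n r"
  shows "det (submatrix A K M) = minor r (\<lambda>p l. A $$ (p, pick M l)) K"
proof -
  have "{i. i < n \<and> i \<in> K} = K" "{i. i < n \<and> i \<in> M} = M"
    using plucker_idxD(1)[OF K] plucker_idxD(1)[OF M] by auto
  then show ?thesis
    unfolding submatrix_def minor_def using A plucker_idxD(2)[OF K] plucker_idxD(2)[OF M] by simp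
qed

lemma plucker_pt_pvec:
  assumes g: "g \<in> carrier_mat n n" and "r \<le> n"
  shows "plucker_pt n r g = line (pvec n r (\<lambda>p l. g $$ (p, l)))"
proof -
  have M: "{..<r} \<in> plucker_idx n r" using assms by (auto simp: plucker_idx_def)
  have "det (submatrix g K {..<r}) = minor r (\<lambda>p l. g $$ (p, l)) K" if K: "K \<in> plucker_idx n r" for K
    unfolding submatrix_minor[OF g K M]
    by (rule minor_cong[OF plucker_idxD(2,3)[OF K]]) (simp add: pick_lessThan)
  then show ?thesis unfolding plucker_pt_def pvec_def by (metis (mono_tags, lifting))
qed

lemma minor_scale:
  assumes "card K = r" "finite K"
  shows "minor r (\<lambda>p l. d p * G p l * c l) K = (\<Prod>p\<in>K. d p) * minor r G K * (\<Prod>l<r. c l)"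
proof -
  have dp: "(\<Prod>i = 0..<r. d (pick K i)) = (\<Prod>p\<in>K. d p)"
    using prod.reindex_bij_betw[OF pick_bij[OF assms], of d] by (simp add: lessThan_atLeast0)
  have "(\<Prod>i = 0..<r. d (pick K i) * G (pick K i) (p i) * c (p i)) =
      (\<Prod>p\<in>K. d p) * (\<Prod>i = 0..<r. G (pick K i) (p i)) * (\<Prod>l<r. c l)"
    if "p permutes {0..<r}" for p
  proof -
    have "(\<Prod>i = 0..<r. c (p i)) = (\<Prod>l<r. c l)"
      using prod.permute[OF that, of c] by (simp add: comp_def lessThan_atLeast0)
    then show ?thesis by (simp add: prod.distrib dp)
  qed
  then show ?thesis
    unfolding minor_def det_mat_leibniz by (simp add: sum_distrib_left sum_distrib_right mult.assoc mult.left_commute)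
qed

text \<open>Multiplication on the right by a square matrix only changes the generators of the column
  space: all maximal minors get the same factor.\<close>

lemma minor_times:
  "minor r (\<lambda>p l. \<Sum>k<r. G p k * C k l) K = minor r G K * det (mat r r (\<lambda>(k, l). C k l))"
proof -
  have "mat r r (\<lambda>(i, l). \<Sum>k<r. G (pick K i) k * C k l) =
      mat r r (\<lambda>(i, l). G (pick K i) l) * mat r r (\<lambda>(k, l). C k l)"
    by (rule eq_matI) (auto simp: scalar_prod_def lessThan_atLeast0)
  then show ?thesis unfolding minor_def using det_mult[of "mat r r (\<lambda>(i, l). G (pick K i) l)" r] by simp
qed

text \<open>A nonzero determinant has a nonzero Leibniz term; the inverse of its permutation,
  followed by the enumeration of K, is the bijection.\<close>

lemma minor_nonzero_bij:
  assumes "minor r G K \<noteq> 0" "card K = r" "finite K"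
  obtains f where "bij_betw f {..<r} K" "\<And>l. l < r \<Longrightarrow> G (f l) l \<noteq> 0"
proof -
  obtain p where p: "p permutes {0..<r}" "(\<Prod>i = 0..<r. G (pick K i) (p i)) \<noteq> 0"
    using assms(1) unfolding minor_def det_mat_leibniz
    by (metis (mono_tags, lifting) mem_Collect_eq mult_zero_right sum.neutral)
  define f where "f = pick K \<circ> inv_into UNIV p"
  have "inv_into UNIV p permutes {..<r}" using permutes_inv[OF p(1)] by (simp add: lessThan_atLeast0)
  then have b: "bij_betw (inv_into UNIV p) {..<r} {..<r}" by (rule permutes_imp_bij)
  have "bij_betw f {..<r} K" unfolding f_def by (rule bij_betw_trans[OF b pick_bij[OF assms(2,3)]])
  moreover have "G (f l) l \<noteq> 0" if "l < r" for l
  proof -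
    have "inv_into UNIV p l < r" using b that by (auto dest: bij_betwE)
    moreover have "p (inv_into UNIV p l) = l" using permutes_inverses(1)[OF p(1)] by simp
    ultimately show ?thesis using p(2) by (auto simp: f_def dest: bspec[of _ _ "inv_into UNIV p l"])
  qed
  ultimately show ?thesis using that by blast
qed

lemma det_nonzero_iff_kernel:
  fixes A :: "nat \<Rightarrow> nat \<Rightarrow> complex"
  shows "det (mat r r (\<lambda>(i, l). A i l)) \<noteq> 0 \<longleftrightarrow>
    (\<forall>c. (\<forall>i<r. (\<Sum>l<r. A i l * c l) = 0) \<longrightarrow> (\<forall>l<r. c l = 0))"
proof -
  let ?A = "mat r r (\<lambda>(i, l). A i l)"
  have A: "?A \<in> carrier_mat r r" by simp
  have mv: "(?A *\<^sub>v v = 0\<^sub>v r) \<longleftrightarrow> (\<forall>i<r. (\<Sum>l<r. A i l * v $ l) = 0)" if "v \<in> carrier_vec r" for v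
  proof -
    have "(?A *\<^sub>v v) $ i = (\<Sum>l<r. A i l * v $ l)" if "i < r" for i
      using that \<open>v \<in> carrier_vec r\<close> by (auto simp: scalar_prod_def lessThan_atLeast0)
    then show ?thesis by (auto simp: vec_eq_iff)
  qed
  show ?thesis
  proof
    assume "det ?A \<noteq> 0"
    then have nz: "\<not> (\<exists> v. v \<in> carrier_vec r \<and> v \<noteq> 0\<^sub>v r \<and> ?A *\<^sub>v v = 0\<^sub>v r)"
      using det_0_iff_vec_prod_zero_field[OF A] by simp
    show "\<forall>c. (\<forall>i<r. (\<Sum>l<r. A i l * c l) = 0) \<longrightarrow> (\<forall>l<r. c l = 0)"
    proof (intro allI impI)
      fix c l assume c: "\<forall>i<r. (\<Sum>l<r. A i l * c l) = 0" and l: "l < r"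
      have "?A *\<^sub>v vec r c = 0\<^sub>v r" using c by (subst mv) auto
      then have "vec r c = 0\<^sub>v r" using nz by (metis vec_carrier)
      then show "c l = 0" using l by (metis index_vec index_zero_vec(1))
    qed
  next
    assume R: "\<forall>c. (\<forall>i<r. (\<Sum>l<r. A i l * c l) = 0) \<longrightarrow> (\<forall>l<r. c l = 0)"
    show "det ?A \<noteq> 0"
    proof
      assume "det ?A = 0"
      then obtain v where v: "v \<in> carrier_vec r" "v \<noteq> 0\<^sub>v r" "?A *\<^sub>v v = 0\<^sub>v r"
        using det_0_iff_vec_prod_zero_field[OF A] by auto
      then have "\<forall>l<r. v $ l = 0" using mv[OF v(1)] R by blast
      then show False using v(1,2) by (auto simp: vec_eq_iff)
    qed
  qed
qed

text \<open>The kernel condition does not see the order of the rows. It lets K be treated as a set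
  in arguments where sorting and signs would only be a burden.\<close>

lemma minor_nonzero_iff_kernel:
  assumes "card K = r" "finite K"
  shows "minor r G K \<noteq> 0 \<longleftrightarrow>
    (\<forall>c. (\<forall>p\<in>K. (\<Sum>l<r. G p l * c l) = 0) \<longrightarrow> (\<forall>l<r. c l = 0))"
proof -
  have "(\<forall>i<r. Q (pick K i)) \<longleftrightarrow> (\<forall>p\<in>K. Q p)" for Q
  proof -
    have "K = pick K ` {..<r}" using pick_bij[OF assms] unfolding bij_betw_def by simp
    then have "(\<forall>p\<in>K. Q p) \<longleftrightarrow> (\<forall>p\<in>pick K ` {..<r}. Q p)" by simp
    then show ?thesis by auto
  qed
  from this[of "\<lambda>p. (\<Sum>l<r. G p l * c l) = 0" for c]
  show ?thesis unfolding minor_def det_nonzero_iff_kernel by simp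
qed

section \<open>Affine charts of the Grassmannian: the identity block in the rows K, and the exchange
  of one row\<close>

definition normalized :: "nat \<Rightarrow> (nat \<Rightarrow> nat \<Rightarrow> complex) \<Rightarrow> nat set \<Rightarrow> bool" where
  "normalized r G K \<longleftrightarrow> (\<forall>i<r. \<forall>l<r. G (pick K i) l = (if i = l then 1 else 0))"

lemma minor_normalized:
  assumes "normalized r G K" shows "minor r G K = 1"
proof -
  have "mat r r (\<lambda>(i, l). G (pick K i) l) = 1\<^sub>m r"
    using assms unfolding normalized_def by (intro eq_matI) auto
  then show ?thesis unfolding minor_def by simp
qed

definition exchange :: "nat set \<Rightarrow> nat \<Rightarrow> nat \<Rightarrow> nat set" where
  "exchange K l p = insert p (K - {pick K l})"

text \<open>The sign of the permutation that sorts the exchanged rows, expressed as the minor of a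
  0-1 matrix. The place of p in the sorted set never has to be computed: what matters is that the
  value does not depend on the matrix to be evaluated and is not 0.\<close>

definition exchange_sign :: "nat \<Rightarrow> nat set \<Rightarrow> nat \<Rightarrow> nat \<Rightarrow> complex" where
  "exchange_sign r K l p =
     minor r (\<lambda>p' l'. if p' = p then if l' = l then 1 else 0 else if p' = pick K l' then 1 else 0)
       (exchange K l p)"

lemma exchange_card:
  assumes "card K = r" "finite K" "l < r" "p \<notin> K"
  shows "card (exchange K l p) = r" "finite (exchange K l p)"
proof -
  have "pick K l \<in> K" using assms pick_in_set by blast
  then have "card (K - {pick K l}) = r - 1" using assms by simp
  then show "card (exchange K l p) = r" unfolding exchange_def using assms by (subst card_insert_disjoint) auto
  show "finite (exchange K l p)" using assms unfolding exchange_def by simp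
qed

lemma exchange_idx:
  assumes "K \<in> plucker_idx n r" "l < r" "p < n" "p \<notin> K"
  shows "exchange K l p \<in> plucker_idx n r"
proof -
  have "exchange K l p \<subseteq> {..<n}" using plucker_idxD(1)[OF assms(1)] assms(3) by (auto simp: exchange_def)
  then show ?thesis
    unfolding plucker_idx_def
    using exchange_card(1)[OF plucker_idxD(2,3)[OF assms(1)] assms(2,4)] by simp
qed

text \<open>A permutation other than the identity moves at least two indices, so it moves some index
  besides l, where the factor of its Leibniz term is an off-diagonal 0.\<close>

lemma det_identity_replace_row:
  assumes "l < r"
  shows "det (mat r r (\<lambda>(k, l'). if k = l then g l' else if k = l' then 1 else (0::complex))) = g l"
proof -
  let ?C = "\<lambda>k l'. if k = l then g l' else if k = l' then 1 else (0::complex)"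
  have z: "(\<Prod>i = 0..<r. ?C i (p i)) = 0" if p: "p permutes {0..<r}" "p \<noteq> id" for p
  proof -
    obtain i where i: "p i \<noteq> i" using p(2) by (auto simp: fun_eq_iff)
    then have i': "p (p i) \<noteq> p i" using permutes_inj[OF p(1)] by (auto dest: injD)
    have ir: "i \<in> {0..<r}" "p i \<in> {0..<r}"
      using i p(1) permutes_in_image[OF p(1)] by (auto simp: permutes_def)
    have "\<exists>k\<in>{0..<r}. k \<noteq> l \<and> p k \<noteq> k"
    proof (cases "i = l")
      case True then show ?thesis using i i' ir by (intro bexI[of _ "p i"]) auto
    next
      case False then show ?thesis using i ir by (intro bexI[of _ i]) auto
    qed
    then obtain k where "k \<in> {0..<r}" "k \<noteq> l" "p k \<noteq> k" by blast
    then show ?thesis by (intro prod_zero) (auto intro: bexI[of _ k])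
  qed
  have "det (mat r r (\<lambda>(k, l'). ?C k l')) =
      (\<Sum>p | p permutes {0..<r}. signof p * (\<Prod>i = 0..<r. ?C i (p i)))" by (rule det_mat_leibniz)
  also have "\<dots> = (\<Sum>p\<in>{id}. signof p * (\<Prod>i = 0..<r. ?C i (p i)))"
    by (rule sum.mono_neutral_right) (auto simp: z finite_permutations permutes_id)
  also have "\<dots> = (\<Prod>i = 0..<r. ?C i (id i))" by (simp add: sign_id)
  also have "\<dots> = (\<Prod>i = 0..<r. if i = l then g l else 1)" by (rule prod.cong) auto
  also have "\<dots> = g l" using assms by (simp add: prod.delta)
  finally show ?thesis .
qed

text \<open>On the exchanged rows, G is the 0-1 matrix of \<open>exchange_sign\<close> times the
  identity matrix whose row l is replaced by row p of G. The minor is the product of the two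
  determinants.\<close>

lemma minor_exchange:
  assumes K: "card K = r" "finite K" and l: "l < r" and p: "p \<notin> K" and G: "normalized r G K"
  shows "minor r G (exchange K l p) = exchange_sign r K l p * G p l"
proof -
  let ?E = "\<lambda>p' l'. if p' = p then if l' = l then 1 else 0 else if p' = pick K l' then 1 else (0::complex)"
  let ?C = "\<lambda>k l'. if k = l then G p l' else if k = l' then 1 else (0::complex)"
  note ex = exchange_card[OF K l p]
  have "minor r G (exchange K l p) = minor r (\<lambda>p' l'. \<Sum>k<r. ?E p' k * ?C k l') (exchange K l p)"
  proof (rule minor_cong[OF ex])
    fix p' l' assume p': "p' \<in> exchange K l p" and l': "l' < r"
    show "G p' l' = (\<Sum>k<r. ?E p' k * ?C k l')"
    proof (cases "p' = p")
      case True
      then have "(\<Sum>k<r. ?E p' k * ?C k l') = (\<Sum>k<r. if k = l then ?C l l' else 0)"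
        by (intro sum.cong) auto
      also have "\<dots> = G p l'" using l by (simp add: sum.delta)
      finally show ?thesis using True by simp
    next
      case False
      then have "p' \<in> K" "p' \<noteq> pick K l" using p' by (auto simp: exchange_def)
      then obtain m where m: "m < r" "p' = pick K m" "m \<noteq> l"
        using pick_bij[OF K] unfolding bij_betw_def by auto
      have inj: "pick K m = pick K k \<longleftrightarrow> m = k" if "k < r" for k
        using pick_bij[OF K] m(1) that unfolding bij_betw_def by (auto dest: inj_onD)
      have "(\<Sum>k<r. ?E p' k * ?C k l') = (\<Sum>k<r. if k = m then ?C m l' else 0)"
        using False m inj by (intro sum.cong) auto
      also have "\<dots> = ?C m l'" using m by (simp add: sum.delta)
      also have "\<dots> = G p' l'" using G m l' unfolding normalized_def by auto
      finally show ?thesis by simp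
    qed
  qed
  also have "\<dots> = exchange_sign r K l p * G p l"
    unfolding minor_times exchange_sign_def det_identity_replace_row[OF l] ..
  finally show ?thesis .
qed

lemma exchange_sign_nonzero:
  assumes K: "card K = r" "finite K" and l: "l < r" and p: "p \<notin> K"
  shows "exchange_sign r K l p \<noteq> 0"
proof -
  let ?E = "\<lambda>p' l'. if p' = p then if l' = l then 1 else 0 else if p' = pick K l' then 1 else (0::complex)"
  note ex = exchange_card[OF K l p]
  have "minor r ?E (exchange K l p) \<noteq> 0"
    unfolding minor_nonzero_iff_kernel[OF ex]
  proof (intro allI impI)
    fix c m assume c: "\<forall>p'\<in>exchange K l p. (\<Sum>l<r. ?E p' l * c l) = 0" and m: "m < r"
    have inj: "pick K m = pick K k \<longleftrightarrow> m = k" if "k < r" for k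
      using pick_bij[OF K] m that unfolding bij_betw_def by (auto dest: inj_onD)
    define p' where "p' = (if m = l then p else pick K m)"
    have mK: "pick K m \<in> K" using pick_in_set K m by blast
    have "p' \<in> exchange K l p" using mK inj[OF l] by (auto simp: p'_def exchange_def)
    then have "0 = (\<Sum>k<r. ?E p' k * c k)" using c by simp
    also have "\<dots> = (\<Sum>k<r. if k = m then c m else 0)"
      using mK p inj by (intro sum.cong) (auto simp: p'_def)
    also have "\<dots> = c m" using m by (simp add: sum.delta)
    finally show "c m = 0" by simp
  qed
  then show ?thesis unfolding exchange_sign_def .
qed

lemma normalize_minor:
  assumes K: "card K = r" "finite K" and nz: "minor r G K \<noteq> 0"
  obtains G' s where "normalized r G' K" "s \<noteq> 0" "\<And>M. minor r G M = s * minor r G' M"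
proof -
  let ?A = "mat r r (\<lambda>(i, l). G (pick K i) l)"
  have A: "?A \<in> carrier_mat r r" by simp
  have "?A \<in> Units (ring_mat TYPE(complex) r ())"
    by (rule det_non_zero_imp_unit[OF A]) (use nz in \<open>simp add: minor_def\<close>)
  then obtain B where B: "B \<in> carrier_mat r r" "?A * B = 1\<^sub>m r"
    unfolding Units_def ring_mat_def by auto
  have Bm: "mat r r (\<lambda>(k, l). B $$ (k, l)) = B" using B(1) by auto
  have "det ?A * det B = 1" using det_mult[OF A B(1)] B(2) by simp
  then have dB: "det B \<noteq> 0" by auto
  define G' where "G' = (\<lambda>p l. \<Sum>k<r. G p k * B $$ (k, l))"
  have "normalized r G' K" unfolding normalized_def
  proof (intro allI impI)
    fix i l assume "i < r" "l < r"
    have "G' (pick K i) l = (?A * B) $$ (i, l)"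
      unfolding G'_def using \<open>i < r\<close> \<open>l < r\<close> B(1) by (auto simp: scalar_prod_def lessThan_atLeast0)
    then show "G' (pick K i) l = (if i = l then 1 else 0)" using B(2) \<open>i < r\<close> \<open>l < r\<close> by simp
  qed
  moreover have "minor r G M = (1 / det B) * minor r G' M" for M
    unfolding G'_def minor_times Bm using dB by simp
  ultimately show ?thesis using that[of G' "1 / det B"] dB by simp
qed

section \<open>Points of the Grassmannian from matrices\<close>

lemma complex_root: assumes "z \<noteq> 0" "n > 0" obtains c :: complex where "c ^ n = z" "c \<noteq> 0"
proof -
  define c where "c = rcis (root n (cmod z)) (Arg z / n)"
  have "c ^ n = rcis (root n (cmod z) ^ n) (real n * (Arg z / n))" unfolding c_def by (rule DeMoivre2)
  also have "\<dots> = z" using assms by (simp add: rcis_cmod_Arg)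
  finally have "c ^ n = z" .
  moreover from this have "c \<noteq> 0" using assms by (cases "c = 0") auto
  ultimately show ?thesis using that by blast
qed

lemma line_pvec_scale:
  assumes "s \<noteq> 0" "\<And>K. K \<in> plucker_idx n r \<Longrightarrow> minor r G K = s * minor r H K"
  shows "line (pvec n r G) = line (pvec n r H)"
proof -
  have "pvec n r G = (\<lambda>K. s * pvec n r H K)" using assms(2) by (auto simp: pvec_def)
  then show ?thesis using line_scale[OF assms(1)] by simp
qed

text \<open>\<open>grassmannian\<close> is defined by matrices of determinant 1. Scaling by an n-th
  root of 1 / det g reaches determinant 1, and all r-minors get the factor c^r, which leaves the
  point unchanged.\<close>

lemma plucker_pt_of_invertible:
  assumes g: "g \<in> carrier_mat n n" and "det g \<noteq> 0" and rn: "r \<le> n" "n > 0"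
  shows "plucker_pt n r g \<in> grassmannian n r"
proof -
  obtain c where c: "c ^ n = inverse (det g)" "c \<noteq> 0"
    using complex_root[of "inverse (det g)" n] assms by auto
  have "c \<cdot>\<^sub>m g \<in> carrier (SL n)" using g c \<open>det g \<noteq> 0\<close> by (simp add: SL_def)
  moreover have "plucker_pt n r (c \<cdot>\<^sub>m g) = plucker_pt n r g"
  proof -
    have "minor r (\<lambda>p l. (c \<cdot>\<^sub>m g) $$ (p, l)) K = c ^ r * minor r (\<lambda>p l. g $$ (p, l)) K"
      if K: "K \<in> plucker_idx n r" for K
    proof -
      have "minor r (\<lambda>p l. (c \<cdot>\<^sub>m g) $$ (p, l)) K = minor r (\<lambda>p l. c * g $$ (p, l) * 1) K"
        using g plucker_idxD[OF K] rn by (intro minor_cong) auto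
      also have "\<dots> = c ^ r * minor r (\<lambda>p l. g $$ (p, l)) K"
        unfolding minor_scale[OF plucker_idxD(2,3)[OF K], of "\<lambda>_. c" _ "\<lambda>_. 1"] using plucker_idxD(2)[OF K] by simp
      finally show ?thesis .
    qed
    then have "line (pvec n r (\<lambda>p l. (c \<cdot>\<^sub>m g) $$ (p, l))) = line (pvec n r (\<lambda>p l. g $$ (p, l)))"
      by (intro line_pvec_scale[of "c ^ r"]) (use c in auto)
    then show ?thesis using plucker_pt_pvec[OF g rn(1)] plucker_pt_pvec[of "c \<cdot>\<^sub>m g", OF _ rn(1)] g by simp
  qed
  ultimately show ?thesis unfolding grassmannian_def by (metis image_eqI)
qed

text \<open>The r columns are completed to a square matrix by the unit vectors of the rows outside
  K. On the rows of K these vectors vanish, so the minor forces the first r coefficients of a kernel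
  vector to be 0; each row outside K then isolates one of the others.\<close>

lemma grassmannian_of_minor:
  assumes K: "K \<in> plucker_idx n r" and nz: "minor r G K \<noteq> 0" and n: "n > 0"
  shows "line (pvec n r G) \<in> grassmannian n r"
proof -
  note Kd = plucker_idxD[OF K]
  let ?N = "{..<n} - K"
  have rn: "r \<le> n" using Kd by (metis card_lessThan card_mono finite_lessThan)
  have cN: "card ?N = n - r" "finite ?N" using Kd by (simp_all add: card_Diff_subset)
  note bN = pick_bij[OF cN]
  define A where "A = (\<lambda>p l. if l < r then G p l else if p = pick ?N (l - r) then 1 else 0)"
  let ?g = "mat n n (\<lambda>(p, l). A p l)"
  have "det ?g \<noteq> 0" unfolding det_nonzero_iff_kernel
  proof (intro allI impI)
    fix c l assume c: "\<forall>i<n. (\<Sum>l<n. A i l * c l) = 0" and l: "l < n"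
    have split: "(\<Sum>l<n. A p l * c l) = (\<Sum>l<r. A p l * c l) + (\<Sum>l = r..<n. A p l * c l)" for p
      using sum.atLeastLessThan_concat[of 0 r n "\<lambda>l. A p l * c l"] rn by (simp add: lessThan_atLeast0)
    have "\<forall>p\<in>K. (\<Sum>l<r. G p l * c l) = 0"
    proof
      fix p assume p: "p \<in> K"
      have "(\<Sum>l = r..<n. A p l * c l) = 0"
      proof (rule sum.neutral, rule ballI)
        fix l assume "l \<in> {r..<n}"
        then have "pick ?N (l - r) \<in> ?N" using bN by (auto dest!: bij_betwE)
        then show "A p l * c l = 0" using p \<open>l \<in> {r..<n}\<close> by (auto simp: A_def)
      qed
      then show "(\<Sum>l<r. G p l * c l) = 0" using c split[of p] p Kd(1) by (auto simp: A_def)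
    qed
    then have z: "\<forall>l<r. c l = 0" using nz unfolding minor_nonzero_iff_kernel[OF Kd(2,3)] by blast
    show "c l = 0"
    proof (cases "l < r")
      case False
      let ?p = "pick ?N (l - r)"
      have p: "?p \<in> ?N" using bN l False by (auto dest!: bij_betwE)
      have "(\<Sum>k = r..<n. A ?p k * c k) = (\<Sum>k = r..<n. if k = l then c l else 0)"
      proof (rule sum.cong[OF refl])
        fix k assume k: "k \<in> {r..<n}"
        have "?p = pick ?N (k - r) \<longleftrightarrow> l - r = k - r"
          using bN k l False unfolding bij_betw_def by (auto dest!: inj_onD)
        then show "A ?p k * c k = (if k = l then c l else 0)" using k False by (auto simp: A_def)
      qed
      also have "\<dots> = c l" using l False by (simp add: sum.delta)
      finally show ?thesis using c split[of ?p] p z by (auto simp: A_def)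
    qed (use z in simp)
  qed
  then have "plucker_pt n r ?g \<in> grassmannian n r"
    by (intro plucker_pt_of_invertible rn n) auto
  moreover have "pvec n r (\<lambda>p l. ?g $$ (p, l)) = pvec n r G"
    by (rule pvec_cong) (use rn in \<open>auto simp: A_def\<close>)
  ultimately show ?thesis using plucker_pt_pvec[of ?g n r] rn by simp
qed

lemma ext_act_diagonal:
  assumes A: "A \<in> carrier_mat n n" and d: "\<And>p m. p < n \<Longrightarrow> m < n \<Longrightarrow> A $$ (p, m) = (if p = m then d p else 0)"
    and K: "K \<in> plucker_idx n r"
  shows "ext_act n r A v K = (\<Prod>p\<in>K. d p) * v K"
proof -
  note Kd = plucker_idxD[OF K]
  \<comment> \<open>Selecting the columns M of a diagonal matrix leaves in row p an entry only where
    \<open>pick M l = p\<close>. A nonzero Leibniz term thus matches M with K.\<close>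
  have sub: "det (submatrix A K M) = (if M = K then \<Prod>p\<in>K. d p else 0)" if M: "M \<in> plucker_idx n r" for M
  proof -
    note Md = plucker_idxD[OF M]
    let ?D = "\<lambda>p l. if p = pick M l then 1 else (0::complex)"
    have "det (submatrix A K M) = minor r (\<lambda>p l. d p * ?D p l * 1) K"
      unfolding submatrix_minor[OF A K M]
    proof (rule minor_cong[OF Kd(2,3)])
      fix p l assume "p \<in> K" "l < r"
      then have "p < n" "pick M l < n" using Kd(1) Md(1) pick_in_idx[OF M] by auto
      then show "A $$ (p, pick M l) = d p * ?D p l * 1" using d by simp
    qed
    also have "\<dots> = (\<Prod>p\<in>K. d p) * minor r ?D K"
      unfolding minor_scale[OF Kd(2,3), of d _ "\<lambda>_. 1"] by simp
    also have "minor r ?D K = (if M = K then 1 else 0)"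
    proof (cases "M = K")
      case True
      have "normalized r ?D K" unfolding normalized_def
        using Kd(4) True unfolding bij_betw_def by (auto dest: inj_onD)
      then show ?thesis using True by (simp add: minor_normalized)
    next
      case False
      have "minor r ?D K = 0"
      proof (rule ccontr)
        assume "minor r ?D K \<noteq> 0"
        then obtain f where f: "bij_betw f {..<r} K" "\<And>l. l < r \<Longrightarrow> ?D (f l) l \<noteq> 0"
          using minor_nonzero_bij[OF _ Kd(2,3)] by blast
        then have "f l = pick M l" if "l < r" for l using that by (metis)
        then have "f ` {..<r} = pick M ` {..<r}" by auto
        then show False using f(1) Md(4) False unfolding bij_betw_def by simp
      qed
      then show ?thesis using False by simp
    qed
    finally show ?thesis by simp
  qed
  have "ext_act n r A v K = (\<Sum>M\<in>plucker_idx n r. if M = K then (\<Prod>p\<in>K. d p) * v K else 0)"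
    unfolding ext_act_def using K sub by (auto intro!: sum.cong)
  also have "\<dots> = (\<Prod>p\<in>K. d p) * v K"
  proof -
    have "finite (plucker_idx n r)" unfolding plucker_idx_def by simp
    then show ?thesis using K by (simp add: sum.delta)
  qed
  finally show ?thesis .
qed

section \<open>The torus\<close>

text \<open>Positions are 0-based: for n = rq + 1 position p lies in block \<open>p div q\<close>,
  with q positions in each block below r and the single position rq in block r.\<close>

definition block_diag :: "nat \<Rightarrow> nat \<Rightarrow> (nat \<Rightarrow> complex) \<Rightarrow> complex mat" where
  "block_diag n q u = mat n n (\<lambda>(p, m). if p = m then u (p div q) else 0)"

definition block_torus :: "nat \<Rightarrow> nat \<Rightarrow> complex mat set" where
  "block_torus n q = {block_diag n q u | u. (\<forall>b. u b \<noteq> 0) \<and> det (block_diag n q u) = 1}"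

lemma block_diag_carrier [simp]: "block_diag n q u \<in> carrier_mat n n"
  "dim_row (block_diag n q u) = n" "dim_col (block_diag n q u) = n"
  by (simp_all add: block_diag_def)

lemma block_diag_mult: "block_diag n q u * block_diag n q v = block_diag n q (\<lambda>b. u b * v b)"
proof (rule eq_matI)
  fix i j assume ij: "i < dim_row (block_diag n q (\<lambda>b. u b * v b))" "j < dim_col (block_diag n q (\<lambda>b. u b * v b))"
  then have "(block_diag n q u * block_diag n q v) $$ (i, j) =
      (\<Sum>k = 0..<n. (if i = k then u (i div q) else 0) * (if k = j then v (k div q) else 0))"
    by (auto simp: block_diag_def scalar_prod_def)
  also have "\<dots> = (\<Sum>k = 0..<n. if k = i then u (i div q) * (if i = j then v (i div q) else 0) else 0)"
    by (intro sum.cong) auto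
  also have "\<dots> = block_diag n q (\<lambda>b. u b * v b) $$ (i, j)"
    using ij by (simp add: sum.delta block_diag_def)
  finally show "(block_diag n q u * block_diag n q v) $$ (i, j) = block_diag n q (\<lambda>b. u b * v b) $$ (i, j)" .
qed (simp_all add: block_diag_def)

lemma smult_one_block_diag: "c \<cdot>\<^sub>m 1\<^sub>m n = block_diag n q (\<lambda>_. c)"
  by (rule eq_matI) (auto simp: block_diag_def)

lemma block_diag_one: "block_diag n q (\<lambda>_. 1) = 1\<^sub>m n"
  by (rule eq_matI) (auto simp: block_diag_def)

lemma det_diagonal:
  fixes A :: "complex mat"
  assumes A: "A \<in> carrier_mat n n" and "diagonal_mat A"
  shows "det A = (\<Prod>p<n. A $$ (p, p))"
proof -
  have "upper_triangular A" using assms by (auto simp: diagonal_mat_def)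
  then have "det A = prod_list (diag_mat A)" using A by (rule det_upper_triangular)
  also have "\<dots> = prod_list (map (\<lambda>i. A $$ (i, i)) [0..<n])" using A by (simp add: diag_mat_def)
  also have "\<dots> = (\<Prod>p\<in>set [0..<n]. A $$ (p, p))" by (rule prod.distinct_set_conv_list[symmetric]) simp
  finally show ?thesis by (simp add: lessThan_atLeast0)
qed

lemma det_block_diag: "det (block_diag n q u) = (\<Prod>p<n. u (p div q))"
  by (subst det_diagonal[of _ n]) (auto simp: block_diag_def diagonal_mat_def)

lemma prod_blocks:
  assumes "q > 0"
  shows "(\<Prod>p<r * q + 1. g (p div q)) = (\<Prod>b<r. g b) ^ q * (g r :: complex)"
proof -
  have "(\<Prod>p<r * q. g (p div q)) = (\<Prod>b<r. \<Prod>p = b * q..<b * q + q. g (p div q))"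
    by (rule prod.nat_group[symmetric])
  also have "\<dots> = (\<Prod>b<r. g b ^ q)"
  proof (rule prod.cong[OF refl])
    fix b
    have "(\<Prod>p = b * q..<b * q + q. g (p div q)) = (\<Prod>p = b * q..<b * q + q. g b)"
    proof (rule prod.cong[OF refl])
      fix p assume "p \<in> {b * q..<b * q + q}"
      then have "p div q = b" by (intro div_nat_eqI) (auto simp: mult.commute)
      then show "g (p div q) = g b" by simp
    qed
    then show "(\<Prod>p = b * q..<b * q + q. g (p div q)) = g b ^ q" by simp
  qed
  finally show ?thesis using assms by (simp add: prod_power_distrib)
qed

section \<open>The groups SL and PSL\<close>

lemma SL_simps: "carrier (SL n) = {A \<in> carrier_mat n n. det A = 1}" "A \<otimes>\<^bsub>SL n\<^esub> B = A * B" "\<one>\<^bsub>SL n\<^esub> = 1\<^sub>m n"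
  by (simp_all add: SL_def)

lemma SL_group: "group (SL n)"
proof (rule groupI)
  fix A assume A: "A \<in> carrier (SL n)"
  then have "A \<in> carrier_mat n n" "det A \<noteq> 0" by (auto simp: SL_simps)
  then have "A \<in> Units (ring_mat TYPE(complex) n ())" by (rule det_non_zero_imp_unit)
  then obtain B where B: "B \<in> carrier_mat n n" "B * A = 1\<^sub>m n"
    unfolding Units_def ring_mat_def by auto
  then have "det B * det A = 1" using det_mult[of B n A] A by (simp add: SL_simps)
  then show "\<exists>B\<in>carrier (SL n). B \<otimes>\<^bsub>SL n\<^esub> A = \<one>\<^bsub>SL n\<^esub>" using A B by (auto simp: SL_simps)
qed (auto simp: SL_simps det_mult[of _ n] assoc_mult_mat[of _ n n _ n _ n])

lemma SL_inv_eq: "A \<in> carrier (SL n) \<Longrightarrow> B \<in> carrier (SL n) \<Longrightarrow> B * A = 1\<^sub>m n \<Longrightarrow> inv\<^bsub>SL n\<^esub> A = B"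
  using group.inv_equality[OF SL_group, of n B A] by (simp add: SL_simps)

lemma SL_center_normal: "SL_center n \<lhd> SL n"
  unfolding group.normal_inv_iff[OF SL_group]
proof (intro conjI ballI)
  interpret group "SL n" by (rule SL_group)
  show "subgroup (SL_center n) (SL n)"
  proof (rule subgroupI)
    show "SL_center n \<subseteq> carrier (SL n)" by (auto simp: SL_center_def)
    have "1\<^sub>m n \<in> SL_center n" unfolding SL_center_def by (auto simp: SL_simps intro!: exI[of _ 1])
    then show "SL_center n \<noteq> {}" by blast
    fix A assume "A \<in> SL_center n"
    then obtain c where A: "A = c \<cdot>\<^sub>m 1\<^sub>m n" "c ^ n = 1" by (auto simp: SL_center_def SL_simps)
    show "inv\<^bsub>SL n\<^esub> A \<in> SL_center n"
    \<comment> \<open>For n = 0 the equation c^n = 1 says nothing about c, which may be 0 and then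
      has no inverse.\<close>
    proof (cases "n = 0")
      case True
      then have "inv\<^bsub>SL n\<^esub> A = 1\<^sub>m n" by (intro SL_inv_eq) (auto simp: A SL_simps)
      then show ?thesis using \<open>1\<^sub>m n \<in> SL_center n\<close> by simp
    next
      case False
      then have c: "c \<noteq> 0" using A(2) by (auto simp: power_0_left)
      have "inverse c \<cdot>\<^sub>m 1\<^sub>m n * A = 1 \<cdot>\<^sub>m 1\<^sub>m n"
        unfolding A(1) smult_one_block_diag[of _ _ 1] block_diag_mult using c by simp
      moreover have "1 \<cdot>\<^sub>m 1\<^sub>m n = (1\<^sub>m n :: complex mat)" by (rule eq_matI) auto
      ultimately have "inv\<^bsub>SL n\<^esub> A = inverse c \<cdot>\<^sub>m 1\<^sub>m n"
        by (intro SL_inv_eq) (simp_all add: A SL_simps power_inverse)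
      then show ?thesis using A(2) by (auto simp: SL_center_def SL_simps power_inverse)
    qed
  next
    fix A B assume "A \<in> SL_center n" "B \<in> SL_center n"
    then obtain c d where "A = c \<cdot>\<^sub>m 1\<^sub>m n" "c ^ n = 1" "B = d \<cdot>\<^sub>m 1\<^sub>m n" "d ^ n = 1"
      by (auto simp: SL_center_def SL_simps)
    moreover have "c \<cdot>\<^sub>m 1\<^sub>m n * (d \<cdot>\<^sub>m 1\<^sub>m n) = (c * d) \<cdot>\<^sub>m 1\<^sub>m n"
      unfolding smult_one_block_diag[of _ _ 1] block_diag_mult ..
    ultimately show "A \<otimes>\<^bsub>SL n\<^esub> B \<in> SL_center n"
      by (auto simp: SL_center_def SL_simps power_mult_distrib)
  qed
  fix x h assume x: "x \<in> carrier (SL n)" and "h \<in> SL_center n"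
  then obtain c where h: "h = c \<cdot>\<^sub>m 1\<^sub>m n" "h \<in> carrier (SL n)" by (auto simp: SL_center_def)
  have xm: "x \<in> carrier_mat n n" using x by (simp add: SL_simps)
  have "x \<otimes>\<^bsub>SL n\<^esub> h = h \<otimes>\<^bsub>SL n\<^esub> x"
    using mult_smult_distrib[OF xm one_carrier_mat, of c] mult_smult_assoc_mat[OF one_carrier_mat xm, of c] xm
    by (simp add: SL_simps h)
  then have "x \<otimes>\<^bsub>SL n\<^esub> h \<otimes>\<^bsub>SL n\<^esub> inv\<^bsub>SL n\<^esub> x = h"
    using x h(2) by (simp add: m_assoc)
  then show "x \<otimes>\<^bsub>SL n\<^esub> h \<otimes>\<^bsub>SL n\<^esub> inv\<^bsub>SL n\<^esub> x \<in> SL_center n" using \<open>h \<in> SL_center n\<close> by simp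
qed

lemma SL_center_eq: "SL_center n = {c \<cdot>\<^sub>m 1\<^sub>m n | c. c ^ n = 1}"
  by (auto simp: SL_center_def SL_simps)

definition PSL_class :: "nat \<Rightarrow> complex mat \<Rightarrow> complex mat set" where
  "PSL_class n A = SL_center n #>\<^bsub>SL n\<^esub> A"

lemma PSL_class_group_hom: "group_hom (SL n) (PSL n) (PSL_class n)"
proof -
  interpret normal "SL_center n" "SL n" by (rule SL_center_normal)
  have "PSL_class n = (\<lambda>A. SL_center n #>\<^bsub>SL n\<^esub> A)" by (auto simp: PSL_class_def)
  then show ?thesis
    using r_coset_hom_Mod factorgroup_is_group SL_group[of n]
    by (simp add: group_hom_def group_hom_axioms_def PSL_def)
qed

lemma mem_PSL_class_iff: "A \<in> carrier (SL n) \<Longrightarrow> n > 0 \<Longrightarrow> B \<in> PSL_class n A \<longleftrightarrow> (\<exists>c. c ^ n = 1 \<and> B = c \<cdot>\<^sub>m A)"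
proof -
  assume A: "A \<in> carrier (SL n)" and n: "n > 0"
  have eq: "(c \<cdot>\<^sub>m 1\<^sub>m n) * A = c \<cdot>\<^sub>m A" for c
    using mult_smult_assoc_mat[OF one_carrier_mat, of A n n c] A by (simp add: SL_simps)
  have "B \<in> PSL_class n A \<longleftrightarrow> (\<exists>Z\<in>SL_center n. B = Z * A)"
    unfolding PSL_class_def r_coset_def by (auto simp: SL_simps)
  also have "\<dots> \<longleftrightarrow> (\<exists>c. c ^ n = 1 \<and> B = (c \<cdot>\<^sub>m 1\<^sub>m n) * A)"
    unfolding SL_center_eq by blast
  finally show ?thesis using eq by simp
qed

lemma smult_block_diag: "c \<cdot>\<^sub>m block_diag n q u = block_diag n q (\<lambda>b. c * u b)"
  by (rule eq_matI) (auto simp: block_diag_def)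

lemma block_torus_SL: "block_torus n q \<subseteq> carrier (SL n)"
  by (auto simp: block_torus_def SL_simps)

lemma block_torus_subgroup: "subgroup (block_torus n q) (SL n)"
proof -
  interpret group "SL n" by (rule SL_group)
  show ?thesis
  proof (rule subgroupI)
    show "block_torus n q \<subseteq> carrier (SL n)" by (rule block_torus_SL)
    have "block_diag n q (\<lambda>_. 1) \<in> block_torus n q" unfolding block_torus_def
      by (auto simp: det_block_diag)
    then show "block_torus n q \<noteq> {}" by blast
  next
    fix A assume "A \<in> block_torus n q"
    then obtain u where u: "A = block_diag n q u" "\<forall>b. u b \<noteq> 0" "det A = 1" by (auto simp: block_torus_def)
    let ?B = "block_diag n q (\<lambda>b. inverse (u b))"
    have dB: "det ?B = 1"
      using u prod_inversef[of "\<lambda>p. u (p div q)" "{..<n}"] by (simp add: det_block_diag comp_def)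
    have "?B * A = 1\<^sub>m n"
      unfolding u(1) block_diag_mult using u(2) by (simp add: block_diag_one)
    then have "inv\<^bsub>SL n\<^esub> A = ?B" using u dB by (intro SL_inv_eq) (auto simp: SL_simps)
    then show "inv\<^bsub>SL n\<^esub> A \<in> block_torus n q" using dB u(2) by (auto simp: block_torus_def)
  next
    fix A B assume "A \<in> block_torus n q" "B \<in> block_torus n q"
    then obtain u v where "A = block_diag n q u" "\<forall>b. u b \<noteq> 0" "det A = 1"
      "B = block_diag n q v" "\<forall>b. v b \<noteq> 0" "det B = 1" by (auto simp: block_torus_def)
    then show "A \<otimes>\<^bsub>SL n\<^esub> B \<in> block_torus n q"
      by (auto simp: block_torus_def SL_simps block_diag_mult det_block_diag prod.distrib
          intro!: exI[of _ "\<lambda>b. u b * v b"])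
  qed
qed

text \<open>Ratios of consecutive diagonal entries determine a diagonal matrix up to a scalar, and
  determinant 1 makes this scalar an n-th root of unity. Hence the matrices with the prescribed
  ratios form one coset of the centre.\<close>

lemma one_param_class:
  assumes q: "q > 0" and k: "0 < k" "k \<le> r" and t: "t \<noteq> 0"
    and c: "c \<noteq> 0" and n: "n = r * q + 1"
  defines "u \<equiv> (\<lambda>b. if b < k then c * t else c)"
  assumes det: "det (block_diag n q u) = 1"
  shows "one_param n (k * q) t = PSL_class n (block_diag n q u)"
proof (rule equalityI; rule subsetI)
  let ?D = "block_diag n q u"
  have DSL: "?D \<in> carrier (SL n)" using det by (simp add: SL_simps)
  have n0: "n > 0" using n by simp
  have div: "p div q < k \<longleftrightarrow> p < k * q" for p using q by (simp add: div_less_iff_less_mult)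
  have u0: "u b \<noteq> 0" for b using c t by (simp add: u_def)
  \<comment> \<open>The diagonal values change only between blocks k - 1 and k, that is between
    positions kq - 1 and kq.\<close>
  have ratio: "u ((i - 1) div q) = (if i = k * q then t else 1) * u (i div q)" if "1 \<le> i" for i
    using that q k unfolding u_def div by auto
  {
    fix A assume A: "A \<in> PSL_class n ?D"
    then obtain s where s: "s ^ n = 1" "A = s \<cdot>\<^sub>m ?D" using mem_PSL_class_iff[OF DSL n0] by auto
    have s0: "s \<noteq> 0" using s(1) n0 by (auto simp: power_0_left)
    have "\<forall>i\<in>{1..<n}. A $$ (i - 1, i - 1) / A $$ (i, i) = (if i = k * q then t else 1)"
      using s0 u0 ratio by (auto simp: s(2) block_diag_def)
    moreover have "det A = 1" using s det by simp
    ultimately show "A \<in> one_param n (k * q) t"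
      unfolding one_param_def using s(2) by (auto simp: SL_simps diagonal_mat_def block_diag_def)
  }
  fix A assume "A \<in> one_param n (k * q) t"
  then have A: "A \<in> carrier_mat n n" "det A = 1" "diagonal_mat A"
    and rat: "\<And>i. i \<in> {1..<n} \<Longrightarrow> A $$ (i - 1, i - 1) / A $$ (i, i) = (if i = k * q then t else 1)"
    by (auto simp: one_param_def SL_simps)
  define s where "s = A $$ (0, 0) / u 0"
  have diag: "A $$ (i, i) = s * u (i div q)" if "i < n" for i
    using that
  proof (induction i)
    case 0 then show ?case using u0 by (simp add: s_def)
  next
    case (Suc i)
    then have IH: "A $$ (i, i) = s * u (i div q)" by simp
    have r': "A $$ (i, i) / A $$ (Suc i, Suc i) = (if Suc i = k * q then t else 1)"
      using rat[of "Suc i"] Suc.prems by simp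
    have nz: "A $$ (Suc i, Suc i) \<noteq> 0" using r' t by (auto split: if_splits)
    define e where "e = (if Suc i = k * q then t else 1)"
    have e: "e \<noteq> 0" using t by (simp add: e_def)
    have "A $$ (i, i) = e * A $$ (Suc i, Suc i)"
      using r' nz by (simp add: divide_simps e_def)
    moreover have "A $$ (i, i) = e * (s * u (Suc i div q))"
      using IH ratio[of "Suc i"] by (simp add: e_def[symmetric])
    ultimately show ?case using e by simp
  qed
  have AD: "A = s \<cdot>\<^sub>m ?D"
    using A(1,3) diag by (intro eq_matI) (auto simp: block_diag_def diagonal_mat_def)
  then have "s ^ n = 1" using A(2) det by simp
  then show "A \<in> PSL_class n ?D" using AD mem_PSL_class_iff[OF DSL n0] by auto
qed

lemma one_param_ex:
  assumes q: "q > 0" and k: "0 < k" "k \<le> r" and t: "t \<noteq> 0" and n: "n = r * q + 1"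
  obtains c where "c \<noteq> 0" "det (block_diag n q (\<lambda>b. if b < k then c * t else c)) = 1"
proof -
  let ?d = "det (block_diag n q (\<lambda>b. if b < k then t else 1))"
  have "?d \<noteq> 0" using t by (simp add: det_block_diag)
  then obtain c where c: "c ^ n = inverse ?d" "c \<noteq> 0" using complex_root[of "inverse ?d" n] n by auto
  have "block_diag n q (\<lambda>b. if b < k then c * t else c) = c \<cdot>\<^sub>m block_diag n q (\<lambda>b. if b < k then t else 1)"
    unfolding smult_block_diag by (rule arg_cong[of _ _ "block_diag n q"]) auto
  then have "det (block_diag n q (\<lambda>b. if b < k then c * t else c)) = 1"
    using c \<open>?d \<noteq> 0\<close> by simp
  then show ?thesis using that c(2) by blast
qed

text \<open>Induction on the index from which u is constant. A one-parameter element with its jump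
  just before block k + 1 absorbs the quotient u_k / u_(k+1), and the remaining factor is constant
  from k on. At k = 0 the matrix is scalar and represents the neutral element of PSL.\<close>

lemma block_torus_generated:
  assumes q: "q > 0"
  shows "k \<le> r \<Longrightarrow> \<forall>b. u b \<noteq> 0 \<Longrightarrow> det (block_diag (dim_n r q) q u) = 1 \<Longrightarrow>
     (\<forall>b\<in>{k..r}. u b = u r) \<Longrightarrow> PSL_class (dim_n r q) (block_diag (dim_n r q) q u) \<in> T_J r q"
proof (induction k arbitrary: u)
  case 0
  let ?n = "dim_n r q"
  interpret normal "SL_center ?n" "SL ?n" by (rule SL_center_normal)
  have "u (p div q) = u r" if "p < ?n" for p
  proof -
    have "p div q \<le> r" using that q div_le_mono[of p "r * q" q] by (simp add: dim_n_def)
    then show ?thesis by (intro bspec[OF 0(4)]) simp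
  qed
  then have eq: "block_diag ?n q u = u r \<cdot>\<^sub>m 1\<^sub>m ?n" by (auto simp: block_diag_def)
  then have "block_diag ?n q u \<in> SL_center ?n" using 0(3) by (auto simp: SL_center_def SL_simps)
  then have "PSL_class ?n (block_diag ?n q u) = SL_center ?n"
    unfolding PSL_class_def
    by (intro coset_join2 subgroup_axioms) (use subset in blast)+
  then show ?case unfolding T_J_def using generate.one[of "PSL ?n"] by (simp add: PSL_def FactGroup_def)
next
  case (Suc k)
  let ?n = "dim_n r q"
  interpret group_hom "SL ?n" "PSL ?n" "PSL_class ?n" by (rule PSL_class_group_hom)
  define t where "t = u k / u (Suc k)"
  have t: "t \<noteq> 0" using Suc.prems(2) by (simp add: t_def)
  have n: "?n = r * q + 1" by (simp add: dim_n_def)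
  obtain c where c: "c \<noteq> 0" "det (block_diag ?n q (\<lambda>b. if b < Suc k then c * t else c)) = 1"
    using one_param_ex[OF q _ Suc.prems(1) t n] by auto
  define w where "w = (\<lambda>b. if b < Suc k then c * t else c)"
  define u' where "u' = (\<lambda>b. u b / w b)"
  have w0: "w b \<noteq> 0" for b using c t by (simp add: w_def)
  have eq: "block_diag ?n q u = block_diag ?n q u' * block_diag ?n q w"
    unfolding block_diag_mult u'_def using w0 by simp
  have du': "det (block_diag ?n q u') = 1"
    using Suc.prems(3) c(2) unfolding eq w_def[symmetric] by (simp add: det_mult[of _ ?n])
  have "PSL_class ?n (block_diag ?n q u') \<in> T_J r q"
  proof (rule Suc.IH)
    show "\<forall>b\<in>{k..r}. u' b = u' r"
    proof
      fix b assume b: "b \<in> {k..r}"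
      have ur: "u r = u (Suc k)" by (rule bspec[OF Suc.prems(4), symmetric]) (use Suc.prems(1) in simp)
      show "u' b = u' r"
      proof (cases "b = k")
        case True
        then show ?thesis using Suc.prems(1) Suc.prems(2)[rule_format, of k] Suc.prems(2)[rule_format, of "Suc k"] c(1) ur by (simp add: u'_def w_def t_def)
      next
        case False
        then have "u b = u r" by (intro bspec[OF Suc.prems(4)]) (use b in simp)
        then show ?thesis using False b Suc.prems(1) by (simp add: u'_def w_def)
      qed
    qed
  qed (use Suc.prems(1-3) w0 du' in \<open>auto simp: u'_def\<close>)
  moreover have "PSL_class ?n (block_diag ?n q w) \<in> T_J r q"
    unfolding T_J_def
  proof (rule generate.incl)
    have "one_param ?n (Suc k * q) t = PSL_class ?n (block_diag ?n q w)"
      unfolding w_def by (rule one_param_class[OF q _ Suc.prems(1) t c(1) n c(2)]) simp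
    then show "PSL_class ?n (block_diag ?n q w) \<in> {one_param ?n (j * q) t |j t. j \<in> {1..r} \<and> t \<noteq> 0}"
      using t Suc.prems(1) by (intro CollectI exI[of _ "Suc k"] exI[of _ t]) auto
  qed
  ultimately have "PSL_class ?n (block_diag ?n q u') \<otimes>\<^bsub>PSL ?n\<^esub> PSL_class ?n (block_diag ?n q w) \<in> T_J r q"
    unfolding T_J_def by (rule generate.eng)
  moreover have "PSL_class ?n (block_diag ?n q u) =
      PSL_class ?n (block_diag ?n q u') \<otimes>\<^bsub>PSL ?n\<^esub> PSL_class ?n (block_diag ?n q w)"
    using hom_mult[of "block_diag ?n q u'" "block_diag ?n q w"] du' c(2)
    by (simp add: eq SL_simps w_def)
  ultimately show ?case by simp
qed

lemma T_J_Union: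
  assumes q: "q > 0"
  shows "\<Union>(T_J r q) = block_torus (dim_n r q) q"
proof (rule equalityI; rule subsetI)
  let ?n = "dim_n r q"
  have n: "?n = r * q + 1" "?n > 0" by (simp_all add: dim_n_def)
  interpret group_hom "SL ?n" "PSL ?n" "PSL_class ?n" by (rule PSL_class_group_hom)
  {
    fix A assume "A \<in> \<Union>(T_J r q)"
    have "T_J r q \<subseteq> PSL_class ?n ` block_torus ?n q"
      unfolding T_J_def
    proof (rule H.generate_subgroup_incl[OF _ subgroup_img_is_subgroup[OF block_torus_subgroup]], rule subsetI)
      fix S assume "S \<in> {one_param ?n (j * q) t |j t. j \<in> {1..r} \<and> t \<noteq> 0}"
      then obtain k t where "k \<in> {1..r}" and t: "t \<noteq> 0" and S: "S = one_param ?n (k * q) t" by blast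
      then have k: "0 < k" "k \<le> r" by auto
      obtain c where c: "c \<noteq> 0" "det (block_diag ?n q (\<lambda>b. if b < k then c * t else c)) = 1"
        using one_param_ex[OF q k t n(1)] by auto
      have "block_diag ?n q (\<lambda>b. if b < k then c * t else c) \<in> block_torus ?n q"
        unfolding block_torus_def using c t by (intro CollectI exI conjI) auto
      then show "S \<in> PSL_class ?n ` block_torus ?n q"
        using one_param_class[OF q k t c(1) n(1) c(2)] S by blast
    qed
    then obtain u where u: "\<forall>b. u b \<noteq> 0" "det (block_diag ?n q u) = 1" "A \<in> PSL_class ?n (block_diag ?n q u)"
      using \<open>A \<in> \<Union>(T_J r q)\<close> by (auto simp: block_torus_def)
    then obtain c where c: "c ^ ?n = 1" "A = c \<cdot>\<^sub>m block_diag ?n q u"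
      using mem_PSL_class_iff[of "block_diag ?n q u" ?n A] n by (auto simp: SL_simps)
    then have "c \<noteq> 0" using n(2) by (auto simp: power_0_left)
    then show "A \<in> block_torus ?n q"
      unfolding block_torus_def c(2) using c(1) u
      by (intro CollectI exI[of _ "\<lambda>b. c * u b"]) (auto simp: smult_block_diag[symmetric])
  }
  fix A assume "A \<in> block_torus ?n q"
  then obtain u where u: "A = block_diag ?n q u" "\<forall>b. u b \<noteq> 0" "det A = 1" by (auto simp: block_torus_def)
  have "PSL_class ?n A \<in> T_J r q"
    using block_torus_generated[OF q, of r r u] u by simp
  moreover have "A \<in> PSL_class ?n A"
    using mem_PSL_class_iff[of A ?n A] u n by (auto simp: SL_simps intro!: exI[of _ 1])
  ultimately show "A \<in> \<Union>(T_J r q)" by blast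
qed

lemma T_J_act_iff:
  assumes "q > 0"
  shows "\<gamma> \<in> T_J_act r q \<longleftrightarrow> (\<exists>u. (\<forall>b. u b \<noteq> 0) \<and> (\<Prod>b<r. u b) ^ q * u r = 1 \<and>
     \<gamma> = ext_act (dim_n r q) r (block_diag (dim_n r q) q u))"
  unfolding T_J_act_def T_J_Union[OF assms] block_torus_def det_block_diag
  using prod_blocks[OF assms, of _ r] by (auto simp: dim_n_def)

lemma ext_act_block_diag:
  "ext_act n r (block_diag n q u) v =
     (\<lambda>K. if K \<in> plucker_idx n r then (\<Prod>p\<in>K. u (p div q)) * v K else 0)"
proof
  fix K
  show "ext_act n r (block_diag n q u) v K =
      (if K \<in> plucker_idx n r then (\<Prod>p\<in>K. u (p div q)) * v K else 0)"
  proof (cases "K \<in> plucker_idx n r")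
    case True
    then show ?thesis
      using ext_act_diagonal[of "block_diag n q u" n "\<lambda>p. u (p div q)" K r v] by (simp add: block_diag_def)
  qed (simp add: ext_act_def)
qed

lemma ext_act_line: "ext_act n r A ` line v = line (ext_act n r A v)"
proof -
  have "ext_act n r A (\<lambda>i. c * v i) = (\<lambda>i. c * ext_act n r A v i)" for c
    by (auto simp: ext_act_def sum_distrib_left algebra_simps)
  then show ?thesis unfolding line_def by (auto simp: image_def)
qed

lemma ext_act_block_diag_pvec:
  "ext_act n r (block_diag n q u) (pvec n r G) = pvec n r (\<lambda>p l. u (p div q) * G p l)"
proof
  fix K
  show "ext_act n r (block_diag n q u) (pvec n r G) K = pvec n r (\<lambda>p l. u (p div q) * G p l) K"
    unfolding ext_act_block_diag pvec_def
    using minor_scale[of K r "\<lambda>p. u (p div q)" G "\<lambda>_. 1"] plucker_idxD[of K n r] by auto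
qed

section \<open>The open cell and the Schubert variety\<close>

text \<open>Rows and columns are 0-based, the parameters 1-based: column l belongs to j = l + 1, and
  its pivot row jq + 1 is position \<open>(l + 1) * q\<close>.\<close>

definition cell_mat :: "nat \<Rightarrow> (nat \<Rightarrow> nat \<Rightarrow> complex) \<Rightarrow> nat \<Rightarrow> nat \<Rightarrow> complex" where
  "cell_mat q a p l = (if p = (l + 1) * q then 1
     else if p + 1 \<in> C_set q (l + 1) then a (p + 1) (l + 1) else 0)"

lemma foldr_comp_append:
  "foldr (\<circ>) (fs @ gs) id = foldr (\<circ>) fs id \<circ> foldr (\<circ>) gs (id :: 'a \<Rightarrow> 'a)"
  by (induction fs) (auto simp: comp_assoc)

text \<open>The cycle s_(a+m-1) ... s_a; the j-th factor of the word is the case a = j, a + m = jq +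
  1.\<close>

definition seg :: "nat \<Rightarrow> nat \<Rightarrow> nat \<Rightarrow> nat" where
  "seg a m = foldr (\<circ>) (map simple_reflection (rev [a..<a + m])) id"

lemma seg_Suc: "seg a (Suc m) = simple_reflection (a + m) \<circ> seg a m"
  by (simp add: seg_def)

lemma seg_values: "seg a m a = a + m" "k < a \<Longrightarrow> seg a m k = k" "k > a + m \<Longrightarrow> seg a m k = k"
proof -
  show "seg a m a = a + m"
    by (induction m) (auto simp: seg_Suc simple_reflection_def, simp add: seg_def)
  show "k < a \<Longrightarrow> seg a m k = k"
    by (induction m) (auto simp: seg_Suc simple_reflection_def transpose_def, simp add: seg_def)
  show "k > a + m \<Longrightarrow> seg a m k = k"
    by (induction m) (auto simp: seg_Suc simple_reflection_def transpose_def, simp add: seg_def)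
qed

lemma w_elt_Suc:
  assumes "q > 0"
  shows "w_elt (Suc r) q = w_elt r q \<circ> seg (Suc r) (Suc r * q + 1 - Suc r)"
proof -
  have "Suc r \<le> Suc r * q" using mult_le_mono2[of 1 q "Suc r"] assms by simp
  then have "Suc r + (Suc r * q + 1 - Suc r) = Suc r * q + 1" by linarith
  moreover have "[1..<Suc r + 1] = [1..<r + 1] @ [Suc r]" by simp
  ultimately show ?thesis unfolding w_elt_def seg_def
    by (simp only: map_append concat_append foldr_comp_append list.map concat.simps append_Nil2)
qed

text \<open>The last factor acts first. It sends r to rq + 1 and fixes all smaller indices, and the
  remaining factors fix everything above (r - 1)q + 1. So each j is moved only by its own
  factor.\<close>

lemma w_elt_values:
  assumes q: "q > 0"
  shows "k > r * q + 1 \<Longrightarrow> w_elt r q k = k" and "1 \<le> j \<Longrightarrow> j \<le> r \<Longrightarrow> w_elt r q j = j * q + 1"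
proof -
  have le: "Suc r \<le> Suc r * q" for r using mult_le_mono2[of 1 q "Suc r"] assms by simp
  have fixed: "k > r * q + 1 \<Longrightarrow> w_elt r q k = k" for k r
  proof (induction r)
    case 0 then show ?case by (simp add: w_elt_def)
  next
    case (Suc r)
    then show ?case using le[of r] seg_values(3)[of "Suc r" "Suc r * q + 1 - Suc r" k] by (simp add: w_elt_Suc[OF q])
  qed
  then show "k > r * q + 1 \<Longrightarrow> w_elt r q k = k" by blast
  show "1 \<le> j \<Longrightarrow> j \<le> r \<Longrightarrow> w_elt r q j = j * q + 1"
  proof (induction r)
    case (Suc r)
    show ?case
    proof (cases "j = Suc r")
      case True
      have "Suc r + (Suc r * q + 1 - Suc r) = Suc r * q + 1" using le[of r] by linarith
      then have "seg (Suc r) (Suc r * q + 1 - Suc r) j = Suc r * q + 1"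
        using seg_values(1)[of "Suc r" "Suc r * q + 1 - Suc r"] True by simp
      then show ?thesis using fixed[of r "Suc r * q + 1"] q True by (simp add: w_elt_Suc[OF q] del: mult_Suc)
    next
      case False
      then show ?thesis using Suc seg_values(2)[of j "Suc r"] by (simp add: w_elt_Suc[OF q])
    qed
  qed simp
qed

lemma C_setD:
  assumes "i \<in> C_set q j" "1 \<le> j"
  shows "1 \<le> i" "i \<le> j * q" "1 \<le> l \<Longrightarrow> l \<le> j \<Longrightarrow> i \<noteq> l * q + 1"
proof -
  have i: "1 \<le> i" "i \<le> j * q + 1" "\<not> (\<exists>l\<in>{1..j}. i = l * q + 1)"
    using assms unfolding C_set_def by auto
  show "1 \<le> i" by (rule i)
  show "1 \<le> l \<Longrightarrow> l \<le> j \<Longrightarrow> i \<noteq> l * q + 1" using i(3) by auto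
  have "i \<noteq> j * q + 1" using i(3) assms(2) by auto
  then show "i \<le> j * q" using i(2) by simp
qed

lemma C_setI: "1 \<le> i \<Longrightarrow> i \<le> j * q \<Longrightarrow> (\<And>l. 1 \<le> l \<Longrightarrow> l \<le> j \<Longrightarrow> i \<noteq> l * q + 1) \<Longrightarrow> i \<in> C_set q j"
  unfolding C_set_def by auto

lemma finite_C_set [simp]: "finite (C_set q j)"
  unfolding C_set_def by simp

text \<open>Row lq + 1 is removed from \<open>C_set q j\<close> if l \<le> j and exceeds its bound
  if l > j. The pivot row of any column thus carries no parameter in any other column.\<close>

lemma Suc_mult_notin_C_set: assumes "1 \<le> l" "1 \<le> j" shows "l * q + 1 \<notin> C_set q j"
proof
  assume C: "l * q + 1 \<in> C_set q j"
  have "l * q < j * q" using C_setD(2)[OF C assms(2)] by linarith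
  then have "l < j" using mult_less_cancel2 by blast
  then show False using C_setD(3)[OF C assms(2,1)] by simp
qed

lemma distinct_concat_map:
  assumes "distinct xs" "\<And>x. x \<in> set xs \<Longrightarrow> distinct (f x)"
    "\<And>x y. x \<in> set xs \<Longrightarrow> y \<in> set xs \<Longrightarrow> x \<noteq> y \<Longrightarrow> set (f x) \<inter> set (f y) = {}"
  shows "distinct (concat (map f xs))"
  using assms
proof (induction xs)
  case (Cons x xs)
  have "set (f x) \<inter> set (f y) = {}" if "y \<in> set xs" for y
    using Cons.prems(1) that by (intro Cons.prems(3)) auto
  moreover have "distinct (concat (map f xs))" by (rule Cons.IH) (use Cons.prems in auto)
  ultimately show ?case using Cons.prems(2)[of x] by auto
qed simp

section \<open>Products of root subgroup elements\<close>

definition unip :: "nat \<Rightarrow> nat \<Rightarrow> (nat \<Rightarrow> nat \<Rightarrow> complex) \<Rightarrow> (nat \<times> nat) list \<Rightarrow> complex mat \<Rightarrow> complex mat" where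
  "unip n q a L W = foldr (*) (map (\<lambda>(i, j). u_beta n q (a i j) i j) L) W"

definition roots_list :: "nat \<Rightarrow> nat \<Rightarrow> (nat \<times> nat) list" where
  "roots_list r q = concat (map (\<lambda>j. map (\<lambda>i. (i, j)) (sorted_list_of_set (C_set q j))) [1..<r + 1])"

lemma set_roots_list: "set (roots_list r q) = {(i, j). 1 \<le> j \<and> j \<le> r \<and> i \<in> C_set q j}"
  unfolding roots_list_def by auto

lemma distinct_roots_list: "distinct (roots_list r q)"
  unfolding roots_list_def
  by (rule distinct_concat_map) (auto simp: distinct_map inj_on_def)

lemma cell_pt_unip: "cell_pt r q a = plucker_pt (dim_n r q) r
    (unip (dim_n r q) q a (roots_list r q) (weyl_rep (dim_n r q) (w_elt r q)))"
  unfolding cell_pt_def unip_def roots_list_def by (simp add: map_concat comp_def)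

lemma unip_Nil: "unip n q a [] W = W"
  and unip_Cons: "unip n q a ((i, j) # L) W = addrow_mat n (a i j) (i - 1) (j * q) * unip n q a L W"
  by (simp_all add: unip_def u_beta_def)

lemma roots_bounds:
  assumes "1 \<le> j" "j \<le> r" "i \<in> C_set q j" "n = r * q + 1"
  shows "i - 1 < j * q" "j * q < n"
proof -
  show "i - 1 < j * q" using C_setD(1,2)[OF assms(3,1)] by linarith
  have "j * q \<le> r * q" using assms(2) by (rule mult_le_mono1)
  then show "j * q < n" using assms(4) by linarith
qed

lemma unip_carrier:
  "W \<in> carrier_mat n m \<Longrightarrow> unip n q a L W \<in> carrier_mat n m"
proof (induction L)
  case (Cons x L)
  then show ?case by (cases x) (auto simp: unip_Cons)
qed (simp add: unip_Nil)

lemma unip_mult: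
  assumes "W \<in> carrier_mat n m" shows "unip n q a L W = unip n q a L (1\<^sub>m n) * W"
proof (induction L)
  case Nil then show ?case using assms by (simp add: unip_Nil)
next
  case (Cons x L)
  have c: "unip n q a L (1\<^sub>m n) \<in> carrier_mat n n" by (rule unip_carrier) simp
  obtain i j where "x = (i, j)" by (cases x)
  then show ?case using Cons assoc_mult_mat[OF _ c assms, of "addrow_mat n (a i j) (i - 1) (j * q)" n]
    by (simp add: unip_Cons)
qed

text \<open>The position (i - 1, jq) of a root lies above the diagonal, because i - 1 < jq.\<close>

lemma unip_borel:
  assumes n: "n = r * q + 1" and L: "set L \<subseteq> {(i, j). 1 \<le> j \<and> j \<le> r \<and> i \<in> C_set q j}"
  shows "unip n q a L (1\<^sub>m n) \<in> borel_SL n"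
  using L
proof (induction L)
  case Nil then show ?case by (auto simp: unip_Nil borel_SL_def SL_simps)
next
  case (Cons x L)
  obtain i j where x: "x = (i, j)" by (cases x)
  let ?A = "unip n q a L (1\<^sub>m n)"
  have A: "?A \<in> carrier_mat n n" "det ?A = 1" "upper_triangular ?A"
    using Cons by (auto simp: borel_SL_def SL_simps)
  have ij: "i - 1 < j * q" "j * q < n"
    using roots_bounds[of j r i q n] Cons.prems n by (auto simp: x)
  have "unip n q a (x # L) (1\<^sub>m n) = addrow (a i j) (i - 1) (j * q) ?A"
    using addrow_mat[OF A(1) ij(2)] by (simp add: x unip_Cons)
  moreover have "upper_triangular (addrow (a i j) (i - 1) (j * q) ?A)"
  proof (rule upper_triangularI)
    fix p l assume "l < p" "p < dim_row (addrow (a i j) (i - 1) (j * q) ?A)"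
    then show "addrow (a i j) (i - 1) (j * q) ?A $$ (p, l) = 0"
      using A ij upper_triangularD[OF A(3)] by auto
  qed
  moreover have "det (addrow (a i j) (i - 1) (j * q) ?A) = 1"
    using det_addrow[OF ij(2) _ A(1)] ij A(2) by simp
  ultimately show ?case using A(1) by (simp add: borel_SL_def SL_simps)
qed

lemma r_le_n: "q > 0 \<Longrightarrow> r \<le> dim_n r q"
  unfolding dim_n_def by (induction r) auto

text \<open>Each factor adds a multiple of a pivot row to a row that is not a pivot row. Pivot rows
  never change and stay unit vectors in the first r columns, so the factors do not interact and each
  contributes exactly its own parameter.\<close>

lemma unip_entries:
  assumes q: "q > 0" and n: "n = r * q + 1"
    and W: "W \<in> carrier_mat n n" "\<And>p l. p < n \<Longrightarrow> l < r \<Longrightarrow> W $$ (p, l) = (if p = (l + 1) * q then 1 else 0)"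
  shows "distinct L \<Longrightarrow> set L \<subseteq> {(i, j). 1 \<le> j \<and> j \<le> r \<and> i \<in> C_set q j} \<Longrightarrow> p < n \<Longrightarrow> l < r \<Longrightarrow>
    unip n q a L W $$ (p, l) = (if p = (l + 1) * q then 1
      else if (p + 1, l + 1) \<in> set L then a (p + 1) (l + 1) else 0)"
proof (induction L arbitrary: p)
  case Nil then show ?case using W by (simp add: unip_Nil)
next
  case (Cons x L)
  obtain i j where x: "x = (i, j)" by (cases x)
  have j: "1 \<le> j" "j \<le> r" and i: "i \<in> C_set q j" using Cons.prems by (auto simp: x)
  note ij = roots_bounds[OF j i n]
  have i1: "1 \<le> i" using C_setD[OF i j(1)] by simp
  let ?A = "unip n q a L W"
  have A: "?A \<in> carrier_mat n n" by (rule unip_carrier[OF W(1)])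
  have ln: "l < n" using Cons.prems(4) r_le_n[OF q, of r] by (simp add: n dim_n_def)
  have IH: "?A $$ (p', l) = (if p' = (l + 1) * q then 1
      else if (p' + 1, l + 1) \<in> set L then a (p' + 1) (l + 1) else 0)" if "p' < n" for p'
    using Cons.IH[of p'] Cons.prems that by simp
  have e: "unip n q a (x # L) W $$ (p, l) =
      (if i - 1 = p then a i j * ?A $$ (j * q, l) + ?A $$ (p, l) else ?A $$ (p, l))"
    using addrow_mat[OF A ij(2), of "a i j" "i - 1"] A Cons.prems(3) ln by (simp add: x unip_Cons flip: addrow_mat[OF A ij(2)])
  have src: "?A $$ (j * q, l) = (if j = l + 1 then 1 else 0)"
  proof -
    have "(j * q + 1, l + 1) \<notin> set L"
      using Cons.prems(2) Suc_mult_notin_C_set[OF j(1)] by auto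
    moreover have "j * q = (l + 1) * q \<longleftrightarrow> j = l + 1" using q by (simp only: mult_cancel2) simp
    ultimately show ?thesis using IH[OF ij(2)] by simp
  qed
  show ?case
  proof (cases "i = p + 1 \<and> j = l + 1")
    case True
    have "p \<noteq> (l + 1) * q" using Suc_mult_notin_C_set[OF j(1) j(1)] i True by auto
    moreover have "(p + 1, l + 1) \<notin> set L" using Cons.prems(1) True x by auto
    ultimately show ?thesis using e src IH[OF Cons.prems(3)] True x by simp
  next
    case False
    then have "(p + 1, l + 1) \<in> set (x # L) \<longleftrightarrow> (p + 1, l + 1) \<in> set L" using x by auto
    moreover have "unip n q a (x # L) W $$ (p, l) = ?A $$ (p, l)"
      using e src False i1 by auto
    ultimately show ?thesis using IH[OF Cons.prems(3)] by simp
  qed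
qed

lemma weyl_rep_entries:
  assumes q: "q > 0" and n: "n = r * q + 1" and "p < n" "l < r"
  shows "weyl_rep n (w_elt r q) $$ (p, l) = (if p = (l + 1) * q then 1 else 0)"
proof -
  have "l < n" using assms(4) r_le_n[OF q, of r] by (simp add: n dim_n_def)
  then show ?thesis using w_elt_values(2)[OF q, of "l + 1" r] assms by (auto simp: weyl_rep_def)
qed

lemma cell_pt_eq:
  assumes q: "q > 0"
  shows "cell_pt r q a = line (pvec (dim_n r q) r (cell_mat q a))"
proof -
  let ?n = "dim_n r q"
  have n: "?n = r * q + 1" by (simp add: dim_n_def)
  have W: "weyl_rep ?n (w_elt r q) \<in> carrier_mat ?n ?n" by (simp add: weyl_rep_def)
  note We = weyl_rep_entries[OF q n]
  show ?thesis unfolding cell_pt_unip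
    by (subst plucker_pt_pvec[OF unip_carrier[OF W] r_le_n[OF q]], rule arg_cong[of _ _ line], rule pvec_cong)
      (use unip_entries[OF q n W We distinct_roots_list, where a = a] in \<open>auto simp: set_roots_list cell_mat_def\<close>)
qed

text \<open>The positions of the pivots, that is the Plucker index of the point of w. Inside the
  Schubert variety the open cell is where this coordinate is nonzero.\<close>

definition top_idx :: "nat \<Rightarrow> nat \<Rightarrow> nat set" where
  "top_idx r q = (\<lambda>l. (l + 1) * q) ` {..<r}"

lemma top_idx_facts:
  assumes q: "q > 0"
  shows "top_idx r q \<in> plucker_idx (dim_n r q) r" "l < r \<Longrightarrow> pick (top_idx r q) l = (l + 1) * q"
proof -
  have inj: "inj_on (\<lambda>l. (l + 1) * q) A" for A using q by (auto simp: inj_on_def)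
  have le: "(l + 1) * q \<le> r * q" if "l < r" for l using that by (intro mult_le_mono1) simp
  show "top_idx r q \<in> plucker_idx (dim_n r q) r"
    using inj le by (auto simp: plucker_idx_def top_idx_def dim_n_def card_image less_Suc_eq_le simp del: mult_Suc)
  assume l: "l < r"
  have "{a \<in> top_idx r q. a < (l + 1) * q} = (\<lambda>l. (l + 1) * q) ` {..<l}"
    using q l by (auto simp: top_idx_def simp del: mult_Suc)
  then have "card {a \<in> top_idx r q. a < (l + 1) * q} = l" using inj by (simp add: card_image)
  moreover have "(l + 1) * q \<in> top_idx r q" using l by (auto simp: top_idx_def)
  ultimately show "pick (top_idx r q) l = (l + 1) * q" using pick_card_in_set by metis
qed

lemma cell_mat_normalized:
  assumes q: "q > 0" shows "normalized r (cell_mat q a) (top_idx r q)"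
  unfolding normalized_def
proof (intro allI impI)
  fix i l assume "i < r" "l < r"
  then show "cell_mat q a (pick (top_idx r q) i) l = (if i = l then 1 else 0)"
    using top_idx_facts(2)[OF q] Suc_mult_notin_C_set[of "i + 1" "l + 1" q] q
    by (simp add: cell_mat_def del: mult_Suc)
qed

lemma pvec_top: "q > 0 \<Longrightarrow> pvec (dim_n r q) r (cell_mat q a) (top_idx r q) = 1"
  using top_idx_facts(1) minor_normalized[OF cell_mat_normalized] by (simp add: pvec_def)

text \<open>Up to sign the entries in nonpivot rows are themselves Plucker coordinates, namely those
  whose index differs from the pivot index in one row. Hence a parameter is a ratio of two
  coordinates.\<close>

lemma exchange_coordinate:
  assumes q: "q > 0" and G: "normalized r G (top_idx r q)"
    and p: "p < dim_n r q" "p \<notin> top_idx r q" and l: "l < r"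
  shows "pvec (dim_n r q) r G (exchange (top_idx r q) l p) = exchange_sign r (top_idx r q) l p * G p l"
    and "exchange (top_idx r q) l p \<in> plucker_idx (dim_n r q) r"
    and "exchange_sign r (top_idx r q) l p \<noteq> 0"
proof -
  note t = top_idx_facts(1)[OF q, of r]
  show ex: "exchange (top_idx r q) l p \<in> plucker_idx (dim_n r q) r" by (rule exchange_idx[OF t l p])
  show "pvec (dim_n r q) r G (exchange (top_idx r q) l p) = exchange_sign r (top_idx r q) l p * G p l"
    using minor_exchange[OF plucker_idxD(2,3)[OF t] l p(2) G] ex by (simp add: pvec_def)
  show "exchange_sign r (top_idx r q) l p \<noteq> 0"
    by (rule exchange_sign_nonzero[OF plucker_idxD(2,3)[OF t] l p(2)])
qed

lemma C_set_position:
  assumes q: "q > 0" and j: "1 \<le> j" "j \<le> r" and i: "i \<in> C_set q j"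
  shows "i - 1 < dim_n r q" "i - 1 \<notin> top_idx r q" "cell_mat q a (i - 1) (j - 1) = a i j"
proof -
  note b = roots_bounds[OF j i, of "dim_n r q"]
  show "i - 1 < dim_n r q" using b by (simp add: dim_n_def)
  have i1: "1 \<le> i" using C_setD[OF i j(1)] by simp
  have ne: "i - 1 \<noteq> (l + 1) * q" for l
    using Suc_mult_notin_C_set[OF _ j(1), of "l + 1"] i i1 by (metis le_add2 le_add_diff_inverse2)
  then show "i - 1 \<notin> top_idx r q" by (auto simp: top_idx_def)
  show "cell_mat q a (i - 1) (j - 1) = a i j"
    using ne[of "j - 1"] i i1 j by (simp add: cell_mat_def)
qed

lemma cell_pt_grassmannian:
  assumes q: "q > 0"
  shows "cell_pt r q a \<in> grassmannian (dim_n r q) r" "cell_pt r q a \<in> proj_points (plucker_idx (dim_n r q) r)"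
proof -
  note t = top_idx_facts(1)[OF q, of r]
  have nz: "minor r (cell_mat q a) (top_idx r q) \<noteq> 0"
    using minor_normalized[OF cell_mat_normalized[OF q]] by simp
  show "cell_pt r q a \<in> grassmannian (dim_n r q) r"
    unfolding cell_pt_eq[OF q] by (rule grassmannian_of_minor[OF t nz]) (simp add: dim_n_def)
  show "cell_pt r q a \<in> proj_points (plucker_idx (dim_n r q) r)"
    unfolding cell_pt_eq[OF q] line_in_proj_points using t nz by (auto simp: pvec_def)
qed

section \<open>The Schubert variety as a closure\<close>

definition ambient :: "nat \<Rightarrow> nat \<Rightarrow> (nat set \<Rightarrow> complex) set topology" where
  "ambient r q = subtopology (zariski (plucker_idx (dim_n r q) r)) (grassmannian (dim_n r q) r)"

definition orbit_pts :: "nat \<Rightarrow> nat \<Rightarrow> (nat set \<Rightarrow> complex) set set" where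
  "orbit_pts r q = {plucker_pt (dim_n r q) r (b * weyl_rep (dim_n r q) (w_elt r q)) | b. b \<in> borel_SL (dim_n r q)}"

lemma X_w_closure: "X_w r q = ambient r q closure_of orbit_pts r q"
  unfolding X_w_def schubert_variety_def ambient_def orbit_pts_def ..

lemma X_w_subset: "X_w r q \<subseteq> grassmannian (dim_n r q) r" "X_w r q \<subseteq> proj_points (plucker_idx (dim_n r q) r)"
proof -
  have "X_w r q \<subseteq> topspace (ambient r q)" unfolding X_w_closure by (rule closure_of_subset_topspace)
  then show "X_w r q \<subseteq> grassmannian (dim_n r q) r" "X_w r q \<subseteq> proj_points (plucker_idx (dim_n r q) r)"
    by (auto simp: ambient_def topspace_zariski)
qed

lemma X_w_iff:
  "x \<in> X_w r q \<longleftrightarrow> x \<in> grassmannian (dim_n r q) r \<and> x \<in> proj_points (plucker_idx (dim_n r q) r) \<and>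
     (\<forall>d F. hpoly (plucker_idx (dim_n r q) r) d F \<longrightarrow> x \<in> nonvanishing (plucker_idx (dim_n r q) r) F \<longrightarrow>
        (\<exists>y\<in>orbit_pts r q. y \<in> grassmannian (dim_n r q) r \<and> y \<in> nonvanishing (plucker_idx (dim_n r q) r) F))"
  (is "_ \<longleftrightarrow> ?G x \<and> ?P x \<and> ?R")
proof
  assume x: "x \<in> X_w r q"
  have "?R"
  proof (intro allI impI)
    fix d F assume F: "hpoly (plucker_idx (dim_n r q) r) d F" "x \<in> nonvanishing (plucker_idx (dim_n r q) r) F"
    let ?S = "nonvanishing (plucker_idx (dim_n r q) r) F \<inter> grassmannian (dim_n r q) r"
    have "openin (ambient r q) ?S"
      unfolding ambient_def openin_subtopology using openin_nonvanishing[OF F(1)] by blast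
    moreover have "x \<in> ?S" using x F(2) X_w_subset(1) by blast
    moreover have "\<forall>T. x \<in> T \<and> openin (ambient r q) T \<longrightarrow> (\<exists>y. y \<in> orbit_pts r q \<and> y \<in> T)"
      using x unfolding X_w_closure in_closure_of by (rule conjunct2)
    ultimately obtain y where "y \<in> orbit_pts r q" "y \<in> ?S" by meson
    then show "\<exists>y\<in>orbit_pts r q. y \<in> grassmannian (dim_n r q) r \<and> y \<in> nonvanishing (plucker_idx (dim_n r q) r) F"
      by (intro bexI[of _ y]) simp_all
  qed
  then show "?G x \<and> ?P x \<and> ?R" using x X_w_subset by blast
next
  assume R: "?G x \<and> ?P x \<and> ?R"
  show "x \<in> X_w r q" unfolding X_w_closure in_closure_of
  proof (intro conjI allI impI)
    show "x \<in> topspace (ambient r q)" using R by (simp add: ambient_def topspace_zariski)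
    fix S assume S: "x \<in> S \<and> openin (ambient r q) S"
    then obtain O' where O': "openin (zariski (plucker_idx (dim_n r q) r)) O'" "S = O' \<inter> grassmannian (dim_n r q) r"
      by (auto simp: ambient_def openin_subtopology)
    then obtain d F where F: "hpoly (plucker_idx (dim_n r q) r) d F" "x \<in> nonvanishing (plucker_idx (dim_n r q) r) F"
      "nonvanishing (plucker_idx (dim_n r q) r) F \<subseteq> O'"
      using S unfolding openin_zariski_iff by blast
    then show "\<exists>y. y \<in> orbit_pts r q \<and> y \<in> S" using R O'(2) by blast
  qed
qed

text \<open>By \<open>weyl_rep_entries\<close>, multiplication by the permutation matrix makes
  column (l + 1)q of b the new column l.\<close>

lemma orbit_pt_pvec:
  assumes q: "q > 0" and b: "b \<in> borel_SL (dim_n r q)"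
  shows "plucker_pt (dim_n r q) r (b * weyl_rep (dim_n r q) (w_elt r q)) =
    line (pvec (dim_n r q) r (\<lambda>p l. b $$ (p, (l + 1) * q)))"
proof -
  let ?n = "dim_n r q"
  have n: "?n = r * q + 1" by (simp add: dim_n_def)
  have W: "weyl_rep ?n (w_elt r q) \<in> carrier_mat ?n ?n" by (simp add: weyl_rep_def)
  have bc: "b \<in> carrier_mat ?n ?n" using b by (simp add: borel_SL_def SL_simps)
  have "(b * weyl_rep ?n (w_elt r q)) $$ (p, l) = b $$ (p, (l + 1) * q)" if p: "p < ?n" and l: "l < r" for p l
  proof -
    have ln: "l < ?n" using l r_le_n[OF q, of r] by simp
    have lq: "(l + 1) * q < ?n" using l mult_le_mono1[of "l + 1" r q] n by simp
    have "(b * weyl_rep ?n (w_elt r q)) $$ (p, l) = (\<Sum>k = 0..<?n. b $$ (p, k) * weyl_rep ?n (w_elt r q) $$ (k, l))"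
      using bc W p ln by (auto simp: scalar_prod_def)
    also have "\<dots> = (\<Sum>k = 0..<?n. if k = (l + 1) * q then b $$ (p, (l + 1) * q) else 0)"
      using weyl_rep_entries[OF q n _ l] by (intro sum.cong) (auto simp del: mult_Suc)
    also have "\<dots> = b $$ (p, (l + 1) * q)" using lq by (simp add: sum.delta del: mult_Suc)
    finally show ?thesis .
  qed
  then show ?thesis
    by (subst plucker_pt_pvec[OF _ r_le_n[OF q]], use bc W in simp)
      (rule arg_cong[of _ _ line], rule pvec_cong, simp del: mult_Suc)
qed

lemma cell_pt_in_X_w:
  assumes q: "q > 0" shows "cell_pt r q a \<in> X_w r q"
proof -
  let ?n = "dim_n r q"
  have n: "?n = r * q + 1" by (simp add: dim_n_def)
  have W: "weyl_rep ?n (w_elt r q) \<in> carrier_mat ?n ?n" by (simp add: weyl_rep_def)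
  have "unip ?n q a (roots_list r q) (1\<^sub>m ?n) \<in> borel_SL ?n"
    by (rule unip_borel[OF n]) (simp add: set_roots_list)
  then have "cell_pt r q a \<in> orbit_pts r q"
    unfolding cell_pt_unip orbit_pts_def unip_mult[OF W, of q a "roots_list r q"] by blast
  then show ?thesis unfolding X_w_iff using cell_pt_grassmannian[OF q] by blast
qed

text \<open>On the orbit the coordinate K is a minor of an upper triangular matrix in the columns q,
  2q, ..., rq. A nonzero Leibniz term places the first j of these columns in distinct rows of K up
  to jq. Nonvanishing of a coordinate is an open condition, so the bound passes to the closure. It
  is the Bruhat order on indices.\<close>

lemma X_w_support:
  assumes q: "q > 0" and x: "x \<in> X_w r q" "v \<in> x" "v K \<noteq> 0" and j: "1 \<le> j" "j \<le> r"
  shows "K \<in> plucker_idx (dim_n r q) r" and "j \<le> card (K \<inter> {..j * q})"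
proof -
  let ?I = "plucker_idx (dim_n r q) r"
  have xp: "x \<in> proj_points ?I" using x X_w_subset by blast
  show KI: "K \<in> ?I" using proj_point_vec(3)[OF xp x(2)] x(3) by blast
  have hp: "hpoly ?I 1 (\<lambda>v. v K)" by (rule hpoly.coord[OF KI])
  have "line v = x" by (rule proj_point_vec(1)[OF xp x(2)])
  then have "x \<in> nonvanishing ?I (\<lambda>v. v K)" using line_in_nonvanishing[OF hp, of v] xp x(3) by simp
  then obtain y where y: "y \<in> orbit_pts r q" "y \<in> nonvanishing ?I (\<lambda>v. v K)"
    using x(1) hp unfolding X_w_iff by blast
  then obtain b where b: "b \<in> borel_SL (dim_n r q)" and
    yb: "y = line (pvec (dim_n r q) r (\<lambda>p l. b $$ (p, (l + 1) * q)))"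
    using orbit_pt_pvec[OF q] unfolding orbit_pts_def by blast
  have "minor r (\<lambda>p l. b $$ (p, (l + 1) * q)) K \<noteq> 0"
    using y(2) KI unfolding yb line_in_nonvanishing[OF hp] by (simp add: pvec_def)
  then obtain f where f: "bij_betw f {..<r} K" "\<And>l. l < r \<Longrightarrow> b $$ (f l, (l + 1) * q) \<noteq> 0"
    using minor_nonzero_bij[OF _ plucker_idxD(2,3)[OF KI]] by blast
  have fle: "f l \<le> (l + 1) * q" if l: "l < r" for l
  proof (rule ccontr)
    assume "\<not> f l \<le> (l + 1) * q"
    moreover have "f l < dim_n r q" using f(1) l plucker_idxD(1)[OF KI] by (auto dest!: bij_betwE)
    ultimately have "b $$ (f l, (l + 1) * q) = 0" using b by (auto simp: borel_SL_def SL_simps)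
    then show False using f(2)[OF l] by simp
  qed
  have "f ` {..<j} \<subseteq> K \<inter> {..j * q}"
  proof
    fix p assume "p \<in> f ` {..<j}"
    then obtain l where l: "l < j" "p = f l" by auto
    have "(l + 1) * q \<le> j * q" using l by (intro mult_le_mono1) simp
    then show "p \<in> K \<inter> {..j * q}" using fle[of l] l j f(1) by (auto dest!: bij_betwE)
  qed
  moreover have "card (f ` {..<j}) = j"
    using f(1) j by (subst card_image) (auto simp: bij_betw_def inj_on_def)
  ultimately show "j \<le> card (K \<inter> {..j * q})"
    using card_mono[of "K \<inter> {..j * q}" "f ` {..<j}"] plucker_idxD(3)[OF KI] by simp
qed

lemma grassmannian_minor:
  assumes x: "x \<in> grassmannian n r" "r \<le> n" "v \<in> x" "v K \<noteq> 0" and K: "K \<in> plucker_idx n r"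
  obtains G where "normalized r G K" "x = line (pvec n r G)"
proof -
  obtain g where g: "g \<in> carrier_mat n n" "x = plucker_pt n r g"
    using x(1) by (auto simp: grassmannian_def SL_simps)
  let ?H = "\<lambda>p l. g $$ (p, l)"
  have xl: "x = line (pvec n r ?H)" using plucker_pt_pvec[OF g(1) x(2)] g(2) by simp
  have "minor r ?H K \<noteq> 0" using x(3,4) K unfolding xl line_iff by (auto simp: pvec_def)
  then obtain G s where "normalized r G K" "s \<noteq> 0" "\<And>M. minor r ?H M = s * minor r G M"
    using normalize_minor[OF plucker_idxD(2,3)[OF K]] by metis
  then show ?thesis using that xl line_pvec_scale by metis
qed

text \<open>With the identity in the pivot rows, only the entries in nonpivot rows below the pivot
  of their column have to be shown to be 0. Such an entry is up to sign the coordinate in which the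
  pivot is exchanged for a lower row, and this index has only l elements up to (l + 1)q, one too few
  for \<open>X_w_support\<close>.\<close>

lemma X_w_top_nonzero:
  assumes q: "q > 0" and x: "x \<in> X_w r q" "v \<in> x" "v (top_idx r q) \<noteq> 0"
  obtains a where "x = cell_pt r q a"
proof -
  let ?n = "dim_n r q" and ?K = "top_idx r q"
  note t = top_idx_facts(1)[OF q, of r]
  obtain G where G: "normalized r G ?K" and xl: "x = line (pvec ?n r G)"
    using grassmannian_minor[OF _ r_le_n[OF q] x(2,3) t] x(1) X_w_subset by blast
  define a where "a = (\<lambda>i j. G (i - 1) (j - 1))"
  have "G p l = cell_mat q a p l" if p: "p < ?n" and l: "l < r" for p l
  proof (cases "p \<in> ?K")
    case True
    then obtain m where m: "m < r" "p = (m + 1) * q" by (auto simp: top_idx_def)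
    then have "p = pick ?K m" using top_idx_facts(2)[OF q m(1)] by simp
    then show ?thesis using G cell_mat_normalized[OF q, of r a] m l unfolding normalized_def by simp
  next
    case False
    note ex = exchange_coordinate[OF q G p False l]
    have pl: "p \<noteq> (l + 1) * q" using False l by (auto simp: top_idx_def)
    show ?thesis
    proof (cases "p + 1 \<in> C_set q (l + 1)")
      case True
      then show ?thesis using pl by (simp add: cell_mat_def a_def)
    next
      case notC: False
      \<comment> \<open>Above its pivot, column l is free in every row that is not a pivot
        row.\<close>
      have "p > (l + 1) * q"
      proof (rule ccontr)
        assume "\<not> p > (l + 1) * q"
        then have "p + 1 \<le> (l + 1) * q" using pl by simp
        moreover have "p + 1 \<noteq> m * q + 1" if "1 \<le> m" "m \<le> l + 1" for m
        proof -
          have "m * q \<in> ?K" unfolding top_idx_def using that l by (intro image_eqI[of _ _ "m - 1"]) auto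
          then show ?thesis using False by auto
        qed
        ultimately show False using notC C_setI[of "p + 1" "l + 1" q] by simp
      qed
      have "exchange ?K l p \<inter> {..(l + 1) * q} \<subseteq> (\<lambda>m. (m + 1) * q) ` {..<l}"
      proof
        fix k assume k: "k \<in> exchange ?K l p \<inter> {..(l + 1) * q}"
        then have "k \<in> ?K" "k \<noteq> (l + 1) * q"
          using \<open>p > (l + 1) * q\<close> top_idx_facts(2)[OF q l] by (auto simp: exchange_def)
        then obtain m where m: "k = (m + 1) * q" "m < r" by (auto simp: top_idx_def)
        have "(m + 1) * q < (l + 1) * q" using k m \<open>k \<noteq> (l + 1) * q\<close> by auto
        then have "m + 1 < l + 1" using mult_less_cancel2 by blast
        then show "k \<in> (\<lambda>m. (m + 1) * q) ` {..<l}" using m by auto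
      qed
      then have "card (exchange ?K l p \<inter> {..(l + 1) * q}) \<le> card ((\<lambda>m. (m + 1) * q) ` {..<l})"
        by (intro card_mono) auto
      also have "\<dots> \<le> l" using card_image_le[of "{..<l}"] by simp
      finally have "\<not> l + 1 \<le> card (exchange ?K l p \<inter> {..(l + 1) * q})" by simp
      then have "pvec ?n r G (exchange ?K l p) = 0"
        using X_w_support(2)[OF q x(1), of "pvec ?n r G" "exchange ?K l p" "l + 1"] l xl in_line_self by auto
      then have "G p l = 0" using ex by simp
      then show ?thesis using notC pl by (simp add: cell_mat_def)
    qed
  qed
  then have "pvec ?n r G = pvec ?n r (cell_mat q a)" by (rule pvec_cong)
  then show ?thesis using that[of a] xl cell_pt_eq[OF q, of r a] by simp
qed

text \<open>Scaling the rows turns the pivot of column l into u_(l+1). Dividing this column by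
  u_(l+1) restores the pivot and changes all minors by one common factor.\<close>

lemma ext_act_cell:
  assumes q: "q > 0" and u: "\<forall>b. u b \<noteq> 0"
  shows "ext_act (dim_n r q) r (block_diag (dim_n r q) q u) ` cell_pt r q a =
     cell_pt r q (\<lambda>i j. u ((i - 1) div q) / u j * a i j)"
proof -
  let ?n = "dim_n r q" and ?b = "\<lambda>i j. u ((i - 1) div q) / u j * a i j"
  have "u (p div q) * cell_mat q a p l = 1 * cell_mat q ?b p l * u (l + 1)" for p l
    using u q by (auto simp: cell_mat_def simp del: mult_Suc)
  then have eq: "(\<lambda>p l. u (p div q) * cell_mat q a p l) = (\<lambda>p l. 1 * cell_mat q ?b p l * u (l + 1))"
    by (intro ext)
  have "ext_act ?n r (block_diag ?n q u) ` cell_pt r q a = line (pvec ?n r (\<lambda>p l. u (p div q) * cell_mat q a p l))"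
    unfolding cell_pt_eq[OF q] ext_act_line ext_act_block_diag_pvec ..
  also have "\<dots> = line (pvec ?n r (cell_mat q ?b))"
  proof (rule line_pvec_scale[of "\<Prod>l<r. u (l + 1)"])
    show "(\<Prod>l<r. u (l + 1)) \<noteq> 0" using u by simp
    fix K assume K: "K \<in> plucker_idx ?n r"
    show "minor r (\<lambda>p l. u (p div q) * cell_mat q a p l) K = (\<Prod>l<r. u (l + 1)) * minor r (cell_mat q ?b) K"
      unfolding eq using minor_scale[OF plucker_idxD(2,3)[OF K], of "\<lambda>_. 1" "cell_mat q ?b" "\<lambda>l. u (l + 1)"]
      by simp
  qed
  finally show ?thesis unfolding cell_pt_eq[OF q] .
qed

section \<open>Instability\<close>

lemma sum_blocks:
  assumes "q > 0"
  shows "(\<Sum>p<r * q + 1. g (p div q)) = int q * (\<Sum>b<r. g b) + (g r :: int)"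
proof -
  have "(\<Sum>p<r * q. g (p div q)) = (\<Sum>b<r. \<Sum>p = b * q..<b * q + q. g (p div q))"
    by (rule sum.nat_group[symmetric])
  also have "\<dots> = (\<Sum>b<r. int q * g b)"
  proof (rule sum.cong[OF refl])
    fix b
    have "(\<Sum>p = b * q..<b * q + q. g (p div q)) = (\<Sum>p = b * q..<b * q + q. g b)"
    proof (rule sum.cong[OF refl])
      fix p assume "p \<in> {b * q..<b * q + q}"
      then have "p div q = b" by (intro div_nat_eqI) (auto simp: mult.commute)
      then show "g (p div q) = g b" by simp
    qed
    then show "(\<Sum>p = b * q..<b * q + q. g (p div q)) = int q * g b" by simp
  qed
  finally show ?thesis using assms by (simp add: sum_distrib_left)
qed

lemma prod_powi: "t \<noteq> 0 \<Longrightarrow> (\<Prod>k\<in>K. (t :: complex) powi g k) = t powi (\<Sum>k\<in>K. g k)"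
  by (induction K rule: infinite_finite_induct) (auto simp: power_int_add)

lemma block_diag_times:
  assumes g: "g \<in> carrier_mat n n" and "p < n" "l < n"
  shows "(block_diag n q u * g) $$ (p, l) = u (p div q) * g $$ (p, l)"
proof -
  have "(block_diag n q u * g) $$ (p, l) = (\<Sum>k = 0..<n. (if p = k then u (p div q) else 0) * g $$ (k, l))"
    using assms by (simp add: block_diag_def scalar_prod_def)
  also have "\<dots> = (\<Sum>k = 0..<n. if k = p then u (p div q) * g $$ (p, l) else 0)"
    by (rule sum.cong) auto
  finally show ?thesis using assms by (simp add: sum.delta)
qed

lemma X_w_orbit_pt:
  assumes "x \<in> X_w r q" "hpoly (plucker_idx (dim_n r q) r) d F"
    "x \<in> nonvanishing (plucker_idx (dim_n r q) r) F"
  obtains y where "y \<in> orbit_pts r q" "y \<in> grassmannian (dim_n r q) r"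
    "y \<in> nonvanishing (plucker_idx (dim_n r q) r) F"
  using conjunct2[OF conjunct2[OF assms(1)[unfolded X_w_iff]], rule_format, OF assms(2,3)]
  by (elim bexE conjE) (rule that)

lemma grassmannian_torus:
  assumes x: "x \<in> grassmannian n r" and rn: "r \<le> n"
    and u: "det (block_diag n q u) = 1"
  shows "ext_act n r (block_diag n q u) ` x \<in> grassmannian n r"
proof -
  obtain g where g: "g \<in> carrier (SL n)" "x = plucker_pt n r g"
    using x by (auto simp: grassmannian_def)
  then have gc: "g \<in> carrier_mat n n" "det g = 1" by (auto simp: SL_simps)
  let ?D = "block_diag n q u"
  have Dg: "?D * g \<in> carrier_mat n n" using gc by (intro mult_carrier_mat) auto
  have "?D * g \<in> carrier (SL n)" using gc u Dg by (simp add: SL_simps det_mult[of _ n])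
  moreover have "plucker_pt n r (?D * g) = ext_act n r ?D ` x"
    unfolding g(2) plucker_pt_pvec[OF gc(1) rn] plucker_pt_pvec[OF Dg rn] ext_act_line
      ext_act_block_diag_pvec
    by (rule arg_cong[of _ _ line], rule pvec_cong, rule block_diag_times[OF gc(1)]) (use rn in auto)
  ultimately show ?thesis unfolding grassmannian_def by (metis image_eqI)
qed

text \<open>A diagonal matrix of determinant 1 lies in B, so it preserves the B-orbit. It also
  carries forms to forms of the same degree, so it preserves the closure.\<close>

lemma X_w_torus:
  assumes q: "q > 0" and x: "x \<in> X_w r q" and u: "\<forall>b. u b \<noteq> 0" and d: "det (block_diag (dim_n r q) q u) = 1"
  shows "ext_act (dim_n r q) r (block_diag (dim_n r q) q u) ` x \<in> X_w r q"
proof -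
  let ?n = "dim_n r q" and ?I = "plucker_idx (dim_n r q) r"
  let ?D = "block_diag ?n q u"
  let ?\<gamma> = "ext_act ?n r ?D"
  let ?s = "\<lambda>K. \<Prod>p\<in>K. u (p div q)"
  note rn = r_le_n[OF q, of r]
  have xG: "x \<in> grassmannian ?n r" and xP: "x \<in> proj_points ?I" using subsetD[OF X_w_subset(1) x] subsetD[OF X_w_subset(2) x] by simp_all
  have s0: "?s K \<noteq> 0" for K using u by (cases "finite K") auto
  have \<gamma>P: "?\<gamma> ` y \<in> proj_points ?I" if y: "y \<in> proj_points ?I" for y
  proof -
    obtain v where v: "y = line v" by (rule proj_point_ex[OF y])
    then obtain K where "K \<in> ?I" "v K \<noteq> 0" using y by (auto simp: line_in_proj_points)
    then have "\<exists>K\<in>?I. ?\<gamma> v K \<noteq> 0"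
      using s0 by (intro bexI[of _ K]) (simp_all only: ext_act_block_diag if_True mult_eq_0_iff, simp)
    then show ?thesis unfolding v ext_act_line line_in_proj_points by (simp add: ext_act_block_diag)
  qed
  have F\<gamma>: "F (?\<gamma> v) = F (\<lambda>K. ?s K * v K)" if "hpoly ?I e F" for e F v
    by (rule hpoly_cong[OF that]) (simp add: ext_act_block_diag)
  show ?thesis unfolding X_w_iff
  proof (intro conjI allI impI)
    show "?\<gamma> ` x \<in> grassmannian ?n r" by (rule grassmannian_torus[OF xG rn d])
    show "?\<gamma> ` x \<in> proj_points ?I" by (rule \<gamma>P[OF xP])
    fix e F assume F: "hpoly ?I e F" and xF: "?\<gamma> ` x \<in> nonvanishing ?I F"
    let ?F = "\<lambda>v. F (\<lambda>K. ?s K * v K)"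
    have F': "hpoly ?I e ?F" by (rule hpoly_diagonal[OF F])
    have tr: "line v \<in> nonvanishing ?I ?F \<longleftrightarrow> ?\<gamma> ` line v \<in> nonvanishing ?I F"
      if v: "line v \<in> proj_points ?I" for v
    proof -
      have "line (?\<gamma> v) \<in> proj_points ?I" using \<gamma>P[OF v] by (simp only: ext_act_line)
      then show ?thesis
        unfolding line_in_nonvanishing[OF F'] ext_act_line line_in_nonvanishing[OF F] F\<gamma>[OF F]
        using v by (simp only: simp_thms)
    qed
    obtain v where v: "x = line v" by (rule proj_point_ex[OF xP])
    have "x \<in> nonvanishing ?I ?F" using tr[of v] xP xF unfolding v by (simp only: simp_thms)
    then obtain y where y: "y \<in> orbit_pts r q" "y \<in> grassmannian ?n r" "y \<in> nonvanishing ?I ?F"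
      by (rule X_w_orbit_pt[OF x F'])
    then have yP: "y \<in> proj_points ?I" by (simp add: nonvanishing_def)
    obtain b where b: "b \<in> borel_SL ?n" "y = plucker_pt ?n r (b * weyl_rep ?n (w_elt r q))"
      using y(1) unfolding orbit_pts_def by auto
    then have yb: "y = line (pvec ?n r (\<lambda>p l. b $$ (p, (l + 1) * q)))" using orbit_pt_pvec[OF q] by simp
    have bc: "b \<in> carrier_mat ?n ?n" "det b = 1" "upper_triangular b" using b by (auto simp: borel_SL_def SL_simps)
    note e = block_diag_times[OF bc(1), where u = u and q = q]
    have Dbc: "?D * b \<in> carrier_mat ?n ?n" using bc by (intro mult_carrier_mat) auto
    have "upper_triangular (?D * b)"
    proof (rule upper_triangularI)
      fix i j assume "j < i" "i < dim_row (?D * b)"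
      then show "(?D * b) $$ (i, j) = 0" using e[of i j] upper_triangularD[OF bc(3), of j i] bc(1) by simp
    qed
    then have Db: "?D * b \<in> borel_SL ?n" using bc d Dbc by (simp add: borel_SL_def SL_simps det_mult[of _ ?n])
    have "?\<gamma> ` y = plucker_pt ?n r (?D * b * weyl_rep ?n (w_elt r q))"
      unfolding orbit_pt_pvec[OF q Db] yb ext_act_line ext_act_block_diag_pvec
    proof (rule arg_cong[of _ _ line], rule pvec_cong)
      fix p l assume "p < ?n" "l < r"
      moreover have "(l + 1) * q < ?n"
        using \<open>l < r\<close> mult_le_mono1[of "l + 1" r q] unfolding dim_n_def by linarith
      ultimately show "u (p div q) * b $$ (p, (l + 1) * q) = (?D * b) $$ (p, (l + 1) * q)"
        using e[of p "(l + 1) * q"] by (simp only:)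
    qed
    then have "?\<gamma> ` y \<in> orbit_pts r q" unfolding orbit_pts_def using Db by blast
    moreover have "?\<gamma> ` y \<in> grassmannian ?n r" by (rule grassmannian_torus[OF y(2) rn d])
    moreover have "?\<gamma> ` y \<in> nonvanishing ?I F"
      using tr[of "pvec ?n r (\<lambda>p l. b $$ (p, (l + 1) * q))"] yP y(3) unfolding yb by (simp only: simp_thms)
    ultimately show "\<exists>y\<in>orbit_pts r q. y \<in> grassmannian ?n r \<and> y \<in> nonvanishing ?I F"
      by (intro bexI[of _ "?\<gamma> ` y"] conjI)
  qed
qed

lemma twist_sectionE:
  assumes "f \<in> twist_sections I X d" "p \<in> X"
  obtains e F H where "hpoly I (d + e) F" "hpoly I e H" "\<forall>v\<in>p. H v \<noteq> 0"
    "\<forall>v\<in>\<Union>X. H v \<noteq> 0 \<longrightarrow> f v = F v / H v"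
  using bspec[OF CollectD[OF assms(1)[unfolded twist_sections_def]] assms(2)]
  by (elim exE conjE) (rule that; assumption)

lemma twist_section_homogeneous:
  assumes f: "f \<in> twist_sections I X d" and XI: "X \<subseteq> proj_points I" and p: "p \<in> X" "v \<in> p" and c: "c \<noteq> 0"
  shows "f (\<lambda>i. c * v i) = c ^ d * f v"
proof -
  obtain e F H where 1: "hpoly I (d + e) F" "hpoly I e H" "\<forall>v\<in>p. H v \<noteq> 0"
    "\<forall>v\<in>\<Union>X. H v \<noteq> 0 \<longrightarrow> f v = F v / H v"
    by (rule twist_sectionE[OF f p(1)])
  have pl: "p = line v" using proj_point_vec(1) XI p by blast
  have cv: "(\<lambda>i. c * v i) \<in> p" using c unfolding pl line_iff by blast
  have Hv: "H v \<noteq> 0" using 1(3) p(2) by simp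
  have "f (\<lambda>i. c * v i) = F (\<lambda>i. c * v i) / H (\<lambda>i. c * v i)"
    using 1(3,4) cv p(1) by (meson UnionI)
  also have "\<dots> = c ^ d * (F v / H v)"
    using c by (simp add: hpoly_scale[OF 1(1)] hpoly_scale[OF 1(2)] power_add)
  also have "F v / H v = f v" using 1(4) p Hv by (metis UnionI)
  finally show ?thesis .
qed

lemma minor_tendsto:
  assumes "\<And>p l. l < r \<Longrightarrow> ((\<lambda>t. G t p l) \<longlongrightarrow> G0 p l) \<F>"
  shows "((\<lambda>t. minor r (G t) K) \<longlongrightarrow> minor r G0 K) \<F>"
  unfolding minor_def det_mat_leibniz
proof (intro tendsto_sum tendsto_mult tendsto_const tendsto_prod)
  fix p i assume p: "p \<in> {p. p permutes {0..<r}}" and i: "i \<in> {0..<r}"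
  have "p i < r" using p i permutes_in_image[of p "{0..<r}" i] by auto
  then show "((\<lambda>t. G t (pick K i) (p i)) \<longlongrightarrow> G0 (pick K i) (p i)) \<F>" by (rule assms)
qed

text \<open>Hilbert-Mumford: under the one-parameter subgroup with exponents \<open>\<mu>\<close> the normalized matrix
  \<open>G\<close> converges, after the Plucker vector is divided by a positive power of \<open>t\<close>, to a point of
  the Schubert variety, where an invariant section would have a pole.\<close>

lemma not_semistable:
  assumes q: "q > 0" and x: "x \<in> X_w r q" and xG: "x = line (pvec (dim_n r q) r G)"
    and K: "K \<in> plucker_idx (dim_n r q) r" and G: "normalized r G K"
    and \<mu>0: "int q * (\<Sum>b<r. \<mu> b) + \<mu> r = 0"
    and le: "\<And>p l. p < dim_n r q \<Longrightarrow> l < r \<Longrightarrow> G p l \<noteq> 0 \<Longrightarrow> \<mu> (pick K l div q) \<le> \<mu> (p div q)"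
    and pos: "(\<Sum>k\<in>K. \<mu> (k div q)) > 0"
  shows "x \<notin> V_ss r q"
proof
  let ?n = "dim_n r q" and ?I = "plucker_idx (dim_n r q) r"
  assume "x \<in> V_ss r q"
  then obtain k f where k: "k \<ge> 1" and f: "f \<in> twist_sections ?I (X_w r q) (k * ?n)"
    and inv: "\<forall>\<gamma>\<in>T_J_act r q. \<forall>v\<in>\<Union>(X_w r q). f (\<gamma> v) = f v" and fx: "\<forall>v\<in>x. f v \<noteq> 0"
    unfolding V_ss_def semistable_def by blast
  have n: "?n > 0" "?n = r * q + 1" by (simp_all add: dim_n_def)
  note Kd = plucker_idxD[OF K]
  have XP: "X_w r q \<subseteq> proj_points ?I" by (rule X_w_subset)
  \<comment> \<open>The weight of the pivot row of column l. Dividing column l by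
    \<open>t powi \<nu> l\<close> keeps the identity in the rows K.\<close>
  define \<nu> where "\<nu> = (\<lambda>l. \<mu> (pick K l div q))"
  \<comment> \<open>For p < n the exponent is nonnegative wherever G p l is nonzero, so
    \<open>nat\<close> loses nothing there; where G p l is zero the entry vanishes for every
    exponent. Unlike the torus element, the matrix is thus defined at t = 0 as well.\<close>
  define H where "H = (\<lambda>(t::complex) p l. if p < ?n then t ^ nat (\<mu> (p div q) - \<nu> l) * G p l else 0)"
  define y where "y = (\<lambda>t. pvec ?n r (H t))"
  define N where "N = (\<Sum>k\<in>K. \<mu> (k div q))"
  let ?u = "\<lambda>t b. (t::complex) powi \<mu> b"
  let ?\<gamma> = "\<lambda>t. ext_act ?n r (block_diag ?n q (?u t))"
  have N\<nu>: "N = (\<Sum>l<r. \<nu> l)"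
    unfolding N_def \<nu>_def using sum.reindex_bij_betw[OF Kd(4), of "\<lambda>k. \<mu> (k div q)"] by simp
  have Hnorm: "normalized r (H t) K" for t
    unfolding normalized_def
  proof (intro allI impI)
    fix i l assume i: "i < r" and l: "l < r"
    have "pick K i < ?n" using pick_in_idx[OF K i] Kd(1) by auto
    then show "H t (pick K i) l = (if i = l then 1 else 0)"
      using G i l unfolding normalized_def H_def \<nu>_def by auto
  qed
  have yK: "y t K = 1" for t using minor_normalized[OF Hnorm] K by (simp add: y_def pvec_def)
  have yP: "line (y t) \<in> proj_points ?I" for t
    unfolding line_in_proj_points
  proof
    show "\<forall>i. i \<notin> ?I \<longrightarrow> y t i = 0" by (simp add: y_def pvec_def)
    show "\<exists>i\<in>?I. y t i \<noteq> 0" using yK[of t] by (intro bexI[OF _ K]) simp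
  qed
  have \<gamma>y: "?\<gamma> t (pvec ?n r G) = (\<lambda>M. t powi N * y t M)" if t: "t \<noteq> 0" for t
  proof
    fix M
    show "?\<gamma> t (pvec ?n r G) M = t powi N * y t M"
    proof (cases "M \<in> ?I")
      case True
      note Md = plucker_idxD[OF True]
      have "?\<gamma> t (pvec ?n r G) M = minor r (\<lambda>p l. ?u t (p div q) * G p l) M"
        unfolding ext_act_block_diag_pvec using True by (simp add: pvec_def)
      also have "\<dots> = minor r (\<lambda>p l. 1 * H t p l * (t powi \<nu> l)) M"
      proof (rule minor_cong[OF Md(2,3)])
        fix p l assume p: "p \<in> M" and l: "l < r"
        have pn: "p < ?n" using p Md(1) by auto
        show "?u t (p div q) * G p l = 1 * H t p l * (t powi \<nu> l)"
        proof (cases "G p l = 0")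
          case False
          then have "\<nu> l \<le> \<mu> (p div q)" using le[OF pn l] by (simp add: \<nu>_def)
          then have "t ^ nat (\<mu> (p div q) - \<nu> l) = t powi (\<mu> (p div q) - \<nu> l)"
            by (simp add: power_int_def)
          then have "t ^ nat (\<mu> (p div q) - \<nu> l) * t powi \<nu> l = t powi (\<mu> (p div q) - \<nu> l + \<nu> l)"
            using t power_int_add[of t "\<mu> (p div q) - \<nu> l" "\<nu> l"] by simp
          then have e: "t powi \<mu> (p div q) = t ^ nat (\<mu> (p div q) - \<nu> l) * t powi \<nu> l" by simp
          show ?thesis unfolding e using pn by (simp add: H_def)
        qed (use pn in \<open>simp add: H_def\<close>)
      qed
      also have "\<dots> = minor r (H t) M * (\<Prod>l<r. t powi \<nu> l)"
        unfolding minor_scale[OF Md(2,3), of "\<lambda>_. 1" "H t" "\<lambda>l. t powi \<nu> l"] by simp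
      finally show ?thesis using True by (simp add: y_def pvec_def prod_powi[OF t] N\<nu> mult.commute)
    qed (simp add: ext_act_def y_def pvec_def)
  qed
  have uT: "(\<forall>b. ?u t b \<noteq> 0) \<and> det (block_diag ?n q (?u t)) = 1" if t: "t \<noteq> 0" for t
  proof -
    have "det (block_diag ?n q (?u t)) = t powi (\<Sum>p<r * q + 1. \<mu> (p div q))"
      unfolding det_block_diag n(2) by (rule prod_powi[OF t])
    also have "\<dots> = 1" unfolding sum_blocks[OF q] \<mu>0 by simp
    finally show ?thesis using t by simp
  qed
  have \<gamma>T: "?\<gamma> t \<in> T_J_act r q" if t: "t \<noteq> 0" for t
    unfolding T_J_act_def T_J_Union[OF q] block_torus_def using uT[OF t] by blast
  have yX: "line (y t) \<in> X_w r q" if t: "t \<noteq> 0" for t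
  proof -
    have "?\<gamma> t ` x = line (y t)"
      unfolding xG ext_act_line \<gamma>y[OF t] by (rule line_scale) (use t in simp)
    then show ?thesis using X_w_torus[OF q x, of "?u t"] uT[OF t] by simp
  qed
  have ylim: "((\<lambda>t. y t M) \<longlongrightarrow> y 0 M) (at 0)" for M
  proof (cases "M \<in> ?I")
    case True
    have "((\<lambda>t. minor r (H t) M) \<longlongrightarrow> minor r (H 0) M) (at 0)"
    proof (rule minor_tendsto)
      fix p l
      have "((\<lambda>t. t ^ nat (\<mu> (p div q) - \<nu> l) * G p l) \<longlongrightarrow> 0 ^ nat (\<mu> (p div q) - \<nu> l) * G p l) (at 0)"
        by (intro tendsto_intros)
      then show "((\<lambda>t. H t p l) \<longlongrightarrow> H 0 p l) (at 0)" unfolding H_def by simp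
    qed
    then show ?thesis using True by (simp add: y_def pvec_def)
  qed (simp add: y_def pvec_def)
  have Flim: "((\<lambda>t. F (y t)) \<longlongrightarrow> F (y 0)) (at 0)" if "hpoly ?I d F" for d F
    by (rule hpoly_tendsto[OF that ylim])
  have t0: "\<forall>\<^sub>F t in at (0::complex). t \<noteq> 0" by (simp add: eventually_at_filter)
  \<comment> \<open>A form that is nonzero at the limit is nonzero at \<open>y t\<close> for some t
    other than 0, and these points lie in the Schubert variety.\<close>
  have y0X: "line (y 0) \<in> X_w r q" unfolding X_w_iff
  proof (intro conjI allI impI)
    have "minor r (H 0) K \<noteq> 0" using minor_normalized[OF Hnorm] by simp
    then show "line (y 0) \<in> grassmannian ?n r" unfolding y_def by (rule grassmannian_of_minor[OF K _ n(1)])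
    show "line (y 0) \<in> proj_points ?I" by (rule yP)
    fix d F assume F: "hpoly ?I d F" and "line (y 0) \<in> nonvanishing ?I F"
    then have "F (y 0) \<noteq> 0" using line_in_nonvanishing[OF F] by simp
    then have "\<forall>\<^sub>F t in at 0. F (y t) \<noteq> 0" by (rule tendsto_imp_eventually_ne[OF Flim[OF F]])
    then have "\<forall>\<^sub>F t in at (0::complex). F (y t) \<noteq> 0 \<and> t \<noteq> 0"
      using t0 by (rule eventually_conj)
    then obtain t :: complex where t: "F (y t) \<noteq> 0" "t \<noteq> 0"
      using eventually_happens'[of "at (0::complex)"] at_neq_bot by blast
    then have "line (y t) \<in> nonvanishing ?I F" using line_in_nonvanishing[OF F] yP by simp
    then show "\<exists>z\<in>orbit_pts r q. z \<in> grassmannian ?n r \<and> z \<in> nonvanishing ?I F"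
      using conjunct2[OF conjunct2[OF yX[OF t(2), unfolded X_w_iff]], rule_format, OF F] by simp
  qed
  obtain e A B where AB: "hpoly ?I (k * ?n + e) A" "hpoly ?I e B" "\<forall>v\<in>line (y 0). B v \<noteq> 0"
    "\<forall>v\<in>\<Union>(X_w r q). B v \<noteq> 0 \<longrightarrow> f v = A v / B v"
    by (rule twist_sectionE[OF f y0X])
  have B0: "B (y 0) \<noteq> 0" using AB(3) in_line_self by blast
  let ?v = "pvec ?n r G"
  have vx: "?v \<in> x" unfolding xG by (rule in_line_self)
  define m where "m = nat N * (k * ?n)"
  have m0: "m > 0" using pos k n(1) by (simp add: m_def N_def)
  \<comment> \<open>Invariance and homogeneity give f(v) = t^m f(y t) with m > 0. After
    multiplication by the denominator B the right-hand side tends to 0 with t, while the left-hand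
    side tends to the nonzero value f(v) B(y 0).\<close>
  have key: "f ?v * B (y t) = t ^ m * A (y t)" if t: "t \<noteq> 0" and Bt: "B (y t) \<noteq> 0" for t
  proof -
    have "f ?v = f (?\<gamma> t ?v)" using inv[rule_format, OF \<gamma>T[OF t], of ?v] x vx by (metis UnionI)
    also have "\<dots> = f (\<lambda>M. t powi N * y t M)" unfolding \<gamma>y[OF t] ..
    also have "\<dots> = (t powi N) ^ (k * ?n) * f (y t)"
      by (rule twist_section_homogeneous[OF f XP yX[OF t] in_line_self]) (use t in simp)
    also have "(t powi N) ^ (k * ?n) = t ^ m"
      using pos by (simp add: m_def N_def power_int_def power_mult)
    also have "f (y t) = A (y t) / B (y t)" using AB(4) Bt yX[OF t] in_line_self by (meson UnionI)
    finally show ?thesis using Bt by simp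
  qed
  have ev: "\<forall>\<^sub>F t in at (0::complex). f ?v * B (y t) = t ^ m * A (y t)"
    using tendsto_imp_eventually_ne[OF Flim[OF AB(2)] B0] t0
    by eventually_elim (use key in simp)
  have l1: "((\<lambda>t. f ?v * B (y t)) \<longlongrightarrow> f ?v * B (y 0)) (at 0)"
    by (intro tendsto_intros Flim[OF AB(2)])
  have l2: "((\<lambda>t. t ^ m * A (y t)) \<longlongrightarrow> 0 ^ m * A (y 0)) (at 0)"
    by (intro tendsto_intros Flim[OF AB(1)])
  have "((\<lambda>t. f ?v * B (y t)) \<longlongrightarrow> 0 ^ m * A (y 0)) (at 0)"
    using l2 tendsto_cong[OF ev] by simp
  then have "f ?v * B (y 0) = 0 ^ m * A (y 0)" using tendsto_unique[OF at_neq_bot l1] by simp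
  moreover have "f ?v \<noteq> 0" using fx vx by blast
  moreover have "0 ^ m = (0 :: complex)" using m0 by (simp add: power_0_left)
  ultimately show False using B0 by simp
qed

text \<open>Among the nonzero coordinates choose K with the largest sum of elements. A nonzero entry
  below the pivot of its column would give, by exchange, a nonzero coordinate with a larger sum; so
  nonzero entries lie at or above the pivots. A weight that is high on the first blocks and low on
  the others then meets the conditions of \<open>not_semistable\<close>.\<close>

lemma semistable_top_nonzero:
  assumes q: "q > 0" and x: "x \<in> V_ss r q" "v \<in> x"
  shows "v (top_idx r q) \<noteq> 0"
proof
  assume v0: "v (top_idx r q) = 0"
  let ?n = "dim_n r q" and ?I = "plucker_idx (dim_n r q) r"
  have xX: "x \<in> X_w r q" using x by (auto simp: V_ss_def semistable_def)
  have xP: "x \<in> proj_points ?I" and xG: "x \<in> grassmannian ?n r" using subsetD[OF X_w_subset(1) xX] subsetD[OF X_w_subset(2) xX] by simp_all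
  have finI: "finite ?I" unfolding plucker_idx_def by simp
  let ?S = "{K\<in>?I. v K \<noteq> 0}"
  define w :: "nat set \<Rightarrow> nat" where "w = (\<lambda>M. \<Sum>M)"
  have "?S \<noteq> {}" using proj_point_vec(2)[OF xP x(2)] by blast
  moreover have "finite ?S" using finI by simp
  ultimately have Mx: "Max (w ` ?S) \<in> w ` ?S" and Mle: "\<And>M. M \<in> ?S \<Longrightarrow> w M \<le> Max (w ` ?S)"
    by (auto intro!: Max_in)
  then obtain K where K: "K \<in> ?S" and "w K = Max (w ` ?S)" by auto
  then have max: "\<And>M. M \<in> ?S \<Longrightarrow> w M \<le> w K" using Mle by simp
  have KI: "K \<in> ?I" and vK: "v K \<noteq> 0" using K by auto
  note Kd = plucker_idxD[OF KI]
  obtain G where G: "normalized r G K" and xl: "x = line (pvec ?n r G)"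
    using grassmannian_minor[OF xG r_le_n[OF q] x(2) vK KI] by blast
  have le: "p \<le> pick K l" if p: "p < ?n" and l: "l < r" and nz: "G p l \<noteq> 0" for p l
  proof (cases "p \<in> K")
    case True
    then obtain i where i: "i < r" "p = pick K i" using Kd(4) by (auto simp: bij_betw_def)
    then have "i = l" using G nz l unfolding normalized_def by (metis)
    then show ?thesis using i by simp
  next
    case False
    let ?E = "exchange K l p"
    have E: "?E \<in> ?I" by (rule exchange_idx[OF KI l p False])
    have "pvec ?n r G ?E = exchange_sign r K l p * G p l"
      using E minor_exchange[OF Kd(2,3) l False G] by (simp add: pvec_def)
    then have "pvec ?n r G ?E \<noteq> 0" using exchange_sign_nonzero[OF Kd(2,3) l False] nz by simp
    moreover obtain c where "c \<noteq> 0" "v = (\<lambda>i. c * pvec ?n r G i)" using x(2) unfolding xl line_iff by blast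
    ultimately have "?E \<in> ?S" using E by simp
    then have "w ?E \<le> w K" by (rule max)
    moreover have "w ?E = p + w (K - {pick K l})"
      unfolding exchange_def w_def using Kd(3) False by (subst sum.insert) auto
    moreover have "w K = pick K l + w (K - {pick K l})"
      unfolding w_def by (rule sum.remove[OF Kd(3) pick_in_idx[OF KI l]])
    ultimately show ?thesis by simp
  qed
  \<comment> \<open>Otherwise \<open>X_w_support\<close> gives at least j elements up to jq but
    fewer than j before jq, so jq lies in K for every j. Then K is the pivot index, whose coordinate
    is assumed to vanish.\<close>
  have "\<exists>j\<in>{1..r}. j \<le> card (K \<inter> {..<j * q})"
  proof (rule ccontr)
    assume neg: "\<not> ?thesis"
    have jq: "j * q \<in> K" if j: "1 \<le> j" "j \<le> r" for j
    proof (rule ccontr)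
      assume "j * q \<notin> K"
      then have "K \<inter> {..j * q} = K \<inter> {..<j * q}" by (auto simp: order_le_less)
      then show False using X_w_support(2)[OF q xX x(2) vK j] neg j by auto
    qed
    have "top_idx r q \<subseteq> K"
    proof
      fix k assume "k \<in> top_idx r q"
      then obtain l where l: "l < r" "k = (l + 1) * q" by (auto simp: top_idx_def)
      then show "k \<in> K" using jq[of "l + 1"] by simp
    qed
    then have "top_idx r q = K"
      using card_subset_eq[OF Kd(3)] Kd(2) plucker_idxD(2)[OF top_idx_facts(1)[OF q]] by metis
    then show False using v0 vK by simp
  qed
  then obtain j where j: "1 \<le> j" "j \<le> r" and cj: "j \<le> card (K \<inter> {..<j * q})" by auto
  \<comment> \<open>The jq positions in blocks below j and the remaining (r - j)q + 1 positions must
    have total weight 0, hence these two values. Then A + B = rq + 1, and the weight of K is at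
    least j (A + B) - r B = j.\<close>
  define A B where "A = int q * (int r - int j) + 1" and "B = int q * int j"
  define \<mu> where "\<mu> = (\<lambda>b. if b < j then A else - B)"
  have A0: "A \<ge> 0" and B0: "B \<ge> 0" using j by (simp_all add: A_def B_def)
  have div: "p div q < j \<longleftrightarrow> p < j * q" for p using q by (simp add: div_less_iff_less_mult)
  have "x \<notin> V_ss r q"
  proof (rule not_semistable[OF q xX xl KI G])
    have "(\<Sum>b<r. \<mu> b) = (\<Sum>b\<in>{..<r} \<inter> {b. b < j}. A) + (\<Sum>b\<in>{..<r} \<inter> - {b. b < j}. - B)"
      unfolding \<mu>_def by (rule sum.If_cases) simp
    also have "{..<r} \<inter> {b. b < j} = {..<j}" using j by auto
    also have "{..<r} \<inter> - {b. b < j} = {j..<r}" by auto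
    finally have "(\<Sum>b<r. \<mu> b) = int j * A - (int r - int j) * B" using j by (simp add: of_nat_diff)
    then show "int q * (\<Sum>b<r. \<mu> b) + \<mu> r = 0" using j by (simp add: \<mu>_def A_def B_def algebra_simps)
    show "\<mu> (pick K l div q) \<le> \<mu> (p div q)" if "p < ?n" "l < r" "G p l \<noteq> 0" for p l
      using le[OF that] A0 B0 unfolding \<mu>_def div by auto
    have "(\<Sum>k\<in>K. \<mu> (k div q)) = (\<Sum>k\<in>K \<inter> {k. k < j * q}. A) + (\<Sum>k\<in>K \<inter> - {k. k < j * q}. - B)"
      unfolding \<mu>_def div by (rule sum.If_cases[OF Kd(3)])
    also have "K \<inter> {k. k < j * q} = K \<inter> {..<j * q}" by auto
    also have "K \<inter> - {k. k < j * q} = K - {..<j * q}" by auto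
    also have "(\<Sum>k\<in>K \<inter> {..<j * q}. A) + (\<Sum>k\<in>K - {..<j * q}. - B) =
        int (card (K \<inter> {..<j * q})) * A - int (card (K - {..<j * q})) * B" by simp
    also have "int (card (K - {..<j * q})) = int r - int (card (K \<inter> {..<j * q}))"
    proof -
      have "card K = card (K \<inter> {..<j * q}) + card (K - {..<j * q})"
        using card_Int_Diff[OF Kd(3)] by metis
      then show ?thesis using Kd(2) by simp
    qed
    finally have S: "(\<Sum>k\<in>K. \<mu> (k div q)) =
      int (card (K \<inter> {..<j * q})) * (A + B) - int r * B" by (simp add: algebra_simps)
    have "int j * (A + B) \<le> int (card (K \<inter> {..<j * q})) * (A + B)"
      using cj A0 B0 by (intro mult_right_mono) auto
    moreover have "int j * (A + B) - int r * B = int j" by (simp add: A_def B_def algebra_simps)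
    ultimately show "(\<Sum>k\<in>K. \<mu> (k div q)) > 0" using S j by linarith
  qed
  then show False using x by simp
qed

text \<open>If column j has no nonzero entry but its pivot, a weight that is high on block j alone
  meets the conditions of \<open>not_semistable\<close>: the pivot of each other column has the
  lowest weight.\<close>

lemma semistable_column_nonzero:
  assumes q: "q > 0" and x: "cell_pt r q a \<in> V_ss r q" and j: "1 \<le> j" "j \<le> r"
  shows "\<exists>i\<in>C_set q j. a i j \<noteq> 0"
proof (rule ccontr)
  assume "\<not> ?thesis"
  then have z: "\<And>i. i \<in> C_set q j \<Longrightarrow> a i j = 0" by blast
  note t = top_idx_facts[OF q]
  \<comment> \<open>Block j has one position if j = r and q positions otherwise; A and B make the
    total weight 0. The weight of the pivot index is A - (r - 1) B, which is rq - r + 1 in the first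
    case and 1 in the second.\<close>
  define A B where "A = (if j = r then int r * int q else int q * (int r - 1) + 1)"
    and "B = (if j = r then 1 else int q)"
  define \<mu> where "\<mu> = (\<lambda>b. if b = j then A else - B)"
  have A0: "A \<ge> 0" and B0: "B \<ge> 0" using j by (auto simp: A_def B_def)
  have "cell_pt r q a \<notin> V_ss r q"
  proof (rule not_semistable[OF q cell_pt_in_X_w[OF q] cell_pt_eq[OF q] t(1) cell_mat_normalized[OF q]])
    show "int q * (\<Sum>b<r. \<mu> b) + \<mu> r = 0"
    proof (cases "j = r")
      case True
      then have "(\<Sum>b<r. \<mu> b) = (\<Sum>b<r. - B)" unfolding \<mu>_def by (intro sum.cong) auto
      then show ?thesis using True by (simp add: \<mu>_def A_def B_def)
    next
      case False
      then have jr: "j \<in> {..<r}" using j by simp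
      have "(\<Sum>b<r. \<mu> b) = \<mu> j + (\<Sum>b\<in>{..<r} - {j}. \<mu> b)" by (rule sum.remove[OF _ jr]) simp
      also have "(\<Sum>b\<in>{..<r} - {j}. \<mu> b) = (\<Sum>b\<in>{..<r} - {j}. - B)" unfolding \<mu>_def by (intro sum.cong) auto
      finally have "(\<Sum>b<r. \<mu> b) = A - (int r - 1) * B" using jr by (simp add: \<mu>_def of_nat_diff)
      then show ?thesis using False by (simp add: \<mu>_def A_def B_def algebra_simps)
    qed
    show "\<mu> (pick (top_idx r q) l div q) \<le> \<mu> (p div q)"
      if p: "p < dim_n r q" and l: "l < r" and nz: "cell_mat q a p l \<noteq> 0" for p l
    proof (cases "p = (l + 1) * q")
      case True
      then show ?thesis using t(2)[OF l] by simp
    next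
      case False
      then have "l + 1 \<noteq> j" using nz z[of "p + 1"] by (auto simp: cell_mat_def split: if_splits)
      moreover have "pick (top_idx r q) l div q = l + 1" using t(2)[OF l] q by (simp del: mult_Suc)
      ultimately show ?thesis using A0 B0 by (auto simp: \<mu>_def)
    qed
    have inj: "inj_on (\<lambda>l. (l + 1) * q) {..<r}" using q by (auto simp: inj_on_def)
    have jm: "j - 1 \<in> {..<r}" using j by auto
    have "(\<Sum>k\<in>top_idx r q. \<mu> (k div q)) = (\<Sum>l<r. \<mu> (l + 1))"
      unfolding top_idx_def sum.reindex[OF inj] using q by (simp del: mult_Suc)
    also have "\<dots> = \<mu> (j - 1 + 1) + (\<Sum>l\<in>{..<r} - {j - 1}. \<mu> (l + 1))" by (rule sum.remove[OF _ jm]) simp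
    also have "(\<Sum>l\<in>{..<r} - {j - 1}. \<mu> (l + 1)) = (\<Sum>l\<in>{..<r} - {j - 1}. - B)"
      unfolding \<mu>_def by (intro sum.cong) auto
    finally have S: "(\<Sum>k\<in>top_idx r q. \<mu> (k div q)) = A - (int r - 1) * B"
      using jm j by (simp add: \<mu>_def of_nat_diff)
    show "(\<Sum>k\<in>top_idx r q. \<mu> (k div q)) > 0"
    proof (cases "j = r")
      case True
      have "int r * int q \<ge> int r * 1" using q by (intro mult_left_mono) auto
      then show ?thesis unfolding S using True by (simp add: A_def B_def)
    qed (simp add: S A_def B_def algebra_simps)
  qed
  then show False using x by simp
qed

section \<open>The semistable locus\<close>

text \<open>The rows \<open>\<rho> b\<close> of a nonvanishing maximal minor that meets every block except block \<open>m\<close>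
  exactly once.  They are found along the path from \<open>m\<close> to \<open>0\<close> that leads from \<open>j\<close> to the block of
  a nonzero entry of column \<open>j\<close>.\<close>

lemma transversal_minor:
  assumes q: "q > 0" and a: "\<And>j. 1 \<le> j \<Longrightarrow> j \<le> r \<Longrightarrow> \<exists>i\<in>C_set q j. a i j \<noteq> 0"
  shows "m \<le> r \<Longrightarrow> \<exists>\<rho>. (\<forall>b\<le>r. b \<noteq> m \<longrightarrow> \<rho> b < dim_n r q \<and> \<rho> b div q = b) \<and>
     (\<forall>b. m < b \<longrightarrow> b \<le> r \<longrightarrow> \<rho> b = b * q) \<and>
     (\<forall>c. (\<forall>b\<le>r. b \<noteq> m \<longrightarrow> (\<Sum>l<r. cell_mat q a (\<rho> b) l * c l) = 0) \<longrightarrow> (\<forall>l<r. c l = 0))"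
proof (induction m rule: less_induct)
  case (less m)
  \<comment> \<open>Row bq is a pivot row, so it reads off a single coefficient of c.\<close>
  have unit: "(\<Sum>l<r. cell_mat q a (b * q) l * c l) = c (b - 1)" if b: "1 \<le> b" "b \<le> r" for b c
  proof -
    have br: "b - 1 < r" using b by simp
    have "pick (top_idx r q) (b - 1) = b * q" using top_idx_facts(2)[OF q br] b by simp
    then have "cell_mat q a (b * q) l = (if b - 1 = l then 1 else 0)" if "l < r" for l
      using cell_mat_normalized[OF q, of r a, unfolded normalized_def, rule_format, OF br that] by simp
    then have "(\<Sum>l<r. cell_mat q a (b * q) l * c l) = (\<Sum>l<r. if l = b - 1 then c (b - 1) else 0)"
      by (intro sum.cong) auto
    then show ?thesis using b by (simp add: sum.delta)
  qed
  show ?case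
  proof (cases "m = 0")
    case True
    show ?thesis
    proof (intro exI[of _ "\<lambda>b. b * q"] conjI allI impI)
      fix b assume "b \<le> r" "b \<noteq> m"
      show "b * q < dim_n r q" using mult_le_mono1[OF \<open>b \<le> r\<close>, of q] by (simp only: dim_n_def)
      show "b * q div q = b" using q by simp
    next
      fix c l assume c: "\<forall>b\<le>r. b \<noteq> m \<longrightarrow> (\<Sum>l<r. cell_mat q a (b * q) l * c l) = 0" and l: "l < r"
      have "(\<Sum>k<r. cell_mat q a ((l + 1) * q) k * c k) = 0"
        by (rule c[rule_format]) (use True l in auto)
      then show "c l = 0" using unit[of "l + 1" c] l by simp
    qed simp
  next
    case False
    then obtain i where i: "i \<in> C_set q m" "a i m \<noteq> 0" using a[of m] less.prems by auto
    define b where "b = (i - 1) div q"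
    have m1: "1 \<le> m" using False by simp
    have "i - 1 < m * q" using C_setD(1,2)[OF i(1) m1] by linarith
    then have bm: "b < m" unfolding b_def using q by (simp add: div_less_iff_less_mult)
    \<comment> \<open>These rows meet every block but b. Since b < m, block m is represented by its
      pivot row mq, and the new row set trades this row for row i - 1 in block b.\<close>
    obtain \<rho> where \<rho>: "\<forall>d\<le>r. d \<noteq> b \<longrightarrow> \<rho> d < dim_n r q \<and> \<rho> d div q = d"
      "\<forall>d. b < d \<longrightarrow> d \<le> r \<longrightarrow> \<rho> d = d * q"
      "\<forall>c. (\<forall>d\<le>r. d \<noteq> b \<longrightarrow> (\<Sum>l<r. cell_mat q a (\<rho> d) l * c l) = 0) \<longrightarrow> (\<forall>l<r. c l = 0)"
      using less.IH[OF bm] bm less.prems by auto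
    note pos = C_set_position(1,2)[OF q m1 less.prems i(1)] C_set_position(3)[OF q m1 less.prems i(1), of a]
    show ?thesis
    proof (intro exI[of _ "\<rho>(b := i - 1)"] conjI allI impI)
      fix d assume d: "d \<le> r" "d \<noteq> m"
      show "(\<rho>(b := i - 1)) d < dim_n r q" using \<rho>(1) pos(1) d by (cases "d = b") auto
      show "(\<rho>(b := i - 1)) d div q = d" using \<rho>(1) d by (cases "d = b") (auto simp: b_def)
    next
      fix d assume "m < d" "d \<le> r"
      then show "(\<rho>(b := i - 1)) d = d * q" using \<rho>(2) bm by auto
    next
      fix c l assume c: "\<forall>d\<le>r. d \<noteq> m \<longrightarrow> (\<Sum>l<r. cell_mat q a ((\<rho>(b := i - 1)) d) l * c l) = 0" and l: "l < r"
      have cb: "(\<Sum>l<r. cell_mat q a (i - 1) l * c l) = 0" using c[rule_format, of b] bm less.prems by simp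
      have cd: "c (d - 1) = 0" if d: "b < d" "d \<le> r" "d \<noteq> m" for d
      proof -
        have "(\<rho>(b := i - 1)) d = d * q" using \<rho>(2) d by auto
        then show ?thesis using c[rule_format, OF d(2,3)] unit[of d c] d by simp
      qed
      \<comment> \<open>Row i - 1 lies below the pivots of the columns up to number b, where its
        entries are therefore 0, and the coefficients of the later columns other than column m
        vanish by \<open>cd\<close>. Only the nonzero entry of column m remains.\<close>
      have zero: "cell_mat q a (i - 1) k * c k = 0" if k: "k < r" "k \<noteq> m - 1" for k
      proof (cases "b \<le> k")
        case True
        then have "c k = 0" using cd[of "k + 1"] k False by auto
        then show ?thesis by simp
      next
        case nb: False
        have "(k + 1) * q \<le> b * q" using nb by (intro mult_le_mono1) simp
        also have "b * q \<le> i - 1" unfolding b_def by simp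
        finally have ki: "(k + 1) * q \<le> i - 1" .
        have "i - 1 + 1 \<notin> C_set q (k + 1)"
        proof
          assume "i - 1 + 1 \<in> C_set q (k + 1)"
          from C_setD(2)[OF this] ki show False by linarith
        qed
        moreover have "i - 1 \<noteq> (k + 1) * q" using pos(2) k by (auto simp: top_idx_def)
        ultimately show ?thesis by (simp add: cell_mat_def)
      qed
      have mr: "m - 1 \<in> {..<r}" using less.prems m1 by auto
      have "0 = cell_mat q a (i - 1) (m - 1) * c (m - 1) +
          (\<Sum>k\<in>{..<r} - {m - 1}. cell_mat q a (i - 1) k * c k)"
        using cb sum.remove[OF _ mr, of "\<lambda>k. cell_mat q a (i - 1) k * c k"] by simp
      also have "(\<Sum>k\<in>{..<r} - {m - 1}. cell_mat q a (i - 1) k * c k) = 0"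
        by (rule sum.neutral) (use zero in auto)
      finally have cm: "c (m - 1) = 0" using pos(3) i(2) by simp
      \<comment> \<open>Outside block b the two row sets differ only in block m, whose pivot row
        reads off the coefficient just shown to be 0.\<close>
      have "\<forall>d\<le>r. d \<noteq> b \<longrightarrow> (\<Sum>l<r. cell_mat q a (\<rho> d) l * c l) = 0"
      proof (intro allI impI)
        fix d assume d: "d \<le> r" "d \<noteq> b"
        show "(\<Sum>l<r. cell_mat q a (\<rho> d) l * c l) = 0"
        proof (cases "d = m")
          case True
          then have "\<rho> d = m * q" using \<rho>(2) bm d by auto
          then show ?thesis using unit[of m c] m1 cm less.prems by simp
        next
          case False
          then show ?thesis using c[rule_format, of d] d by simp
        qed
      qed
      then show "c l = 0" using \<rho>(3) l by blast
    qed
  qed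
qed

text \<open>One row comes from each block but m, so u_m is the factor that completes the weight of
  the coordinate K to the product over all blocks.\<close>

lemma transversal_idx:
  assumes q: "q > 0" and a: "\<And>j. 1 \<le> j \<Longrightarrow> j \<le> r \<Longrightarrow> \<exists>i\<in>C_set q j. a i j \<noteq> 0" and m: "m \<le> r"
  shows "\<exists>K. K \<in> plucker_idx (dim_n r q) r \<and> pvec (dim_n r q) r (cell_mat q a) K \<noteq> 0 \<and>
    (\<forall>u :: nat \<Rightarrow> complex. (\<Prod>p\<in>K. u (p div q)) * u m = (\<Prod>b\<le>r. u b))"
proof -
  obtain \<rho> where T: "(\<forall>b\<le>r. b \<noteq> m \<longrightarrow> \<rho> b < dim_n r q \<and> \<rho> b div q = b) \<and>
     (\<forall>b. m < b \<longrightarrow> b \<le> r \<longrightarrow> \<rho> b = b * q) \<and>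
     (\<forall>c. (\<forall>b\<le>r. b \<noteq> m \<longrightarrow> (\<Sum>l<r. cell_mat q a (\<rho> b) l * c l) = 0) \<longrightarrow> (\<forall>l<r. c l = 0))"
    using transversal_minor[OF q a m] by (rule exE)
  note \<rho> = conjunct1[OF T, rule_format]
    and ker = conjunct2[OF conjunct2[OF T], THEN spec, THEN mp]
  define K where "K = \<rho> ` ({..r} - {m})"
  have inj: "inj_on \<rho> ({..r} - {m})"
    by (rule inj_on_inverseI[of _ "\<lambda>p. p div q"]) (use \<rho> in auto)
  have cK: "card K = r" unfolding K_def card_image[OF inj] using m by simp
  have KI: "K \<in> plucker_idx (dim_n r q) r" unfolding plucker_idx_def using cK \<rho> by (auto simp: K_def)
  have "minor r (cell_mat q a) K \<noteq> 0"
    unfolding minor_nonzero_iff_kernel[OF cK plucker_idxD(3)[OF KI]]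
  proof (intro allI impI)
    fix c l assume "\<forall>p\<in>K. (\<Sum>l<r. cell_mat q a p l * c l) = 0" and l: "l < r"
    then have "\<forall>b\<le>r. b \<noteq> m \<longrightarrow> (\<Sum>l<r. cell_mat q a (\<rho> b) l * c l) = 0" by (auto simp: K_def)
    then show "c l = 0" using ker l by blast
  qed
  then have "pvec (dim_n r q) r (cell_mat q a) K \<noteq> 0" using KI by (simp add: pvec_def)
  moreover have "(\<Prod>p\<in>K. u (p div q)) * u m = (\<Prod>b\<le>r. u b)" for u :: "nat \<Rightarrow> complex"
  proof -
    have "(\<Prod>p\<in>K. u (p div q)) = (\<Prod>b\<in>{..r} - {m}. u b)"
      unfolding K_def prod.reindex[OF inj] by (rule prod.cong) (use \<rho> in auto)
    then show ?thesis using prod.remove[of "{..r}" m u] m by (simp add: mult.commute)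
  qed
  ultimately show ?thesis using KI by (intro exI[of _ K]) simp
qed

lemma cell_pt_semistable:
  assumes q: "q > 0" and a: "\<And>j. 1 \<le> j \<Longrightarrow> j \<le> r \<Longrightarrow> \<exists>i\<in>C_set q j. a i j \<noteq> 0"
  shows "cell_pt r q a \<in> V_ss r q"
proof -
  let ?n = "dim_n r q" and ?I = "plucker_idx (dim_n r q) r"
  let ?v = "pvec ?n r (cell_mat q a)"
  define K where "K = (\<lambda>m. SOME K. K \<in> ?I \<and> ?v K \<noteq> 0 \<and>
      (\<forall>u :: nat \<Rightarrow> complex. (\<Prod>p\<in>K. u (p div q)) * u m = (\<Prod>b\<le>r. u b)))"
  have Kall: "K m \<in> ?I \<and> ?v (K m) \<noteq> 0 \<and>
      (\<forall>u :: nat \<Rightarrow> complex. (\<Prod>p\<in>K m. u (p div q)) * u m = (\<Prod>b\<le>r. u b))" if "m \<le> r" for m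
    unfolding K_def by (rule someI_ex, rule transversal_idx[OF q a that])
  then have KI: "\<And>m. m \<le> r \<Longrightarrow> K m \<in> ?I" and Kv: "\<And>m. m \<le> r \<Longrightarrow> ?v (K m) \<noteq> 0"
    and Ku: "\<And>m (u :: nat \<Rightarrow> complex). m \<le> r \<Longrightarrow> (\<Prod>p\<in>K m. u (p div q)) * u m = (\<Prod>b\<le>r. u b)"
    by blast+
  have n: "?n = r * q + 1" by (simp add: dim_n_def)
  note rn = r_le_n[OF q, of r]
  \<comment> \<open>The degree is r + (n - r) = n, so the first power of the line bundle
    suffices.\<close>
  define f where "f = (\<lambda>v :: nat set \<Rightarrow> complex. (\<Prod>m\<in>{..<r}. v (K m)) * v (K r) ^ (?n - r))"
  have "hpoly ?I (card {..<r} + (?n - r)) f"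
    unfolding f_def by (intro hpoly.mult hpoly_prod_power hpoly_power KI) auto
  then have hf: "hpoly ?I ?n f" using rn by simp
  have "f \<in> twist_sections ?I (X_w r q) (1 * ?n)"
    unfolding twist_sections_def
  proof (intro CollectI ballI)
    fix p
    show "\<exists>e F H. hpoly ?I (1 * ?n + e) F \<and> hpoly ?I e H \<and> (\<forall>v\<in>p. H v \<noteq> 0) \<and>
        (\<forall>v\<in>\<Union>(X_w r q). H v \<noteq> 0 \<longrightarrow> f v = F v / H v)"
      by (rule exI[of _ 0], rule exI[of _ f], rule exI[of _ "\<lambda>_. 1"]) (simp add: hf hpoly.const)
  qed
  moreover have "f (\<gamma> v) = f v" if \<gamma>: "\<gamma> \<in> T_J_act r q" for \<gamma> v
  proof -
    obtain u where u: "\<forall>b. u b \<noteq> 0" "(\<Prod>b<r. u b) ^ q * u r = 1"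
      and \<gamma>e: "\<gamma> = ext_act ?n r (block_diag ?n q u)"
      using \<gamma> unfolding T_J_act_iff[OF q] by blast
    define w where "w = (\<lambda>m. \<Prod>p\<in>K m. u (p div q))"
    define U where "U = (\<Prod>b<r. u b)"
    have \<gamma>K: "\<gamma> v (K m) = w m * v (K m)" if "m \<le> r" for m
      using KI[OF that] by (simp add: \<gamma>e ext_act_block_diag w_def)
    have wu: "w m * u m = U * u r" if "m \<le> r" for m
      using Ku[OF that, of u] by (simp add: w_def U_def lessThan_Suc_atMost[symmetric])
    have U0: "U \<noteq> 0" unfolding U_def using u(1) by simp
    \<comment> \<open>Multiplying by the weights of the omitted blocks completes every factor to the
      product of all u_b.\<close>
    have "(\<Prod>m<r. w m) * w r ^ (?n - r) * (U * u r ^ (?n - r)) =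
        (\<Prod>m<r. w m * u m) * (w r * u r) ^ (?n - r)"
      by (simp add: U_def prod.distrib power_mult_distrib)
    also have "\<dots> = (U * u r) ^ r * (U * u r) ^ (?n - r)" by (simp add: wu)
    also have "\<dots> = (U * u r) ^ ?n" using rn by (simp flip: power_add)
    also have "\<dots> = U * u r ^ (?n - r) * (U ^ (r * q) * u r ^ r)"
    proof -
      have "(U * u r) ^ ?n = U ^ ?n * u r ^ ?n" by (rule power_mult_distrib)
      also have "U ^ ?n = U * U ^ (r * q)" by (simp add: n)
      also have "u r ^ ?n = u r ^ (?n - r) * u r ^ r" using rn by (simp flip: power_add)
      finally show ?thesis by (simp add: ac_simps)
    qed
    also have "U ^ (r * q) * u r ^ r = (U ^ q * u r) ^ r"
      by (simp add: power_mult_distrib mult.commute[of r] power_mult)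
    also have "\<dots> = 1" using u(2) by (simp add: U_def)
    finally have W: "(\<Prod>m<r. w m) * w r ^ (?n - r) = 1" using U0 u(1) by simp
    have "f (\<gamma> v) = (\<Prod>m<r. w m * v (K m)) * (w r * v (K r)) ^ (?n - r)"
      unfolding f_def by (simp add: \<gamma>K)
    also have "\<dots> = ((\<Prod>m<r. w m) * w r ^ (?n - r)) * f v"
      unfolding f_def by (simp add: prod.distrib power_mult_distrib)
    finally show ?thesis unfolding W by simp
  qed
  moreover have "\<forall>v\<in>cell_pt r q a. f v \<noteq> 0"
  proof -
    have "f ?v \<noteq> 0" using Kv by (simp add: f_def)
    then show ?thesis unfolding cell_pt_eq[OF q] hpoly_nonzero_on_line[OF hf] .
  qed
  ultimately show ?thesis
    unfolding V_ss_def semistable_def using cell_pt_in_X_w[OF q]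
    by (intro CollectI conjI exI[of _ "1::nat"] bexI[of _ f]) simp_all
qed

text \<open>Families vanish off the free positions, so that a point of the cell has only one family
  of parameters.\<close>

definition params :: "nat \<Rightarrow> nat \<Rightarrow> (nat \<Rightarrow> nat \<Rightarrow> complex) set" where
  "params r q = {a. (\<forall>i j. a i j \<noteq> 0 \<longrightarrow> 1 \<le> j \<and> j \<le> r \<and> i \<in> C_set q j) \<and>
     (\<forall>j. 1 \<le> j \<longrightarrow> j \<le> r \<longrightarrow> (\<exists>i\<in>C_set q j. a i j \<noteq> 0))}"

lemma cell_pt_cong:
  assumes q: "q > 0" and "\<And>i j. 1 \<le> j \<Longrightarrow> j \<le> r \<Longrightarrow> i \<in> C_set q j \<Longrightarrow> a i j = b i j"
  shows "cell_pt r q a = cell_pt r q b"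
  unfolding cell_pt_eq[OF q]
  by (rule arg_cong[of _ _ line], rule pvec_cong) (use assms(2) in \<open>auto simp: cell_mat_def\<close>)

lemma V_ss_eq:
  assumes q: "q > 0"
  shows "V_ss r q = cell_pt r q ` params r q"
proof (rule equalityI; rule subsetI)
  fix x assume x: "x \<in> V_ss r q"
  have xX: "x \<in> X_w r q" using x by (auto simp: V_ss_def semistable_def)
  then have "x \<in> proj_points (plucker_idx (dim_n r q) r)" using X_w_subset by blast
  then obtain v where v: "x = line v" by (rule proj_point_ex)
  then have vx: "v \<in> x" using in_line_self by simp
  obtain a where a: "x = cell_pt r q a"
    using X_w_top_nonzero[OF q xX vx semistable_top_nonzero[OF q x vx]] by blast
  define b where "b = (\<lambda>i j. if 1 \<le> j \<and> j \<le> r \<and> i \<in> C_set q j then a i j else 0)"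
  have "x = cell_pt r q b" unfolding a by (rule cell_pt_cong[OF q]) (simp add: b_def)
  moreover have "b \<in> params r q"
  proof -
    have "\<exists>i\<in>C_set q j. b i j \<noteq> 0" if j: "1 \<le> j" "j \<le> r" for j
      using semistable_column_nonzero[OF q x[unfolded a] j] j by (auto simp: b_def)
    then show ?thesis unfolding params_def by (auto simp: b_def)
  qed
  ultimately show "x \<in> cell_pt r q ` params r q" by blast
next
  fix x assume "x \<in> cell_pt r q ` params r q"
  then obtain a where "a \<in> params r q" "x = cell_pt r q a" by blast
  then show "x \<in> V_ss r q" using cell_pt_semistable[OF q, of r a] unfolding params_def by blast
qed

section \<open>Coordinates on the semistable locus\<close>

abbreviation V_space :: "nat \<Rightarrow> nat \<Rightarrow> (nat set \<Rightarrow> complex) set fspace" where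
  "V_space r q \<equiv> quasiprojective (plucker_idx (dim_n r q) r) (V_ss r q)"

lemma V_ss_proj: "V_ss r q \<subseteq> proj_points (plucker_idx (dim_n r q) r)"
  using X_w_subset(2)[of r q] unfolding V_ss_def semistable_def by blast

lemma V_space_facts: "pts (V_space r q) = V_ss r q" "space_with_functions (V_space r q)"
  "openin (Top (V_space r q)) (V_ss r q)"
proof -
  show "pts (V_space r q) = V_ss r q" by (rule pts_quasiprojective[OF V_ss_proj])
  then show "openin (Top (V_space r q)) (V_ss r q)" by (metis openin_topspace)
  show "space_with_functions (V_space r q)" by (rule swf_quasiprojective[OF V_ss_proj])
qed

lemma paramsD:
  assumes "a \<in> params r q"
  shows "a i j \<noteq> 0 \<Longrightarrow> 1 \<le> j" "a i j \<noteq> 0 \<Longrightarrow> j \<le> r" "a i j \<noteq> 0 \<Longrightarrow> i \<in> C_set q j"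
  using assms unfolding params_def by blast+

definition restrict_params :: "nat \<Rightarrow> nat \<Rightarrow> (nat \<Rightarrow> nat \<Rightarrow> complex) \<Rightarrow> nat \<Rightarrow> nat \<Rightarrow> complex" where
  "restrict_params r q a = (\<lambda>i j. if 1 \<le> j \<and> j \<le> r \<and> i \<in> C_set q j then a i j else 0)"

lemma cell_pt_restrict: "q > 0 \<Longrightarrow> cell_pt r q (restrict_params r q a) = cell_pt r q a"
  by (rule cell_pt_cong) (simp_all add: restrict_params_def)

lemma cell_coordinate:
  assumes q: "q > 0" and j: "1 \<le> j" "j \<le> r" and i: "i \<in> C_set q j" and v: "v \<in> cell_pt r q a"
  shows "v (exchange (top_idx r q) (j - 1) (i - 1)) =
      exchange_sign r (top_idx r q) (j - 1) (i - 1) * a i j * v (top_idx r q)"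
    and "v (top_idx r q) \<noteq> 0"
proof -
  let ?p = "pvec (dim_n r q) r (cell_mat q a)"
  obtain c where c: "c \<noteq> 0" "v = (\<lambda>K. c * ?p K)" using v unfolding cell_pt_eq[OF q] line_iff by blast
  have jr: "j - 1 < r" using j by simp
  note pos = C_set_position[OF q j i]
  note ex = exchange_coordinate(1)[OF q cell_mat_normalized[OF q] pos(1,2) jr]
  show "v (top_idx r q) \<noteq> 0" using c pvec_top[OF q, of r a] by simp
  show "v (exchange (top_idx r q) (j - 1) (i - 1)) =
      exchange_sign r (top_idx r q) (j - 1) (i - 1) * a i j * v (top_idx r q)"
    unfolding c(2) ex pvec_top[OF q] pos(3) by simp
qed

lemma sign_nonzero:
  assumes q: "q > 0" and j: "1 \<le> j" "j \<le> r" and i: "i \<in> C_set q j"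
  shows "exchange_sign r (top_idx r q) (j - 1) (i - 1) \<noteq> 0"
    and "exchange (top_idx r q) (j - 1) (i - 1) \<in> plucker_idx (dim_n r q) r"
proof -
  have jr: "j - 1 < r" using j by simp
  note pos = C_set_position[OF q j i]
  note ex = exchange_coordinate[OF q cell_mat_normalized[OF q] pos(1,2) jr]
  show "exchange_sign r (top_idx r q) (j - 1) (i - 1) \<noteq> 0" by (rule ex(3))
  show "exchange (top_idx r q) (j - 1) (i - 1) \<in> plucker_idx (dim_n r q) r" by (rule ex(2))
qed

lemma cell_pt_inj:
  assumes q: "q > 0" and a: "a \<in> params r q" and b: "b \<in> params r q" and eq: "cell_pt r q a = cell_pt r q b"
  shows "a = b"
proof (intro ext)
  fix i j
  show "a i j = b i j"
  proof (cases "1 \<le> j \<and> j \<le> r \<and> i \<in> C_set q j")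
    case True
    obtain v where v: "v \<in> cell_pt r q a" unfolding cell_pt_eq[OF q] using in_line_self by blast
    have j: "1 \<le> j" "j \<le> r" and i: "i \<in> C_set q j" using True by auto
    show ?thesis
      using cell_coordinate[OF q j i v] cell_coordinate(1)[OF q j i v[unfolded eq]] sign_nonzero(1)[OF q j i]
      by simp
  next
    case False
    then have "a i j = 0" "b i j = 0" using paramsD[OF a] paramsD[OF b] by blast+
    then show ?thesis by simp
  qed
qed

definition coord :: "nat \<Rightarrow> nat \<Rightarrow> (nat set \<Rightarrow> complex) set \<Rightarrow> nat \<Rightarrow> nat \<Rightarrow> complex" where
  "coord r q x = (THE a. a \<in> params r q \<and> cell_pt r q a = x)"

lemma coord_cell: "q > 0 \<Longrightarrow> a \<in> params r q \<Longrightarrow> coord r q (cell_pt r q a) = a"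
  unfolding coord_def by (rule the_equality) (auto dest: cell_pt_inj)

lemma coord_params:
  assumes q: "q > 0" and x: "x \<in> V_ss r q"
  shows "coord r q x \<in> params r q" "cell_pt r q (coord r q x) = x"
proof -
  obtain a where a: "a \<in> params r q" "x = cell_pt r q a" using x unfolding V_ss_eq[OF q] by blast
  then show "coord r q x \<in> params r q" "cell_pt r q (coord r q x) = x" using coord_cell[OF q a(1)] by simp_all
qed

text \<open>By \<open>cell_coordinate\<close> a parameter is, up to a nonzero constant, a quotient
  of two Plucker coordinates, and the denominator vanishes nowhere on V.\<close>

lemma coord_Reg:
  assumes q: "q > 0"
  shows "(\<lambda>x. coord r q x i j) \<in> Reg (V_space r q) (V_ss r q)"
proof (cases "1 \<le> j \<and> j \<le> r \<and> i \<in> C_set q j")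
  case True
  then have j: "1 \<le> j" "j \<le> r" and i: "i \<in> C_set q j" by auto
  let ?I = "plucker_idx (dim_n r q) r"
  let ?K = "exchange (top_idx r q) (j - 1) (i - 1)" and ?s = "exchange_sign r (top_idx r q) (j - 1) (i - 1)"
  have h: "hpoly ?I 1 (\<lambda>v. v (top_idx r q))" by (rule hpoly.coord[OF top_idx_facts(1)[OF q]])
  have h': "hpoly ?I 1 (\<lambda>v. (1 / ?s) * v ?K)"
    using hpoly.mult[OF hpoly.const[of ?I "1 / ?s"] hpoly.coord[OF sign_nonzero(2)[OF q j i]]] by simp
  have co: "v (top_idx r q) \<noteq> 0 \<and> coord r q p i j = (1 / ?s) * v ?K / v (top_idx r q)"
    if p: "p \<in> V_ss r q" and v: "v \<in> p" for p v
  proof -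
    have "v \<in> cell_pt r q (coord r q p)" using coord_params(2)[OF q p] v by simp
    from cell_coordinate[OF q j i this] show ?thesis using sign_nonzero(1)[OF q j i] by simp
  qed
  have "qfrac ?I (\<lambda>x. coord r q x i j) (V_ss r q) p 1 (\<lambda>v. (1 / ?s) * v ?K) (\<lambda>v. v (top_idx r q))"
    if "p \<in> V_ss r q" for p
    unfolding qfrac_def using h h' co that by blast
  then show ?thesis unfolding Reg_quasiprojective_iff[OF V_ss_proj] by blast
next
  case False
  have "0 = coord r q x i j" if "x \<in> V_ss r q" for x
    using paramsD[OF coord_params(1)[OF q that], of i j] False by metis
  then show ?thesis
    by (rule swf_cong[OF V_space_facts(2,3) swf_const[OF V_space_facts(2,3), of 0]])
qed

lemma fs_morphism_cell_pt:
  assumes q: "q > 0" and S: "space_with_functions S"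
    and \<alpha>: "\<And>i j. (\<lambda>x. \<alpha> x i j) \<in> Reg S (pts S)" and im: "\<And>x. x \<in> pts S \<Longrightarrow> \<alpha> x \<in> params r q"
  shows "fs_morphism S (V_space r q) (\<lambda>x. cell_pt r q (\<alpha> x))"
  unfolding cell_pt_eq[OF q]
proof (rule fs_morphism_to_quasiprojective[OF S V_ss_proj])
  have opn: "openin (Top S) (pts S)" by simp
  fix K assume K: "K \<in> plucker_idx (dim_n r q) r"
  have "(\<lambda>x. cell_mat q (\<alpha> x) p l) \<in> Reg S (pts S)" for p l
    unfolding cell_mat_def using \<alpha> swf_const[OF S opn]
    by (cases "p = (l + 1) * q"; cases "p + 1 \<in> C_set q (l + 1)") (simp_all del: mult_Suc)
  then show "(\<lambda>x. pvec (dim_n r q) r (cell_mat q (\<alpha> x)) K) \<in> Reg S (pts S)"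
    unfolding pvec_def minor_def using K by (simp add: swf_det[OF S opn])
next
  fix x assume "x \<in> pts S"
  then show "line (pvec (dim_n r q) r (cell_mat q (\<alpha> x))) \<in> V_ss r q"
    using im unfolding V_ss_eq[OF q] cell_pt_eq[OF q, symmetric] by blast
qed

section \<open>The torus action in coordinates\<close>

text \<open>Any nonzero family u may act, whatever its determinant: a common scalar factor of u
  cancels in the ratio.\<close>

definition act :: "nat \<Rightarrow> (nat \<Rightarrow> complex) \<Rightarrow> (nat \<Rightarrow> nat \<Rightarrow> complex) \<Rightarrow> nat \<Rightarrow> nat \<Rightarrow> complex" where
  "act q u a = (\<lambda>i j. u ((i - 1) div q) / u j * a i j)"

definition nonzero :: "(nat \<Rightarrow> complex) \<Rightarrow> bool" where
  "nonzero u \<longleftrightarrow> (\<forall>b. u b \<noteq> 0)"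

lemma act_params: "nonzero u \<Longrightarrow> a \<in> params r q \<Longrightarrow> act q u a \<in> params r q"
  unfolding params_def act_def nonzero_def by simp

lemma act_act: "act q u (act q v a) = act q (\<lambda>b. u b * v b) a"
  by (simp add: act_def fun_eq_iff)

lemma act_one: "act q (\<lambda>b. 1) a = a"
  by (simp add: act_def)

definition torus_maps :: "nat \<Rightarrow> nat \<Rightarrow> ((nat set \<Rightarrow> complex) set \<Rightarrow> (nat set \<Rightarrow> complex) set) set" where
  "torus_maps r q = {(`) \<gamma> | \<gamma>. \<gamma> \<in> T_J_act r q}"

lemma torus_maps_act:
  assumes q: "q > 0" and "g \<in> torus_maps r q"
  obtains u where "nonzero u" "\<And>a. g (cell_pt r q a) = cell_pt r q (act q u a)"
proof -
  obtain \<gamma> where \<gamma>: "\<gamma> \<in> T_J_act r q" "g = (`) \<gamma>" using assms(2) unfolding torus_maps_def by blast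
  then obtain u where u: "\<forall>b. u b \<noteq> 0" "\<gamma> = ext_act (dim_n r q) r (block_diag (dim_n r q) q u)"
    using T_J_act_iff[OF q] by blast
  show ?thesis using that[of u] u(1) ext_act_cell[OF q u(1)] unfolding \<gamma>(2) u(2) nonzero_def act_def by blast
qed

text \<open>An n-th root scales u to determinant 1 without changing the action. The orbits of
  \<open>act\<close> are therefore those of the torus.\<close>

lemma act_torus_maps:
  assumes q: "q > 0" and u: "nonzero u"
  obtains g where "g \<in> torus_maps r q" "\<And>a. g (cell_pt r q a) = cell_pt r q (act q u a)"
proof -
  let ?n = "dim_n r q"
  let ?d = "(\<Prod>b<r. u b) ^ q * u r"
  have "?d \<noteq> 0" using u by (simp add: nonzero_def)
  then obtain c where c: "c ^ ?n = inverse ?d" "c \<noteq> 0"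
    using complex_root[of "inverse ?d" ?n] by (auto simp: dim_n_def)
  define w where "w = (\<lambda>b. c * u b)"
  have w0: "\<forall>b. w b \<noteq> 0" using u c(2) by (simp add: w_def nonzero_def)
  have "(\<Prod>b<r. w b) ^ q * w r = c ^ (r * q) * c * ?d"
    by (simp add: w_def prod.distrib power_mult_distrib power_mult)
  also have "c ^ (r * q) * c = inverse ?d" using c(1) by (simp add: dim_n_def mult.commute)
  finally have w1: "(\<Prod>b<r. w b) ^ q * w r = 1" by (simp only: left_inverse[OF \<open>?d \<noteq> 0\<close>])
  let ?\<gamma> = "ext_act ?n r (block_diag ?n q w)"
  have "?\<gamma> \<in> T_J_act r q" unfolding T_J_act_iff[OF q] using w0 w1 by blast
  then have "(`) ?\<gamma> \<in> torus_maps r q" unfolding torus_maps_def by blast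
  moreover have "?\<gamma> ` cell_pt r q a = cell_pt r q (act q u a)" for a
  proof -
    have "(\<lambda>i j. w ((i - 1) div q) / w j * a i j) = act q u a"
      using c(2) by (simp add: w_def act_def)
    then show ?thesis using ext_act_cell[OF q w0, of r a] by simp
  qed
  ultimately show ?thesis using that by blast
qed

text \<open>The guard, which ensures termination, holds whenever \<open>s j \<in> C_set q j\<close>.\<close>

fun norm_factor :: "nat \<Rightarrow> (nat \<Rightarrow> nat) \<Rightarrow> (nat \<Rightarrow> nat \<Rightarrow> complex) \<Rightarrow> nat \<Rightarrow> complex" where
  "norm_factor q s a 0 = 1"
| "norm_factor q s a (Suc j) = (if (s (Suc j) - 1) div q < Suc j
     then norm_factor q s a ((s (Suc j) - 1) div q) * a (s (Suc j)) (Suc j) else 1)"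

definition selections :: "nat \<Rightarrow> nat \<Rightarrow> (nat \<Rightarrow> nat) set" where
  "selections r q = {s. \<forall>j\<in>{1..r}. s j \<in> C_set q j}"

definition sel_dom :: "nat \<Rightarrow> nat \<Rightarrow> (nat \<Rightarrow> nat) \<Rightarrow> (nat \<Rightarrow> nat \<Rightarrow> complex) set" where
  "sel_dom r q s = {a \<in> params r q. \<forall>j\<in>{1..r}. a (s j) j \<noteq> 0}"

lemma C_set_block:
  assumes "q > 0" "1 \<le> j" "i \<in> C_set q j" shows "(i - 1) div q < j"
proof -
  have "i - 1 < j * q" using C_setD(1,2)[OF assms(3,2)] by linarith
  then show ?thesis using assms(1) by (simp add: div_less_iff_less_mult)
qed

lemma norm_factor_step:
  assumes q: "q > 0" and s: "s \<in> selections r q" and j: "1 \<le> j" "j \<le> r"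
  shows "norm_factor q s a j = norm_factor q s a ((s j - 1) div q) * a (s j) j" "(s j - 1) div q < j"
proof -
  have "s j \<in> C_set q j" using s j unfolding selections_def by simp
  then show b: "(s j - 1) div q < j" by (rule C_set_block[OF q j(1)])
  obtain k where "j = Suc k" using j by (cases j) auto
  then show "norm_factor q s a j = norm_factor q s a ((s j - 1) div q) * a (s j) j" using b by simp
qed

lemma norm_factor_nonzero:
  assumes q: "q > 0" and s: "s \<in> selections r q" and a: "a \<in> sel_dom r q s"
  shows "j \<le> r \<Longrightarrow> norm_factor q s a j \<noteq> 0"
proof (induction j rule: less_induct)
  case (less j)
  show ?case
  proof (cases "j = 0")
    case False
    then have j: "1 \<le> j" by simp
    note st = norm_factor_step[OF q s j less.prems]
    have "a (s j) j \<noteq> 0" using a j less.prems unfolding sel_dom_def by simp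
    moreover have "norm_factor q s a ((s j - 1) div q) \<noteq> 0" using less st(2) by simp
    ultimately show ?thesis using st(1)[of a] by simp
  qed simp
qed

text \<open>The weights telescope along the recursion: with b the block of row s(j), the earlier
  factor contributes u_0 / u_b and the entry u_b / u_j.\<close>

lemma norm_factor_act:
  assumes q: "q > 0" and s: "s \<in> selections r q" and u: "nonzero u"
  shows "j \<le> r \<Longrightarrow> norm_factor q s (act q u a) j = u 0 / u j * norm_factor q s a j"
proof (induction j rule: less_induct)
  case (less j)
  show ?case
  proof (cases "j = 0")
    case False
    then have j: "1 \<le> j" by simp
    note st = norm_factor_step[OF q s j less.prems]
    have "norm_factor q s (act q u a) ((s j - 1) div q) =
        u 0 / u ((s j - 1) div q) * norm_factor q s a ((s j - 1) div q)"
      using less st(2) by simp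
    then show ?thesis using st(1)[of a] st(1)[of "act q u a"] u by (simp add: act_def nonzero_def)
  qed (use u in \<open>simp add: nonzero_def\<close>)
qed

text \<open>The recursion descends, so only columns up to k enter. A point and its truncation
  therefore have the same factors.\<close>

lemma norm_factor_cong:
  assumes "\<And>i j. j \<le> k \<Longrightarrow> a i j = b i j"
  shows "norm_factor q s a k = norm_factor q s b k"
  using assms
proof (induction k rule: less_induct)
  case (less k)
  show ?case
  proof (cases k)
    case (Suc j)
    show ?thesis
    proof (cases "(s (Suc j) - 1) div q < Suc j")
      case True
      have "norm_factor q s a ((s (Suc j) - 1) div q) = norm_factor q s b ((s (Suc j) - 1) div q)"
        using less.prems True by (intro less.IH) (auto simp: Suc)
      then show ?thesis using less.prems by (simp add: Suc)
    qed (auto simp: Suc)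
  qed simp
qed

lemma norm_factor_Reg:
  assumes S: "space_with_functions S" and U: "openin (Top S) U"
    and \<alpha>: "\<And>i j. (\<lambda>x. \<alpha> x i j) \<in> Reg S U"
  shows "(\<lambda>x. norm_factor q s (\<alpha> x) j) \<in> Reg S U"
proof (induction j rule: less_induct)
  case (less j)
  show ?case
  proof (cases j)
    case (Suc k)
    then show ?thesis
      using swf_const[OF S U] swf_mult[OF S U less \<alpha>, of "(s (Suc k) - 1) div q" "s (Suc k)" "Suc k"]
      by (cases "(s (Suc k) - 1) div q < Suc k") auto
  qed (simp add: swf_const[OF S U])
qed

text \<open>Beyond r the value 1 keeps the vector nonzero at every index, as \<open>nonzero\<close>
  demands.\<close>

definition norm_vec :: "nat \<Rightarrow> nat \<Rightarrow> (nat \<Rightarrow> nat) \<Rightarrow> (nat \<Rightarrow> nat \<Rightarrow> complex) \<Rightarrow> nat \<Rightarrow> complex" where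
  "norm_vec r q s a = (\<lambda>b. if b \<le> r then norm_factor q s a b else 1)"

definition normal_form :: "nat \<Rightarrow> nat \<Rightarrow> (nat \<Rightarrow> nat) \<Rightarrow> (nat \<Rightarrow> nat \<Rightarrow> complex) \<Rightarrow> nat \<Rightarrow> nat \<Rightarrow> complex" where
  "normal_form r q s a = act q (norm_vec r q s a) a"

lemma norm_vec_nonzero:
  "q > 0 \<Longrightarrow> s \<in> selections r q \<Longrightarrow> a \<in> sel_dom r q s \<Longrightarrow> nonzero (norm_vec r q s a)"
  unfolding nonzero_def norm_vec_def using norm_factor_nonzero by simp

lemma act_dom: "nonzero u \<Longrightarrow> a \<in> sel_dom r q s \<Longrightarrow> act q u a \<in> sel_dom r q s"
  unfolding sel_dom_def using act_params[of u a r q] by (simp add: act_def nonzero_def)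

lemma normal_form_dom:
  "q > 0 \<Longrightarrow> s \<in> selections r q \<Longrightarrow> a \<in> sel_dom r q s \<Longrightarrow> normal_form r q s a \<in> sel_dom r q s"
  unfolding normal_form_def by (rule act_dom[OF norm_vec_nonzero])

text \<open>The acting torus element is t itself: t_j is multiplied by t_0 / t_j, and t_0 =
  1.\<close>

lemma norm_factor_normal_form:
  assumes q: "q > 0" and s: "s \<in> selections r q" and a: "a \<in> sel_dom r q s" and j: "j \<le> r"
  shows "norm_factor q s (normal_form r q s a) j = 1"
  unfolding normal_form_def norm_factor_act[OF q s norm_vec_nonzero[OF q s a] j]
  using norm_factor_nonzero[OF q s a j] j by (simp add: norm_vec_def)

text \<open>With b the block of row i, an entry of the normal form is t_b / t_j times a_ij, of
  weight (u_0 / u_b) (u_j / u_0) (u_b / u_j) = 1.\<close>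

lemma normal_form_act:
  assumes q: "q > 0" and s: "s \<in> selections r q" and u: "nonzero u" and a: "a \<in> params r q"
  shows "normal_form r q s (act q u a) = normal_form r q s a"
proof (intro ext)
  fix i j
  show "normal_form r q s (act q u a) i j = normal_form r q s a i j"
  proof (cases "a i j = 0")
    case False
    then have j: "1 \<le> j" "j \<le> r" and i: "i \<in> C_set q j" using paramsD[OF a] by blast+
    have b: "(i - 1) div q \<le> r" using C_set_block[OF q j(1) i] j(2) by simp
    have nf: "normal_form r q s c i j = norm_factor q s c ((i - 1) div q) / norm_factor q s c j * c i j" for c
      using j b by (simp add: normal_form_def act_def norm_vec_def)
    show ?thesis
      unfolding nf norm_factor_act[OF q s u j(2)] norm_factor_act[OF q s u b]
      using u by (simp add: act_def nonzero_def)
  qed (simp add: normal_form_def act_def)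
qed

text \<open>Both points are torus translates of their common normal form.\<close>

lemma same_normal_form:
  assumes q: "q > 0" and s: "s \<in> selections r q" and a: "a \<in> sel_dom r q s" and b: "b \<in> sel_dom r q s"
    and eq: "normal_form r q s a = normal_form r q s b"
  shows "\<exists>u. nonzero u \<and> b = act q u a"
proof -
  let ?u = "norm_vec r q s a" and ?v = "norm_vec r q s b"
  have nz: "nonzero ?u" "nonzero ?v" using norm_vec_nonzero[OF q s] a b by auto
  have "act q (\<lambda>c. inverse (?v c) * ?u c) a = act q (\<lambda>c. inverse (?v c)) (act q ?v b)"
    using eq unfolding normal_form_def by (simp flip: act_act)
  also have "\<dots> = b" unfolding act_act using nz(2) by (simp add: nonzero_def act_one)
  finally have "b = act q (\<lambda>c. inverse (?v c) * ?u c) a" by simp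
  moreover have "nonzero (\<lambda>c. inverse (?v c) * ?u c)" using nz by (simp add: nonzero_def)
  ultimately show ?thesis by (intro exI[of _ "\<lambda>c. inverse (?v c) * ?u c"] conjI)
qed

lemma dom_cover: "a \<in> params r q \<Longrightarrow> \<exists>s\<in>selections r q. a \<in> sel_dom r q s"
proof -
  assume a: "a \<in> params r q"
  then have "\<forall>j. \<exists>i. 1 \<le> j \<and> j \<le> r \<longrightarrow> i \<in> C_set q j \<and> a i j \<noteq> 0" unfolding params_def by blast
  from choice[OF this] obtain s where "\<forall>j. 1 \<le> j \<and> j \<le> r \<longrightarrow> s j \<in> C_set q j \<and> a (s j) j \<noteq> 0" by blast
  then show ?thesis using a unfolding selections_def sel_dom_def by (intro bexI[of _ s]) auto
qed

section \<open>Torus-stable charts of the semistable locus\<close>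

definition V_chart :: "nat \<Rightarrow> nat \<Rightarrow> (nat \<Rightarrow> nat) \<Rightarrow> (nat set \<Rightarrow> complex) set set" where
  "V_chart r q s = {x \<in> V_ss r q. coord r q x \<in> sel_dom r q s}"

lemma V_chart_open:
  assumes q: "q > 0" shows "openin (Top (V_space r q)) (V_chart r q s)"
proof -
  have "V_chart r q s = {x\<in>V_ss r q. \<forall>j\<in>{1..r}. coord r q x (s j) j \<noteq> 0}"
    unfolding V_chart_def sel_dom_def using coord_params(1)[OF q] by auto
  then show ?thesis
    using swf_nonzero_all_open[OF V_space_facts(2,3), of "{1..r}" "\<lambda>j x. coord r q x (s j) j"] coord_Reg[OF q]
    by simp
qed

lemma coord_Reg_sub:
  assumes "q > 0" "openin (Top (V_space r q)) D" "D \<subseteq> V_ss r q"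
  shows "(\<lambda>x. coord r q x i j) \<in> Reg (V_space r q) D"
  by (rule swf_mono[OF V_space_facts(2,3) coord_Reg[OF assms(1)] assms(2,3)])

lemma normal_form_Reg:
  assumes q: "q > 0" and s: "s \<in> selections r q"
  shows "(\<lambda>x. normal_form r q s (coord r q x) i j) \<in> Reg (V_space r q) (V_chart r q s)"
proof -
  note V = V_space_facts(2)[of r q] and O = V_chart_open[OF q, of r s]
  have sub: "V_chart r q s \<subseteq> V_ss r q" by (auto simp: V_chart_def)
  note co = coord_Reg_sub[OF q O sub]
  have nv: "(\<lambda>x. norm_vec r q s (coord r q x) b) \<in> Reg (V_space r q) (V_chart r q s)" for b
    unfolding norm_vec_def using norm_factor_Reg[OF V O co, where s = s and q = q] swf_const[OF V O]
    by (cases "b \<le> r") auto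
  have nz: "norm_vec r q s (coord r q x) b \<noteq> 0" if "x \<in> V_chart r q s" for x b
    using norm_vec_nonzero[OF q s, of "coord r q x"] that by (auto simp: V_chart_def nonzero_def)
  show ?thesis unfolding normal_form_def act_def
    by (intro swf_mult[OF V O] swf_divide[OF V O] nv nz co)
qed

section \<open>The quotient of the semistable locus\<close>

locale git =
  fixes r q :: nat and Y :: "'y fspace" and \<pi> :: "(nat set \<Rightarrow> complex) set \<Rightarrow> 'y"
  assumes q: "q > 0" and GIT: "GIT_quotient r q Y \<pi>"

sublocale git \<subseteq> quotient "torus_maps r q" "V_space r q" Y \<pi>
proof
  show "space_with_functions (V_space r q)" by (rule V_space_facts)
  show "good_quotient (torus_maps r q) (V_space r q) Y \<pi>"
    using GIT unfolding GIT_quotient_def torus_maps_def .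
  fix g x assume g: "g \<in> torus_maps r q" and "x \<in> pts (V_space r q)"
  then have "x \<in> V_ss r q" by (simp add: V_space_facts)
  then obtain a where a: "a \<in> params r q" "x = cell_pt r q a"
    unfolding V_ss_eq[OF q] by blast
  obtain u where "nonzero u" "\<And>a. g (cell_pt r q a) = cell_pt r q (act q u a)"
    using torus_maps_act[OF q g] by blast
  then have "g x \<in> cell_pt r q ` params r q" using act_params[of u a r q] a by blast
  then show "g x \<in> pts (V_space r q)" unfolding V_space_facts(1) unfolding V_ss_eq[OF q] .
qed

context git
begin

lemma cell_in_V: "a \<in> params r q \<Longrightarrow> cell_pt r q a \<in> V_ss r q"
  unfolding V_ss_eq[OF q] by blast

lemma \<pi>_act: assumes "a \<in> params r q" "nonzero u" shows "\<pi> (cell_pt r q (act q u a)) = \<pi> (cell_pt r q a)"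
proof -
  obtain g where "g \<in> torus_maps r q" "\<And>a. g (cell_pt r q a) = cell_pt r q (act q u a)"
    using act_torus_maps[OF q assms(2)] by blast
  then show ?thesis using inv[of g "cell_pt r q a"] cell_in_V[OF assms(1)] by (simp add: V_space_facts)
qed

definition orbit :: "(nat \<Rightarrow> nat \<Rightarrow> complex) \<Rightarrow> (nat set \<Rightarrow> complex) set set" where
  "orbit a = {cell_pt r q (act q u a) | u. nonzero u}"

text \<open>A point off the orbit has a torus-stable chart around it. If the orbit misses this
  chart, the chart is the neighbourhood; otherwise the orbit lies in the chart, and by
  \<open>same_normal_form\<close> some entry of the normal form of the point differs from its
  constant value on the orbit.\<close>

lemma orbit_closed:
  assumes a: "a \<in> params r q" shows "closedin (Top (V_space r q)) (orbit a)"
proof -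
  have sub: "orbit a \<subseteq> V_ss r q" unfolding orbit_def using act_params[OF _ a] cell_in_V by blast
  have "openin (Top (V_space r q)) (V_ss r q - orbit a)"
  proof (subst openin_subopen, rule ballI)
    fix x assume x: "x \<in> V_ss r q - orbit a"
    define b where "b = coord r q x"
    have b: "b \<in> params r q" "x = cell_pt r q b" using coord_params[OF q, of x r] x by (auto simp: b_def)
    obtain s where s: "s \<in> selections r q" "b \<in> sel_dom r q s" using dom_cover[OF b(1)] by blast
    have xs: "x \<in> V_chart r q s" using x s(2) by (simp add: V_chart_def b_def)
    note O = V_chart_open[OF q, of r s]
    show "\<exists>T. openin (Top (V_space r q)) T \<and> x \<in> T \<and> T \<subseteq> V_ss r q - orbit a"
    proof (cases "a \<in> sel_dom r q s")
      case False
      have "V_chart r q s \<inter> orbit a = {}"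
      proof (rule ccontr)
        assume "V_chart r q s \<inter> orbit a \<noteq> {}"
        then obtain u where u: "nonzero u" "cell_pt r q (act q u a) \<in> V_chart r q s" by (auto simp: orbit_def)
        then have "act q u a \<in> sel_dom r q s" using coord_cell[OF q act_params[OF u(1) a]] by (simp add: V_chart_def)
        then have "act q (\<lambda>b. inverse (u b)) (act q u a) \<in> sel_dom r q s"
          by (rule act_dom[rotated]) (use u(1) in \<open>simp add: nonzero_def\<close>)
        moreover have "act q (\<lambda>b. inverse (u b)) (act q u a) = a"
          unfolding act_act using u(1) by (simp add: act_one nonzero_def)
        ultimately show False using False by simp
      qed
      then show ?thesis using O xs by (intro exI[of _ "V_chart r q s"]) (auto simp: V_chart_def)
    next
      case True
      have "normal_form r q s a \<noteq> normal_form r q s b"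
      proof
        assume "normal_form r q s a = normal_form r q s b"
        then obtain u where "nonzero u" "b = act q u a" using same_normal_form[OF q s(1) True s(2)] by blast
        then show False using x b(2) by (auto simp: orbit_def)
      qed
      then obtain i j where ij: "normal_form r q s b i j \<noteq> normal_form r q s a i j" by (metis ext)
      let ?T = "{x \<in> V_chart r q s. normal_form r q s (coord r q x) i j \<noteq> normal_form r q s a i j}"
      have "openin (Top (V_space r q)) ?T"
        by (rule swf_neq_open[OF V_space_facts(2) O normal_form_Reg[OF q s(1)]])
      moreover have "x \<in> ?T" using xs ij by (simp add: b_def)
      moreover have "?T \<inter> orbit a = {}"
      proof (rule ccontr)
        assume "?T \<inter> orbit a \<noteq> {}"
        then obtain u where u: "nonzero u" "cell_pt r q (act q u a) \<in> ?T" by (auto simp: orbit_def)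
        then show False
          using coord_cell[OF q act_params[OF u(1) a]] normal_form_act[OF q s(1) u(1) a] by simp
      qed
      moreover have "?T \<subseteq> V_ss r q" by (auto simp: V_chart_def)
      ultimately show ?thesis by (intro exI[of _ ?T] conjI) blast+
    qed
  qed
  then show ?thesis using sub unfolding closedin_def V_space_facts(1) by simp
qed

text \<open>Orbits are closed and stable, so disjoint ones have disjoint images under a good
  quotient. Two orbits with the same image thus meet, and then they coincide.\<close>

lemma \<pi>_eq_iff:
  assumes a: "a \<in> params r q" and b: "b \<in> params r q"
  shows "\<pi> (cell_pt r q a) = \<pi> (cell_pt r q b) \<longleftrightarrow> (\<exists>u. nonzero u \<and> b = act q u a)"
proof
  assume "\<exists>u. nonzero u \<and> b = act q u a"
  then show "\<pi> (cell_pt r q a) = \<pi> (cell_pt r q b)" using \<pi>_act[OF a] by auto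
next
  assume eq: "\<pi> (cell_pt r q a) = \<pi> (cell_pt r q b)"
  have self: "cell_pt r q c \<in> orbit c" for c
    unfolding orbit_def by (intro CollectI exI[of _ "\<lambda>_. 1"]) (simp add: act_one nonzero_def)
  have inv: "g ` orbit c \<subseteq> orbit c" if "g \<in> torus_maps r q" for g c
  proof
    fix x assume "x \<in> g ` orbit c"
    then obtain u where u: "nonzero u" "x = g (cell_pt r q (act q u c))" by (auto simp: orbit_def)
    obtain v where v: "nonzero v" "\<And>a. g (cell_pt r q a) = cell_pt r q (act q v a)"
      using torus_maps_act[OF q \<open>g \<in> torus_maps r q\<close>] by blast
    have "nonzero (\<lambda>b. v b * u b)" using u v by (simp add: nonzero_def)
    moreover have "x = cell_pt r q (act q (\<lambda>b. v b * u b) c)" using u v by (simp add: act_act)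
    ultimately show "x \<in> orbit c" unfolding orbit_def by blast
  qed
  have "orbit a \<inter> orbit b \<noteq> {}"
  proof
    assume "orbit a \<inter> orbit b = {}"
    then have "\<pi> ` orbit a \<inter> \<pi> ` orbit b = {}"
      using separate[OF orbit_closed[OF a] orbit_closed[OF b] inv inv] by blast
    then show False using eq self[of a] self[of b] by blast
  qed
  then obtain u v where uv: "nonzero u" "nonzero v" "cell_pt r q (act q u a) = cell_pt r q (act q v b)"
    by (auto simp: orbit_def)
  then have "act q u a = act q v b" using cell_pt_inj[OF q act_params[OF uv(1) a] act_params[OF uv(2) b]] by simp
  then have "act q (\<lambda>c. inverse (v c)) (act q u a) = act q (\<lambda>c. inverse (v c)) (act q v b)" by simp
  then have "act q (\<lambda>c. inverse (v c) * u c) a = b"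
    using uv(2) by (simp add: act_act nonzero_def act_one)
  moreover have "nonzero (\<lambda>c. inverse (v c) * u c)" using uv by (simp add: nonzero_def)
  ultimately show "\<exists>u. nonzero u \<and> b = act q u a"
    by (intro exI[of _ "\<lambda>c. inverse (v c) * u c"]) simp
qed

text \<open>An arbitrary choice in the orbit, with no regularity in y. It enters functions on Y only
  through expressions that are constant on orbits.\<close>

definition rep :: "'y \<Rightarrow> nat \<Rightarrow> nat \<Rightarrow> complex" where
  "rep y = (SOME a. a \<in> params r q \<and> \<pi> (cell_pt r q a) = y)"

lemma rep: assumes "y \<in> pts Y" shows "rep y \<in> params r q" "\<pi> (cell_pt r q (rep y)) = y"
proof -
  have "y \<in> \<pi> ` V_ss r q" using assms unfolding surj[symmetric] V_space_facts(1) .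
  then obtain a where "a \<in> params r q" "\<pi> (cell_pt r q a) = y" unfolding V_ss_eq[OF q] by blast
  then have "rep y \<in> params r q \<and> \<pi> (cell_pt r q (rep y)) = y"
    using someI[of "\<lambda>a. a \<in> params r q \<and> \<pi> (cell_pt r q a) = y" a] unfolding rep_def by simp
  then show "rep y \<in> params r q" "\<pi> (cell_pt r q (rep y)) = y" by auto
qed

lemma \<pi>_pts: "a \<in> params r q \<Longrightarrow> \<pi> (cell_pt r q a) \<in> pts Y"
  using surj cell_in_V unfolding V_space_facts(1) by blast

lemma rep_orbit: "a \<in> params r q \<Longrightarrow> \<exists>u. nonzero u \<and> rep (\<pi> (cell_pt r q a)) = act q u a"
  using \<pi>_eq_iff[of a "rep (\<pi> (cell_pt r q a))"] rep[OF \<pi>_pts] by simp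

text \<open>An invariant expression takes the same value at the chosen representative, so it becomes
  a function of y whose pullback is the given one.\<close>

lemma Reg_descend:
  assumes D: "openin (Top Y) D"
    and h: "(\<lambda>x. h (coord r q x)) \<in> Reg (V_space r q) {x \<in> V_ss r q. \<pi> x \<in> D}"
    and inv: "\<And>a u. a \<in> params r q \<Longrightarrow> nonzero u \<Longrightarrow> h (act q u a) = h a"
  shows "(\<lambda>y. h (rep y)) \<in> Reg Y D"
  unfolding Reg_iff[OF D] V_space_facts(1)
proof (rule swf_cong[OF X _ h])
  show "openin (Top (V_space r q)) {x \<in> V_ss r q. \<pi> x \<in> D}"
    using D unfolding openin_iff V_space_facts(1) by simp
  fix x assume "x \<in> {x \<in> V_ss r q. \<pi> x \<in> D}"
  then have x: "coord r q x \<in> params r q" "cell_pt r q (coord r q x) = x" using coord_params[OF q] by auto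
  then obtain u where "nonzero u" "rep (\<pi> x) = act q u (coord r q x)" using rep_orbit[OF x(1)] by auto
  then show "h (coord r q x) = h (rep (\<pi> x))" using inv[OF x(1)] by simp
qed

section \<open>Charts of the quotient\<close>

definition chart :: "(nat \<Rightarrow> nat) \<Rightarrow> 'y set" where
  "chart s = {\<pi> (cell_pt r q a) | a. a \<in> sel_dom r q s}"

lemma chart_iff: assumes a: "a \<in> params r q" shows "\<pi> (cell_pt r q a) \<in> chart s \<longleftrightarrow> a \<in> sel_dom r q s"
proof
  assume "\<pi> (cell_pt r q a) \<in> chart s"
  then obtain b where b: "b \<in> sel_dom r q s" "\<pi> (cell_pt r q b) = \<pi> (cell_pt r q a)" by (auto simp: chart_def)
  then have "b \<in> params r q" by (simp add: sel_dom_def)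
  then obtain u where "nonzero u" "a = act q u b" using \<pi>_eq_iff[OF _ a] b(2) by blast
  then show "a \<in> sel_dom r q s" using act_dom b(1) by blast
qed (auto simp: chart_def)

lemma chart_preimage: "{x \<in> V_ss r q. \<pi> x \<in> chart s} = V_chart r q s"
  unfolding V_chart_def using chart_iff[OF coord_params(1)[OF q]] coord_params(2)[OF q] by auto

lemma chart_subset: "chart s \<subseteq> pts Y"
  unfolding chart_def using \<pi>_pts by (auto simp: sel_dom_def)

lemma chart_open: "openin (Top Y) (chart s)"
  unfolding openin_iff V_space_facts(1) chart_preimage using V_chart_open[OF q] chart_subset by blast

lemma rep_dom: assumes "y \<in> chart s" shows "rep y \<in> sel_dom r q s"
  using assms chart_iff[OF rep(1), of y s] rep(2)[of y] chart_subset by auto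

end

section \<open>The parameters of the last column\<close>

text \<open>Rows are 1-based and listed block by block, so that the list of their blocks gives the
  order of the summands of the bundle. Each block j \<ge> 1 starts with the pivot row jq + 1, which
  is left out.\<close>

definition last_rows :: "nat \<Rightarrow> nat \<Rightarrow> nat list" where
  "last_rows r q = [1..<q + 1] @ concat (map (\<lambda>j. [j * q + 2..<j * q + q + 1]) [1..<Suc r])"

definition last_blocks :: "nat \<Rightarrow> nat \<Rightarrow> nat list" where
  "last_blocks r q = replicate q 0 @ concat (map (\<lambda>j. replicate (q - 1) j) [1..<Suc r])"

lemma map_const_replicate: "(\<And>x. x \<in> set xs \<Longrightarrow> f x = c) \<Longrightarrow> map f xs = replicate (length xs) c"
  by (induction xs) auto

lemma block_div: "j * q + 1 \<le> i \<Longrightarrow> i \<le> j * q + q \<Longrightarrow> (i - 1) div q = (j :: nat)"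
  by (rule div_nat_eqI) (auto simp: mult.commute)

lemma map_last_rows: "map (\<lambda>i. (i - 1) div q) (last_rows r q) = last_blocks r q"
proof -
  have "map (\<lambda>i. (i - 1) div q) [1..<q + 1] = replicate (length [1..<q + 1]) 0"
    by (rule map_const_replicate, rule block_div) (simp_all del: upt_Suc)
  then have "map (\<lambda>i. (i - 1) div q) [1..<q + 1] = replicate q 0" by (simp del: upt_Suc)
  moreover have "map (\<lambda>i. (i - 1) div q) [j * q + 2..<j * q + q + 1] = replicate (q - 1) j" for j
  proof -
    have "map (\<lambda>i. (i - 1) div q) [j * q + 2..<j * q + q + 1] =
        replicate (length [j * q + 2..<j * q + q + 1]) j"
      by (rule map_const_replicate, rule block_div) (simp_all del: upt_Suc)
    then show ?thesis by (simp del: upt_Suc)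
  qed
  ultimately show ?thesis unfolding last_rows_def last_blocks_def by (simp add: map_concat comp_def)
qed

lemma length_last_rows: "length (last_rows r q) = q + r * (q - 1)"
proof -
  have "sum_list (map (\<lambda>j. q - 1) [1..<Suc r]) = r * (q - 1)"
    by (simp add: sum_list_triv del: upt_Suc)
  then show ?thesis unfolding last_rows_def by (simp add: length_concat comp_def del: upt_Suc)
qed

lemma last_blocks_nth:
  assumes "e < q + r * (q - 1)"
  shows "last_blocks r q ! e = (last_rows r q ! e - 1) div q"
  using nth_map[of e "last_rows r q" "\<lambda>i. (i - 1) div q"] assms
  unfolding map_last_rows length_last_rows by simp

lemma length_last_blocks: "length (last_blocks r q) = q + r * (q - 1)"
proof -
  have "length (last_blocks r q) = length (last_rows r q)"
    unfolding map_last_rows[symmetric] by (rule length_map)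
  then show ?thesis by (simp add: length_last_rows)
qed

lemma set_last_blocks: "b \<in> set (last_blocks r q) \<Longrightarrow> b \<le> r"
  by (auto simp: last_blocks_def split: if_splits)

lemma set_last_rows:
  assumes q: "q > 0" shows "set (last_rows r q) = C_set q (Suc r)"
proof (rule equalityI; rule subsetI)
  fix i assume "i \<in> set (last_rows r q)"
  then have "i \<in> {1..<q + 1} \<or> (\<exists>j\<in>{1..<Suc r}. i \<in> {j * q + 2..<j * q + q + 1})"
    unfolding last_rows_def by (simp del: upt_Suc)
  then consider "1 \<le> i" "i \<le> q" | j where "1 \<le> j" "j \<le> r" "j * q + 2 \<le> i" "i \<le> j * q + q"
    by fastforce
  then show "i \<in> C_set q (Suc r)"
  proof cases
    case 1
    show ?thesis
    proof (rule C_setI)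
      show "i \<le> Suc r * q" using 1 by simp
      fix l :: nat assume "1 \<le> l"
      then have "q \<le> l * q" using mult_le_mono1[of 1 l q] by simp
      then show "i \<noteq> l * q + 1" using 1 by linarith
    qed (rule 1)
  next
    case 2
    show ?thesis
    proof (rule C_setI)
      have "j * q \<le> r * q" using 2(2) by (rule mult_le_mono1)
      then have "i \<le> r * q + q" using 2(4) by linarith
      then show "i \<le> Suc r * q" by simp
      fix l :: nat assume l: "1 \<le> l"
      show "i \<noteq> l * q + 1"
      proof
        assume i: "i = l * q + 1"
        have "(i - 1) div q = j" by (rule block_div) (use 2 in auto)
        then have "l = j" using i q by simp
        then show False using i 2 by simp
      qed
    qed (use 2 in simp)
  qed
next
  fix i assume i: "i \<in> C_set q (Suc r)"
  have i1: "1 \<le> i" by (rule C_setD(1)[OF i]) simp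
  have iq: "i \<le> Suc r * q" by (rule C_setD(2)[OF i]) simp
  define j t where "j = (i - 1) div q" and "t = (i - 1) mod q"
  have ij: "i = j * q + t + 1" using i1 by (simp add: j_def t_def)
  have tq: "t < q" using q by (simp add: t_def)
  have jr: "j \<le> r" using C_set_block[OF q _ i] by (simp add: j_def)
  show "i \<in> set (last_rows r q)"
  proof (cases "j = 0")
    case True
    then show ?thesis using ij tq by (simp add: last_rows_def del: upt_Suc)
  next
    case False
    then have "i \<noteq> j * q + 1" using C_setD(3)[OF i, of j] jr by simp
    then have "i \<in> {j * q + 2..<j * q + q + 1}" using ij tq by simp
    then have "i \<in> {1..<q + 1} \<or> (\<exists>j\<in>{1..<Suc r}. i \<in> {j * q + 2..<j * q + q + 1})"
      using False jr by (intro disjI2 bexI[of _ j]) simp_all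
    then show ?thesis unfolding last_rows_def by (simp del: upt_Suc)
  qed
qed

lemma distinct_last_rows: "distinct (last_rows r q)"
proof -
  let ?f = "\<lambda>j. [j * q + 2..<j * q + q + 1]"
  have blk: "(i - 1) div q = j" if "i \<in> set (?f j)" for i j
    by (rule block_div) (use that in \<open>simp_all del: upt_Suc\<close>)
  have "distinct (concat (map ?f [1..<Suc r]))"
  proof (rule distinct_concat_map)
    fix x y :: nat assume "x \<noteq> y"
    then show "set (?f x) \<inter> set (?f y) = {}" using blk[of _ x] blk[of _ y] by blast
  qed simp_all
  moreover have "set [1..<q + 1] \<inter> set (concat (map ?f [1..<Suc r])) = {}"
  proof -
    have "i \<notin> set (?f j)" if i: "i \<in> set [1..<q + 1]" and j: "j \<in> set [1..<Suc r]" for i j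
    proof
      assume "i \<in> set (?f j)"
      then have "j = 0" using blk[of i j] block_div[of 0 q i] i by (simp del: upt_Suc)
      then show False using j by (simp del: upt_Suc)
    qed
    then show ?thesis unfolding set_concat set_map by blast
  qed
  ultimately show ?thesis unfolding last_rows_def by (simp del: upt_Suc)
qed

section \<open>Bundles with diagonal transition functions\<close>

lemma diag_block_scalars:
  "diag_block_mat (map (\<lambda>x. mat 1 1 (\<lambda>_. f x)) xs) =
     mat (length xs) (length xs) (\<lambda>(i, j). if i = j then f (xs ! i) else (0 :: complex))"
proof (induction xs)
  case (Cons x xs)
  show ?case
    unfolding list.map diag_block_mat.simps Let_def Cons.IH
    by (rule eq_matI) (auto simp: nth_Cons split: nat.splits)
qed auto

lemma mat_act_diagonal:
  "mat_act (mat m m (\<lambda>(i, j). if i = j then d i else 0)) v = (\<lambda>e. if e < m then d e * v e else 0)"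
proof
  fix e
  have "(\<Sum>b<m. (if e = b then d e else 0) * v b) = (\<Sum>b<m. if b = e then d e * v e else 0)"
    by (rule sum.cong) auto
  then show "mat_act (mat m m (\<lambda>(i, j). if i = j then d i else 0)) v e = (if e < m then d e * v e else 0)"
    by (simp add: mat_act_def sum.delta)
qed

lemma mat_act_line: "mat_act A ` line v = line (mat_act A v)"
proof -
  have "mat_act A (\<lambda>i. c * v i) = (\<lambda>i. c * mat_act A v i)" for c
    by (auto simp: mat_act_def sum_distrib_left algebra_simps)
  then show ?thesis unfolding line_def by (auto simp: image_def)
qed

lemma scalar_invertible: "x \<noteq> 0 \<Longrightarrow> invertible_mat (mat 1 1 (\<lambda>_. x :: complex))"
  unfolding invertible_mat_def inverts_mat_def
  by (intro conjI exI[of _ "mat 1 1 (\<lambda>_. inverse x)"]) (auto simp: scalar_prod_def)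

lemma pts_glue: "pts (fs_glue I X \<kappa>) = (\<Union>k\<in>I. \<kappa> k ` pts (X k))"
proof
  show "pts (fs_glue I X \<kappa>) \<subseteq> (\<Union>k\<in>I. \<kappa> k ` pts (X k))"
    using openin_topspace[of "Top (fs_glue I X \<kappa>)"]
    unfolding fs_glue_def fspace.simps openin_glue_topology by (rule conjunct1)
  have "{x \<in> pts (X k). \<kappa> k x \<in> (\<Union>k\<in>I. \<kappa> k ` pts (X k))} = pts (X k)" if "k \<in> I" for k
    using that by auto
  then have "openin (Top (fs_glue I X \<kappa>)) (\<Union>k\<in>I. \<kappa> k ` pts (X k))"
    by (simp add: fs_glue_def openin_glue_topology)
  then show "(\<Union>k\<in>I. \<kappa> k ` pts (X k)) \<subseteq> pts (fs_glue I X \<kappa>)" by (rule openin_subset)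
qed

lemma openin_glue:
  "openin (Top (fs_glue I X \<kappa>)) D \<longleftrightarrow> D \<subseteq> pts (fs_glue I X \<kappa>) \<and>
     (\<forall>k\<in>I. openin (Top (X k)) {x \<in> pts (X k). \<kappa> k x \<in> D})"
  unfolding pts_glue by (simp add: fs_glue_def openin_glue_topology)

lemma Reg_glue:
  "h \<in> Reg (fs_glue I X \<kappa>) D \<longleftrightarrow> (\<forall>k\<in>I. (\<lambda>x. h (\<kappa> k x)) \<in> Reg (X k) {x \<in> pts (X k). \<kappa> k x \<in> D})"
  by (simp add: fs_glue_def comp_def)

text \<open>Bundles are indexed by natural numbers. Only the values s 1, ..., s r matter, so
  finitely many selections cover the parameters and can be numbered.\<close>

lemma finite_selections:
  obtains I :: "nat set" and sel where "\<And>k. k \<in> I \<Longrightarrow> sel k \<in> selections r q"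
    "\<And>a. a \<in> params r q \<Longrightarrow> \<exists>k\<in>I. a \<in> sel_dom r q (sel k)"
proof -
  let ?S = "PiE {1..r} (C_set q)"
  have "finite ?S" by (rule finite_PiE) auto
  then obtain h where h: "bij_betw h {0..<card ?S} ?S" using ex_bij_betw_nat_finite by blast
  show ?thesis
  proof (rule that[of "{0..<card ?S}" h])
    fix k assume "k \<in> {0..<card ?S}"
    then have "h k \<in> ?S" using bij_betwE[OF h] by blast
    then show "h k \<in> selections r q" unfolding selections_def by (auto dest: PiE_mem)
  next
    fix a assume "a \<in> params r q"
    then obtain s where s: "s \<in> selections r q" "a \<in> sel_dom r q s" using dom_cover by blast
    have "restrict s {1..r} \<in> ?S" using s(1) unfolding selections_def by auto
    then have "restrict s {1..r} \<in> h ` {0..<card ?S}" using h unfolding bij_betw_def by simp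
    then obtain k where "k \<in> {0..<card ?S}" "h k = restrict s {1..r}" by auto
    moreover have "a \<in> sel_dom r q (restrict s {1..r})" using s(2) unfolding sel_dom_def by simp
    ultimately show "\<exists>k\<in>{0..<card ?S}. a \<in> sel_dom r q (h k)" by (intro bexI[of _ k]) simp_all
  qed
qed

section \<open>The projective bundle\<close>

text \<open>Here r is one less than in the theorem: the top level is \<open>Suc r\<close> and the
  base is r.\<close>

locale tower = top: git "Suc r" q Y \<pi> + base: git r q Y' \<pi>'
  for r q :: nat and Y :: "'y fspace" and \<pi> and Y' :: "'z fspace" and \<pi>' +
  fixes I :: "nat set" and sel :: "nat \<Rightarrow> nat \<Rightarrow> nat"
  assumes sel: "k \<in> I \<Longrightarrow> sel k \<in> selections r q"
    and cover: "a \<in> params r q \<Longrightarrow> \<exists>k\<in>I. a \<in> sel_dom r q (sel k)"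
begin

lemmas q = base.q

abbreviation "m \<equiv> q + r * (q - 1)"
abbreviation "rw e \<equiv> last_rows r q ! e"
abbreviation "blk e \<equiv> last_blocks r q ! e"
abbreviation "tr \<equiv> restrict_params r q"
abbreviation "U k \<equiv> base.chart (sel k)"

definition base_pt :: "(nat \<Rightarrow> nat \<Rightarrow> complex) \<Rightarrow> 'z" where
  "base_pt a = \<pi>' (cell_pt r q (tr a))"

text \<open>The value 0 beyond m follows the convention that homogeneous coordinates vanish off
  their index set.\<close>

definition fibre :: "nat \<Rightarrow> (nat \<Rightarrow> nat \<Rightarrow> complex) \<Rightarrow> nat \<Rightarrow> complex" where
  "fibre k a = (\<lambda>e. if e < m then norm_factor q (sel k) a (blk e) * a (rw e) (Suc r) else 0)"

text \<open>A point of the projective bundle is written down with all its local representatives at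
  once, so that no chart has to be chosen and invariance can be read off.\<close>

definition cls :: "(nat \<Rightarrow> nat \<Rightarrow> complex) \<Rightarrow> (nat \<times> 'z \<times> (nat \<Rightarrow> complex) set) set" where
  "cls a = {(i, base_pt a, line (fibre i a)) | i. i \<in> I \<and> tr a \<in> sel_dom r q (sel i)}"

definition ratio :: "nat \<Rightarrow> nat \<Rightarrow> 'z \<Rightarrow> nat \<Rightarrow> complex" where
  "ratio i k y j = norm_factor q (sel i) (base.rep y) j / norm_factor q (sel k) (base.rep y) j"

text \<open>The index j is a block number. Since t_0 = 1 in every chart, \<open>L 0\<close> is
  trivial.\<close>

definition L :: "nat \<Rightarrow> 'z transition" where
  "L j i k y = mat 1 1 (\<lambda>_. ratio i k y j)"

definition E :: "'z transition" where
  "E = direct_sum (map L (last_blocks r q))"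

definition PE :: "(nat \<times> 'z \<times> (nat \<Rightarrow> complex) set) set fspace" where
  "PE = proj_bundle Y' I U m E"

definition piece :: "nat \<Rightarrow> ('z \<times> (nat \<Rightarrow> complex) set) fspace" where
  "piece k = fs_prod (open_subspace Y' (U k)) (proj_space m)"

abbreviation "\<kappa> \<equiv> pb_chart I U E"

lemma PE_glue: "PE = fs_glue I piece \<kappa>"
  unfolding PE_def proj_bundle_def piece_def ..

lemma tr_params: assumes a: "a \<in> params (Suc r) q" shows "tr a \<in> params r q"
proof -
  have "\<exists>i\<in>C_set q j. tr a i j \<noteq> 0" if j: "1 \<le> j" "j \<le> r" for j
  proof -
    obtain i where "i \<in> C_set q j" "a i j \<noteq> 0" using a j unfolding params_def by auto
    then show ?thesis using j by (intro bexI[of _ i]) (auto simp: restrict_params_def)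
  qed
  then show ?thesis unfolding params_def by (auto simp: restrict_params_def)
qed

lemma tr_eq: assumes a: "a \<in> params (Suc r) q" and j: "j \<le> r" shows "tr a i j = a i j"
  using paramsD[OF a, of i j] j by (auto simp: restrict_params_def)

lemma tr_act: "tr (act q u a) = act q u (tr a)"
  by (simp add: restrict_params_def act_def fun_eq_iff)

lemma norm_factor_tr:
  "a \<in> params (Suc r) q \<Longrightarrow> j \<le> r \<Longrightarrow> norm_factor q s (tr a) j = norm_factor q s a j"
  by (rule norm_factor_cong) (simp add: tr_eq)

lemma blk: assumes "e < m" shows "blk e \<le> r" "blk e = (rw e - 1) div q" "rw e \<in> C_set q (Suc r)"
proof -
  show "blk e \<le> r" using assms length_last_blocks[of r q] set_last_blocks[of "blk e" r q] by simp
  show "blk e = (rw e - 1) div q" by (rule last_blocks_nth[OF assms])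
  show "rw e \<in> C_set q (Suc r)"
    using assms length_last_rows[of r q] unfolding set_last_rows[OF q, symmetric] by simp
qed

lemma base_pt_chart: "a \<in> params (Suc r) q \<Longrightarrow> base_pt a \<in> U k \<longleftrightarrow> tr a \<in> sel_dom r q (sel k)"
  unfolding base_pt_def by (rule base.chart_iff[OF tr_params])

text \<open>The factor t_b has weight u_0 / u_b and the entry in a row of block b has weight u_b /
  u_(r+1). The block cancels, so all components share one weight and the line is invariant.\<close>

lemma fibre_act:
  assumes k: "k \<in> I" and u: "nonzero u"
  shows "fibre k (act q u a) = (\<lambda>e. u 0 / u (Suc r) * fibre k a e)"
proof
  fix e
  show "fibre k (act q u a) e = u 0 / u (Suc r) * fibre k a e"
  proof (cases "e < m")
    case True
    note b = blk[OF True]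
    have "act q u a (rw e) (Suc r) = u (blk e) / u (Suc r) * a (rw e) (Suc r)"
      by (simp add: act_def b(2))
    then show ?thesis
      using True u norm_factor_act[OF q sel[OF k] u b(1), of a] by (simp add: fibre_def nonzero_def)
  qed (simp add: fibre_def)
qed

lemma cls_act:
  assumes a: "a \<in> params (Suc r) q" and u: "nonzero u"
  shows "cls (act q u a) = cls a"
proof -
  have bp: "base_pt (act q u a) = base_pt a"
    unfolding base_pt_def tr_act by (rule base.\<pi>_act[OF tr_params[OF a] u])
  have "tr (act q u a) \<in> sel_dom r q (sel i) \<longleftrightarrow> tr a \<in> sel_dom r q (sel i)" for i
    using base_pt_chart[OF a] base_pt_chart[OF act_params[OF u a]] bp by simp
  moreover have "line (fibre i (act q u a)) = line (fibre i a)" if "i \<in> I" for i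
    unfolding fibre_act[OF that u] by (rule line_scale) (use u in \<open>simp add: nonzero_def\<close>)
  ultimately show ?thesis unfolding cls_def bp by auto
qed

lemma fibre_nonzero:
  assumes k: "k \<in> I" and a: "a \<in> params (Suc r) q" and d: "tr a \<in> sel_dom r q (sel k)"
  shows "line (fibre k a) \<in> proj_points {..<m}"
proof -
  obtain i where i: "i \<in> C_set q (Suc r)" "a i (Suc r) \<noteq> 0" using a unfolding params_def by auto
  then obtain e where e: "e < m" "rw e = i"
    using set_last_rows[OF q, of r] length_last_rows[of r q] by (metis in_set_conv_nth)
  have "norm_factor q (sel k) a (blk e) \<noteq> 0"
    using norm_factor_nonzero[OF q sel[OF k] d blk(1)[OF e(1)]] norm_factor_tr[OF a blk(1)[OF e(1)]] by simp
  then have "fibre k a e \<noteq> 0" using e i(2) by (simp add: fibre_def)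
  then show ?thesis unfolding line_in_proj_points using e(1) by (auto simp: fibre_def)
qed

text \<open>Both factors are multiplied by the same u_0 / u_j, so the representative may be replaced
  by any point of the orbit.\<close>

lemma ratio_val:
  assumes ik: "i \<in> I" "k \<in> I" and a: "a \<in> params r q" and j: "j \<le> r"
  shows "ratio i k (\<pi>' (cell_pt r q a)) j = norm_factor q (sel i) a j / norm_factor q (sel k) a j"
proof -
  obtain u where u: "nonzero u" "base.rep (\<pi>' (cell_pt r q a)) = act q u a" using base.rep_orbit[OF a] by blast
  then have "u 0 / u j \<noteq> 0" by (simp add: nonzero_def)
  then show ?thesis
    unfolding ratio_def u(2) norm_factor_act[OF q sel[OF ik(1)] u(1) j] norm_factor_act[OF q sel[OF ik(2)] u(1) j]
    by (rule mult_divide_mult_cancel_left)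
qed

lemma ratio_nonzero:
  assumes ik: "i \<in> I" "k \<in> I" and y: "y \<in> U i \<inter> U k" and j: "j \<le> r"
  shows "ratio i k y j \<noteq> 0"
  using norm_factor_nonzero[OF q sel[OF ik(1)] base.rep_dom j, of y]
    norm_factor_nonzero[OF q sel[OF ik(2)] base.rep_dom j, of y] y
  by (simp add: ratio_def)

lemma ratio_Reg:
  assumes ik: "i \<in> I" "k \<in> I" and j: "j \<le> r"
  shows "(\<lambda>y. ratio i k y j) \<in> Reg Y' (U i \<inter> U k)"
proof -
  let ?h = "\<lambda>a. norm_factor q (sel i) a j / norm_factor q (sel k) a j"
  let ?O = "V_chart r q (sel i) \<inter> V_chart r q (sel k)"
  have D: "openin (Top Y') (U i \<inter> U k)" by (intro openin_Int base.chart_open)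
  have O: "openin (Top (V_space r q)) ?O" by (intro openin_Int V_chart_open[OF q])
  have sub: "?O \<subseteq> V_ss r q" by (auto simp: V_chart_def)
  note nr = norm_factor_Reg[OF base.X O coord_Reg_sub[OF q O sub]]
  have "(\<lambda>x. ?h (coord r q x)) \<in> Reg (V_space r q) ?O"
  proof (rule swf_divide[OF base.X O nr nr])
    fix x assume "x \<in> ?O"
    then have "coord r q x \<in> sel_dom r q (sel k)" by (simp add: V_chart_def)
    then show "norm_factor q (sel k) (coord r q x) j \<noteq> 0" by (rule norm_factor_nonzero[OF q sel[OF ik(2)] _ j])
  qed
  moreover have "{x \<in> V_ss r q. \<pi>' x \<in> U i \<inter> U k} = ?O" using base.chart_preimage by blast
  ultimately have h: "(\<lambda>x. ?h (coord r q x)) \<in> Reg (V_space r q) {x \<in> V_ss r q. \<pi>' x \<in> U i \<inter> U k}" by simp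
  have inv: "?h (act q u a) = ?h a" if "a \<in> params r q" "nonzero u" for a u
  proof -
    have "u 0 / u j \<noteq> 0" using that(2) by (simp add: nonzero_def)
    then show ?thesis
      unfolding norm_factor_act[OF q sel[OF ik(1)] that(2) j] norm_factor_act[OF q sel[OF ik(2)] that(2) j]
      by (rule mult_divide_mult_cancel_left)
  qed
  show ?thesis unfolding ratio_def by (rule base.Reg_descend[OF D h inv])
qed

lemma open_cover_U: "open_cover Y' I U"
proof -
  have "pts Y' \<subseteq> (\<Union>k\<in>I. U k)"
  proof
    fix y assume y: "y \<in> pts Y'"
    obtain k where "k \<in> I" "base.rep y \<in> sel_dom r q (sel k)" using cover[OF base.rep(1)[OF y]] by blast
    then show "y \<in> (\<Union>k\<in>I. U k)" using base.chart_iff[OF base.rep(1)[OF y]] base.rep(2)[OF y] by auto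
  qed
  then show ?thesis unfolding open_cover_def using base.chart_open base.chart_subset by blast
qed

lemma line_bundle_L:
  assumes j: "j \<le> r" shows "line_bundle Y' I U (L j)"
  unfolding vector_bundle_def
proof (intro conjI ballI allI impI open_cover_U)
  fix i k assume ik: "i \<in> I" "k \<in> I"
  { fix y assume y: "y \<in> U i \<inter> U k"
    show "L j i k y \<in> carrier_mat 1 1" by (simp add: L_def)
    show "invertible_mat (L j i k y)" unfolding L_def by (rule scalar_invertible[OF ratio_nonzero[OF ik y j]]) }
  { fix a b :: nat assume "a < 1" "b < 1"
    then show "(\<lambda>y. L j i k y $$ (a, b)) \<in> Reg Y' (U i \<inter> U k)"
      using ratio_Reg[OF ik j] by (simp add: L_def) }
  fix l y assume l: "l \<in> I" and y: "y \<in> U i \<inter> U k \<inter> U l"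
  have "norm_factor q (sel k) (base.rep y) j \<noteq> 0"
    by (rule norm_factor_nonzero[OF q sel[OF ik(2)] base.rep_dom j]) (use y in simp)
  then have "ratio i k y j * ratio k l y j = ratio i l y j" by (simp add: ratio_def)
  then show "L j i k y * L j k l y = L j i l y"
    unfolding L_def by (intro eq_matI) (auto simp: scalar_prod_def)
qed

lemma mat_act_E: "mat_act (E i k y) v = (\<lambda>e. if e < m then ratio i k y (blk e) * v e else 0)"
proof -
  have "E i k y = diag_block_mat (map (\<lambda>j. mat 1 1 (\<lambda>_. ratio i k y j)) (last_blocks r q))"
    unfolding E_def direct_sum_def by (simp add: comp_def L_def)
  also have "\<dots> = mat m m (\<lambda>(e, e'). if e = e' then ratio i k y (blk e) else 0)"
    unfolding diag_block_scalars length_last_blocks ..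
  finally show ?thesis by (simp add: mat_act_diagonal)
qed

text \<open>The diagonal entries of the transition matrix are the quotients of the factors t_b of
  the two charts, so they carry the fibre vector of chart k to that of chart i.\<close>

lemma \<kappa>_cls:
  assumes k: "k \<in> I" and a: "a \<in> params (Suc r) q" and d: "tr a \<in> sel_dom r q (sel k)"
  shows "\<kappa> k (base_pt a, line (fibre k a)) = cls a"
proof -
  have "mat_act (E i k (base_pt a)) ` line (fibre k a) = line (fibre i a)" if i: "i \<in> I" for i
  proof -
    have "mat_act (E i k (base_pt a)) (fibre k a) = fibre i a"
    proof
      fix e
      show "mat_act (E i k (base_pt a)) (fibre k a) e = fibre i a e"
      proof (cases "e < m")
        case True
        note b = blk(1)[OF True]
        have nz: "norm_factor q (sel k) (tr a) (blk e) \<noteq> 0" by (rule norm_factor_nonzero[OF q sel[OF k] d b])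
        have "ratio i k (base_pt a) (blk e) =
            norm_factor q (sel i) (tr a) (blk e) / norm_factor q (sel k) (tr a) (blk e)"
          unfolding base_pt_def by (rule ratio_val[OF i k tr_params[OF a] b])
        then show ?thesis using True nz by (simp add: mat_act_E fibre_def norm_factor_tr[OF a b])
      qed (simp add: mat_act_E fibre_def)
    qed
    then show ?thesis by (simp add: mat_act_line)
  qed
  then show ?thesis unfolding pb_chart_def cls_def using base_pt_chart[OF a] by auto
qed

text \<open>Equal base points give a torus element that matches the columns up to r, and equal lines
  give a scalar that relates the last columns; both combine into one torus element.\<close>

lemma cls_inj:
  assumes a: "a \<in> params (Suc r) q" and b: "b \<in> params (Suc r) q" and eq: "cls a = cls b"
  shows "\<exists>u. nonzero u \<and> b = act q u a"
proof -
  obtain k where k: "k \<in> I" "tr a \<in> sel_dom r q (sel k)" using cover[OF tr_params[OF a]] by blast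
  then have "(k, base_pt a, line (fibre k a)) \<in> cls a" unfolding cls_def by blast
  then have "(k, base_pt a, line (fibre k a)) \<in> cls b" by (simp only: eq)
  then have bp: "base_pt a = base_pt b" and fl: "line (fibre k a) = line (fibre k b)"
    unfolding cls_def by auto
  obtain u where u: "nonzero u" "tr b = act q u (tr a)"
    using bp base.\<pi>_eq_iff[OF tr_params[OF a] tr_params[OF b]] unfolding base_pt_def by blast
  obtain c where c: "c \<noteq> 0" "fibre k b = (\<lambda>e. c * fibre k a e)"
    using in_line_self[of "fibre k b"] unfolding fl[symmetric] line_iff by blast
  \<comment> \<open>Index r + 1 of u can still be chosen: it acts on column r + 1 alone, by
    division. This value accounts for the scalar c between the two fibre vectors.\<close>
  define w where "w = u(Suc r := u 0 / c)"
  have w: "nonzero w" using u(1) c(1) by (simp add: w_def nonzero_def)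
  have "b i j = act q w a i j" for i j
  proof (cases "1 \<le> j \<and> j \<le> Suc r \<and> i \<in> C_set q j")
    case False
    then have "a i j = 0" "b i j = 0" using paramsD[OF a, of i j] paramsD[OF b, of i j] by blast+
    then show ?thesis by (simp add: act_def)
  next
    case True
    then have j: "1 \<le> j" "j \<le> Suc r" and i: "i \<in> C_set q j" by auto
    have ib: "(i - 1) div q < j" by (rule C_set_block[OF q j(1) i])
    then have wi: "w ((i - 1) div q) = u ((i - 1) div q)" using j by (simp add: w_def)
    show ?thesis
    proof (cases "j = Suc r")
      case False
      then have jr: "j \<le> r" using j by simp
      have "b i j = act q u (tr a) i j" using tr_eq[OF b jr] u(2) by metis
      also have "\<dots> = act q w a i j" using wi jr by (simp add: act_def tr_eq[OF a jr] w_def)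
      finally show ?thesis .
    next
      case jR: True
      then have "i \<in> set (last_rows r q)" using i set_last_rows[OF q] by simp
      then obtain e where e: "e < m" "rw e = i" using length_last_rows[of r q] by (metis in_set_conv_nth)
      note be = blk[OF e(1)]
      let ?N = "norm_factor q (sel k)"
      have Nb: "?N b (blk e) = u 0 / u (blk e) * ?N a (blk e)"
        using norm_factor_act[OF q sel[OF k(1)] u(1) be(1), of "tr a"]
        unfolding u(2)[symmetric] norm_factor_tr[OF a be(1)] norm_factor_tr[OF b be(1)] .
      have Na: "?N a (blk e) \<noteq> 0"
        using norm_factor_nonzero[OF q sel[OF k(1)] k(2) be(1)] norm_factor_tr[OF a be(1)] by simp
      have "?N b (blk e) * b i j = c * (?N a (blk e) * a i j)"
        using fun_cong[OF c(2), of e] e jR by (simp add: fibre_def)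
      then have "u 0 * b i j = c * u (blk e) * a i j"
        using Na Nb u(1) by (simp add: nonzero_def field_simps)
      then have "b i j = c * u (blk e) * a i j / u 0" using u(1) by (simp add: nonzero_def field_simps)
      moreover have "act q w a i j = u (blk e) / (u 0 / c) * a i j"
        using wi jR e be(2) by (simp add: act_def w_def)
      ultimately show ?thesis by simp
    qed
  qed
  then have "b = act q w a" by blast
  then show ?thesis using w by blast
qed

section \<open>Trivializations over the charts of the base\<close>

lemma piece_product: "fs_product (open_subspace Y' (U k)) (proj_space m)"
  by unfold_locales (auto intro: swf_open_subspace base.Y base.chart_open proj_space_facts)

lemma piece_facts:
  "pts (piece k) = U k \<times> proj_points {..<m}" "space_with_functions (piece k)"
  using fs_product.pts_prod[OF piece_product] fs_product.swf_fs_prod[OF piece_product]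
  by (simp_all add: piece_def pts_subspace[OF base.chart_open] proj_space_facts)

definition V_over :: "nat \<Rightarrow> (nat set \<Rightarrow> complex) set set" where
  "V_over k = {x \<in> V_ss (Suc r) q. tr (coord (Suc r) q x) \<in> sel_dom r q (sel k)}"

abbreviation "co \<equiv> coord (Suc r) q"

lemma co: "x \<in> V_ss (Suc r) q \<Longrightarrow> co x \<in> params (Suc r) q"
  by (rule coord_params(1)[OF q])

lemma fs_morphism_base: "fs_morphism (V_space (Suc r) q) Y' (\<lambda>x. base_pt (co x))"
proof -
  have "fs_morphism (V_space (Suc r) q) (V_space r q) (\<lambda>x. cell_pt r q (tr (co x)))"
  proof (rule fs_morphism_cell_pt[OF q top.X])
    fix i j
    show "(\<lambda>x. tr (co x) i j) \<in> Reg (V_space (Suc r) q) (pts (V_space (Suc r) q))"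
      unfolding V_space_facts(1)
    proof (cases "1 \<le> j \<and> j \<le> r \<and> i \<in> C_set q j")
      case True
      then show "(\<lambda>x. tr (co x) i j) \<in> Reg (V_space (Suc r) q) (V_ss (Suc r) q)"
        using coord_Reg[OF q, of "Suc r" i j] by (simp add: restrict_params_def)
    next
      case False
      show "(\<lambda>x. tr (co x) i j) \<in> Reg (V_space (Suc r) q) (V_ss (Suc r) q)"
        unfolding restrict_params_def if_not_P[OF False]
        by (rule swf_const[OF V_space_facts(2,3)])
    qed
  qed (simp add: V_space_facts tr_params co)
  from fs_morphism_comp[OF this base.mor] show ?thesis unfolding base_pt_def .
qed

lemma V_over_preimage: "V_over k = {x \<in> pts (V_space (Suc r) q). base_pt (co x) \<in> U k}"
  unfolding V_over_def V_space_facts(1) using base_pt_chart[OF co] by blast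

lemma V_over_open: "openin (Top (V_space (Suc r) q)) (V_over k)"
  unfolding V_over_preimage by (rule fs_morphismD(2)[OF fs_morphism_base base.chart_open])

lemma fs_morphism_trivialization:
  assumes k: "k \<in> I"
  shows "fs_morphism (open_subspace (V_space (Suc r) q) (V_over k)) (piece k)
    (\<lambda>x. (base_pt (co x), line (fibre k (co x))))"
proof -
  let ?S = "open_subspace (V_space (Suc r) q) (V_over k)"
  note O = V_over_open[of k]
  have S: "space_with_functions ?S" by (rule swf_open_subspace[OF top.X O])
  have pS: "pts ?S = V_over k" by (rule pts_subspace[OF O])
  have sub: "V_over k \<subseteq> V_ss (Suc r) q" by (auto simp: V_over_def)
  have f: "fs_morphism ?S (open_subspace Y' (U k)) (\<lambda>x. base_pt (co x))"
  proof (rule fs_morphism_into_subspace[OF base.chart_open])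
    show "fs_morphism ?S Y' (\<lambda>x. base_pt (co x))" by (rule fs_morphism_subspace[OF top.X O fs_morphism_base])
    show "base_pt (co x) \<in> U k" if "x \<in> pts ?S" for x
      using that unfolding pS unfolding V_over_preimage by simp
  qed
  have g: "fs_morphism ?S (proj_space m) (\<lambda>x. line (fibre k (co x)))"
    unfolding proj_space_def
  proof (rule fs_morphism_to_quasiprojective[OF S subset_refl])
    fix e assume "e \<in> {..<m}"
    note cr = coord_Reg_sub[OF q O sub]
    have "(\<lambda>x. norm_factor q (sel k) (co x) (blk e) * co x (rw e) (Suc r)) \<in> Reg (V_space (Suc r) q) (V_over k)"
      by (rule swf_mult[OF top.X O norm_factor_Reg[OF top.X O cr] cr])
    then show "(\<lambda>x. fibre k (co x) e) \<in> Reg ?S (pts ?S)"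
      unfolding pS using \<open>e \<in> {..<m}\<close> by (simp add: fibre_def)
  next
    fix x assume "x \<in> pts ?S"
    then show "line (fibre k (co x)) \<in> proj_points {..<m}"
      unfolding pS using fibre_nonzero[OF k co] by (simp add: V_over_def)
  qed
  show ?thesis unfolding piece_def by (rule fs_product.fs_morphism_Pair[OF piece_product S f g])
qed

section \<open>Local sections over affine pieces of the bundle\<close>

definition some_ratio :: "(nat \<Rightarrow> complex) set \<Rightarrow> nat \<Rightarrow> nat \<Rightarrow> complex" where
  "some_ratio l e' e = (SOME v. v \<in> l) e' / (SOME v. v \<in> l) e"

lemma some_ratio:
  assumes "l \<in> proj_points {..<m}" "v \<in> l" shows "some_ratio l e' e = v e' / v e"
proof -
  define w where "w = (SOME w. w \<in> l)"
  have "w \<in> l" unfolding w_def by (rule someI[of "\<lambda>w. w \<in> l", OF assms(2)])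
  then have "w \<in> line v" using proj_point_vec(1)[OF assms] by simp
  then obtain c where "c \<noteq> 0" "w = (\<lambda>i. c * v i)" unfolding line_iff by blast
  then show ?thesis unfolding some_ratio_def w_def[symmetric] by simp
qed

definition row_pos :: "nat \<Rightarrow> nat" where
  "row_pos i = (THE e. e < m \<and> rw e = i)"

lemma row_pos: assumes "e < m" shows "row_pos (rw e) = e"
  unfolding row_pos_def
  using distinct_last_rows[of r q] length_last_rows[of r q] assms
  by (intro the_equality) (auto simp: nth_eq_iff_index_eq)

text \<open>The first r columns are put in normal form, which makes all t_b equal to 1; the fibre
  vector is then the last column itself. There the coordinates of the line are scaled to be 1 at
  position e.\<close>

definition lift :: "nat \<Rightarrow> nat \<Rightarrow> 'z \<times> (nat \<Rightarrow> complex) set \<Rightarrow> nat \<Rightarrow> nat \<Rightarrow> complex" where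
  "lift k e p = (\<lambda>i j. if j \<le> r then normal_form r q (sel k) (base.rep (fst p)) i j
     else if j = Suc r \<and> i \<in> C_set q (Suc r) then some_ratio (snd p) (row_pos i) e else 0)"

definition affine_piece :: "nat \<Rightarrow> nat \<Rightarrow> ('z \<times> (nat \<Rightarrow> complex) set) set" where
  "affine_piece k e = U k \<times> {l \<in> proj_points {..<m}. \<forall>v\<in>l. v e \<noteq> 0}"

lemma row_pos_C: assumes "i \<in> C_set q (Suc r)" shows "row_pos i < m" "rw (row_pos i) = i"
proof -
  have "i \<in> set (last_rows r q)" using assms set_last_rows[OF q] by simp
  then obtain e where e: "e < m" "rw e = i" using length_last_rows[of r q] by (metis in_set_conv_nth)
  then show "row_pos i < m" "rw (row_pos i) = i" using row_pos[OF e(1)] by auto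
qed

lemma lift:
  assumes k: "k \<in> I" and e: "e < m" and p: "(y, l) \<in> affine_piece k e"
  shows "lift k e (y, l) \<in> params (Suc r) q" "tr (lift k e (y, l)) \<in> sel_dom r q (sel k)"
    "base_pt (lift k e (y, l)) = y" "line (fibre k (lift k e (y, l))) = l"
proof -
  let ?b = "lift k e (y, l)" and ?n = "normal_form r q (sel k) (base.rep y)"
  have y: "y \<in> U k" and l: "l \<in> proj_points {..<m}" and le: "\<forall>v\<in>l. v e \<noteq> 0"
    using p by (auto simp: affine_piece_def)
  obtain v where v: "l = line v" by (rule proj_point_ex[OF l])
  have vl: "v \<in> l" unfolding v by (rule in_line_self)
  have ve: "v e \<noteq> 0" using le vl by simp
  note d = base.rep_dom[OF y]
  have nd: "?n \<in> sel_dom r q (sel k)" by (rule normal_form_dom[OF q sel[OF k] d])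
  then have np: "?n \<in> params r q" by (simp add: sel_dom_def)
  show bp: "?b \<in> params (Suc r) q"
    unfolding params_def
  proof (intro CollectI conjI allI impI)
    fix i j assume nz: "?b i j \<noteq> 0"
    show "1 \<le> j" "j \<le> Suc r" "i \<in> C_set q j"
      using nz paramsD[OF np, of i j] by (auto simp: lift_def split: if_splits)
  next
    fix j assume j: "1 \<le> j" "j \<le> Suc r"
    show "\<exists>i\<in>C_set q j. ?b i j \<noteq> 0"
    proof (cases "j = Suc r")
      case True
      have "?b (rw e) (Suc r) = 1"
        using blk(3)[OF e] row_pos[OF e] some_ratio[OF l vl, of e e] ve by (simp add: lift_def)
      then show ?thesis using True blk(3)[OF e] by (intro bexI[of _ "rw e"]) auto
    next
      case False
      then have "j \<le> r" using j by simp
      then obtain i where "i \<in> C_set q j" "?n i j \<noteq> 0" using np j unfolding params_def by blast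
      then show ?thesis using \<open>j \<le> r\<close> by (intro bexI[of _ i]) (auto simp: lift_def)
    qed
  qed
  have trb: "tr ?b = ?n"
  proof (intro ext)
    fix i j
    show "tr ?b i j = ?n i j"
      using paramsD[OF np, of i j] by (cases "j \<le> r") (auto simp: restrict_params_def lift_def)
  qed
  show "tr ?b \<in> sel_dom r q (sel k)" unfolding trb by (rule nd)
  have yp: "y \<in> pts Y'" using y base.chart_subset by blast
  show "base_pt ?b = y"
    unfolding base_pt_def trb normal_form_def
      base.\<pi>_act[OF base.rep(1)[OF yp] norm_vec_nonzero[OF q sel[OF k] d]] by (rule base.rep(2)[OF yp])
  have "fibre k ?b = (\<lambda>e'. (1 / v e) * v e')"
  proof
    fix e'
    show "fibre k ?b e' = 1 / v e * v e'"
    proof (cases "e' < m")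
      case True
      note b = blk[OF True]
      have "norm_factor q (sel k) ?b (blk e') = 1"
        unfolding norm_factor_tr[OF bp b(1), symmetric] trb by (rule norm_factor_normal_form[OF q sel[OF k] d b(1)])
      moreover have "?b (rw e') (Suc r) = v e' / v e"
        using b(3) row_pos[OF True] some_ratio[OF l vl] by (simp add: lift_def)
      ultimately show ?thesis using True by (simp add: fibre_def)
    next
      case False
      then have "v e' = 0" using proj_point_vec(3)[OF l vl, of e'] by simp
      then show ?thesis using False by (simp add: fibre_def)
    qed
  qed
  then show "line (fibre k ?b) = l" unfolding v using line_scale[of "1 / v e" v] ve by simp
qed

lemma affine_piece_open: assumes e: "e < m" shows "openin (Top (piece k)) (affine_piece k e)"
proof -
  have "fs_product.box (open_subspace Y' (U k)) (proj_space m) (U k) {l \<in> proj_points {..<m}. \<forall>v\<in>l. v e \<noteq> 0}"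
    unfolding fs_product.box_def[OF piece_product] openin_subspace[OF base.chart_open]
    using proj_space_ratio(1)[OF e e] base.chart_open by simp
  then show ?thesis unfolding piece_def affine_piece_def by (rule fs_product.openin_Times[OF piece_product])
qed

lemma affine_piece_cover:
  assumes "p \<in> pts (piece k)" obtains e where "e < m" "p \<in> affine_piece k e"
proof -
  obtain y l where p: "p = (y, l)" "y \<in> U k" "l \<in> proj_points {..<m}"
    using assms unfolding piece_facts by auto
  obtain v where v: "l = line v" by (rule proj_point_ex[OF p(3)])
  obtain e where e: "e < m" "v e \<noteq> 0" using p(3) unfolding v line_in_proj_points by auto
  have "\<forall>w\<in>l. w e \<noteq> 0" unfolding v using e(2) by (auto simp: line_iff)
  then show ?thesis using that[OF e(1)] p by (simp add: affine_piece_def)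
qed

lemma fs_morphism_lift:
  assumes k: "k \<in> I" and e: "e < m"
  shows "fs_morphism (open_subspace (piece k) (affine_piece k e)) (V_space (Suc r) q)
    (\<lambda>p. cell_pt (Suc r) q (lift k e p))"
proof -
  let ?S = "open_subspace (piece k) (affine_piece k e)"
  note O = affine_piece_open[OF e, of k]
  have S: "space_with_functions ?S" by (rule swf_open_subspace[OF piece_facts(2) O])
  have pS: "pts ?S = affine_piece k e" by (rule pts_subspace[OF O])
  let ?W = "{l \<in> proj_points {..<m}. \<forall>v\<in>l. v e \<noteq> 0}"
  show ?thesis
  proof (rule fs_morphism_cell_pt[OF q S])
    fix i j
    consider "j \<le> r" | "j = Suc r" "i \<in> C_set q (Suc r)" | "\<not> j \<le> r" "\<not> (j = Suc r \<and> i \<in> C_set q (Suc r))"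
      by blast
    then show "(\<lambda>p. lift k e p i j) \<in> Reg ?S (pts ?S)"
    proof cases
      case 1
      have "(\<lambda>y. normal_form r q (sel k) (base.rep y) i j) \<in> Reg Y' (U k)"
      proof (rule base.Reg_descend[OF base.chart_open])
        show "(\<lambda>x. normal_form r q (sel k) (coord r q x) i j) \<in> Reg (V_space r q) {x \<in> V_ss r q. \<pi>' x \<in> U k}"
          unfolding base.chart_preimage by (rule normal_form_Reg[OF q sel[OF k]])
      qed (simp add: normal_form_act[OF q sel[OF k]])
      then have "(\<lambda>p. normal_form r q (sel k) (base.rep (fst p)) i j) \<in> Reg (piece k) (affine_piece k e)"
        unfolding piece_def
        by (intro fs_product.Reg_fst[OF piece_product])
          (auto simp: openin_subspace base.chart_open affine_piece_def proj_space_facts)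
      then show ?thesis unfolding pS using 1 by (simp add: lift_def)
    next
      case 2
      have "(\<lambda>l. some_ratio l (row_pos i) e) \<in> Reg (proj_space m) ?W"
        by (rule proj_space_ratio(2)[OF e row_pos_C(1)[OF 2(2)]]) (simp add: some_ratio)
      then have "(\<lambda>p. some_ratio (snd p) (row_pos i) e) \<in> Reg (piece k) (affine_piece k e)"
        unfolding piece_def
        by (intro fs_product.Reg_snd[OF piece_product, of _ ?W])
          (use proj_space_ratio(1)[OF e e] in
           \<open>auto simp: affine_piece_def pts_subspace[OF base.chart_open]\<close>)
      then show ?thesis unfolding pS using 2 by (simp add: lift_def)
    next
      case 3
      then have "(\<lambda>p. lift k e p i j) = (\<lambda>p. 0)" by (auto simp: lift_def)
      then show ?thesis using swf_const[OF S openin_topspace] by simp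
    qed
  next
    fix p assume "p \<in> pts ?S"
    then show "lift k e p \<in> params (Suc r) q" using lift(1)[OF k e, of "fst p" "snd p"] unfolding pS by simp
  qed
qed

lemma \<kappa>_lift:
  assumes k: "k \<in> I" and e: "e < m" and p: "p \<in> affine_piece k e"
  shows "\<kappa> k p = cls (lift k e p)" "lift k e p \<in> params (Suc r) q"
proof -
  obtain y l where yl: "p = (y, l)" by (cases p)
  note l = lift[OF k e p[unfolded yl]]
  show "lift k e p \<in> params (Suc r) q" using l(1) yl by simp
  show "\<kappa> k p = cls (lift k e p)" using \<kappa>_cls[OF k l(1,2)] unfolding l(3,4) yl .
qed

lemma cls_in_PE: assumes a: "a \<in> params (Suc r) q" shows "cls a \<in> pts PE"
proof -
  obtain k where k: "k \<in> I" "tr a \<in> sel_dom r q (sel k)" using cover[OF tr_params[OF a]] by blast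
  have "(base_pt a, line (fibre k a)) \<in> pts (piece k)"
    unfolding piece_facts using base_pt_chart[OF a] k(2) fibre_nonzero[OF k(1) a k(2)] by simp
  then show ?thesis unfolding PE_glue pts_glue using \<kappa>_cls[OF k(1) a k(2)] k(1) by blast
qed

lemma PE_cls: assumes "c \<in> pts PE" obtains a where "a \<in> params (Suc r) q" "c = cls a"
proof -
  obtain k p where k: "k \<in> I" and p: "p \<in> pts (piece k)" "c = \<kappa> k p"
    using assms unfolding PE_glue pts_glue by blast
  obtain e where e: "e < m" "p \<in> affine_piece k e" by (rule affine_piece_cover[OF p(1)])
  then show ?thesis using that \<kappa>_lift[OF k e] p(2) by metis
qed

section \<open>The isomorphism and its inverse\<close>

definition \<Psi> :: "'y \<Rightarrow> (nat \<times> 'z \<times> (nat \<Rightarrow> complex) set) set" where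
  "\<Psi> y = cls (top.rep y)"

lemma \<Psi>_\<pi>: assumes a: "a \<in> params (Suc r) q" shows "\<Psi> (\<pi> (cell_pt (Suc r) q a)) = cls a"
proof -
  obtain u where "nonzero u" "top.rep (\<pi> (cell_pt (Suc r) q a)) = act q u a" using top.rep_orbit[OF a] by blast
  then show ?thesis unfolding \<Psi>_def using cls_act[OF a] by simp
qed

lemma \<Psi>_\<pi>_co: "x \<in> V_ss (Suc r) q \<Longrightarrow> \<Psi> (\<pi> x) = cls (co x)"
  using \<Psi>_\<pi>[OF co] coord_params(2)[OF q] by metis

lemma V_over_cover: "x \<in> V_ss (Suc r) q \<Longrightarrow> \<exists>k\<in>I. x \<in> V_over k"
  using cover[OF tr_params[OF co]] unfolding V_over_def by blast

lemma \<Psi>_trivialization: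
  assumes "k \<in> I" "x \<in> V_over k"
  shows "\<Psi> (\<pi> x) = \<kappa> k (base_pt (co x), line (fibre k (co x)))"
  using assms \<kappa>_cls[OF assms(1) co] \<Psi>_\<pi>_co by (simp add: V_over_def)

text \<open>Openness and regularity on Y are tested on V. There the composition with \<pi> is, over
  each chart, the trivialization followed by the chart map of the bundle.\<close>

lemma \<Psi>_morphism: "fs_morphism Y PE \<Psi>"
proof -
  let ?V = "V_space (Suc r) q"
  let ?t = "\<lambda>k x. (base_pt (co x), line (fibre k (co x)))"
  have over: "V_over k \<subseteq> V_ss (Suc r) q" for k by (auto simp: V_over_def)
  have pre_k: "openin (Top ?V) {x \<in> V_over k. \<Psi> (\<pi> x) \<in> D}"
    and reg_k: "h \<in> Reg PE D \<Longrightarrow> (\<lambda>x. h (\<Psi> (\<pi> x))) \<in> Reg ?V {x \<in> V_over k. \<Psi> (\<pi> x) \<in> D}"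
    if D: "openin (Top PE) D" and k: "k \<in> I" for D k h
  proof -
    note t = fs_morphism_trivialization[OF k]
    note O = V_over_open[of k]
    let ?B = "{p \<in> pts (piece k). \<kappa> k p \<in> D}"
    have B: "openin (Top (piece k)) ?B" using D k unfolding PE_glue openin_glue by blast
    have eq: "{x \<in> V_over k. \<Psi> (\<pi> x) \<in> D} =
        {x \<in> pts (open_subspace ?V (V_over k)). ?t k x \<in> ?B}"
    proof -
      have "x \<in> V_over k \<Longrightarrow> ?t k x \<in> pts (piece k)" for x
        using fs_morphismD(1)[OF t, of x] unfolding pts_subspace[OF O] .
      then show ?thesis unfolding pts_subspace[OF O] using \<Psi>_trivialization[OF k] by auto
    qed
    have op: "openin (Top (open_subspace ?V (V_over k))) {x \<in> V_over k. \<Psi> (\<pi> x) \<in> D}"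
      unfolding eq by (rule fs_morphismD(2)[OF t B])
    then show op': "openin (Top ?V) {x \<in> V_over k. \<Psi> (\<pi> x) \<in> D}" unfolding openin_subspace[OF O] by simp
    assume h: "h \<in> Reg PE D"
    then have "(\<lambda>p. h (\<kappa> k p)) \<in> Reg (piece k) ?B" using k unfolding PE_glue Reg_glue by blast
    then have "(\<lambda>x. h (\<kappa> k (?t k x))) \<in> Reg ?V {x \<in> V_over k. \<Psi> (\<pi> x) \<in> D}"
      unfolding eq using fs_morphismD(3)[OF t B] by simp
    then show "(\<lambda>x. h (\<Psi> (\<pi> x))) \<in> Reg ?V {x \<in> V_over k. \<Psi> (\<pi> x) \<in> D}"
      by (rule swf_cong[OF top.X op']) (use \<Psi>_trivialization[OF k] in auto)
  qed
  have preV: "openin (Top ?V) {x \<in> V_ss (Suc r) q. \<Psi> (\<pi> x) \<in> D}" if D: "openin (Top PE) D" for D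
  proof -
    have "{x \<in> V_ss (Suc r) q. \<Psi> (\<pi> x) \<in> D} = (\<Union>k\<in>I. {x \<in> V_over k. \<Psi> (\<pi> x) \<in> D})"
      using V_over_cover over by blast
    then show ?thesis using pre_k[OF D] by (auto intro!: openin_Union)
  qed
  have pY: "y \<in> pts Y \<Longrightarrow> \<exists>x\<in>V_ss (Suc r) q. y = \<pi> x" for y
    using top.surj unfolding V_space_facts(1) by blast
  have \<pi>Y: "x \<in> V_ss (Suc r) q \<Longrightarrow> \<pi> x \<in> pts Y" for x
    using top.surj unfolding V_space_facts(1) by blast
  have preY: "openin (Top Y) {y \<in> pts Y. \<Psi> y \<in> D}" if D: "openin (Top PE) D" for D
  proof -
    have "{x \<in> V_ss (Suc r) q. \<pi> x \<in> {y \<in> pts Y. \<Psi> y \<in> D}} = {x \<in> V_ss (Suc r) q. \<Psi> (\<pi> x) \<in> D}"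
      using \<pi>Y by blast
    then show ?thesis unfolding top.openin_iff V_space_facts(1) using preV[OF D] by auto
  qed
  show ?thesis unfolding fs_morphism_def continuous_map_def
  proof (intro conjI allI impI)
    show "\<Psi> \<in> pts Y \<rightarrow> pts PE" unfolding \<Psi>_def using cls_in_PE top.rep(1) by blast
    show "openin (Top Y) {y \<in> pts Y. \<Psi> y \<in> D}" if "openin (Top PE) D" for D by (rule preY[OF that])
    fix D h assume D: "openin (Top PE) D" and h: "h \<in> Reg PE D"
    have eq: "{x \<in> V_ss (Suc r) q. \<pi> x \<in> {y \<in> pts Y. \<Psi> y \<in> D}} = {x \<in> V_ss (Suc r) q. \<Psi> (\<pi> x) \<in> D}"
      using \<pi>Y by blast
    have "(\<lambda>x. h (\<Psi> (\<pi> x))) \<in> Reg ?V {x \<in> V_ss (Suc r) q. \<Psi> (\<pi> x) \<in> D}"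
    proof (rule swf_local[OF top.X preV[OF D]])
      fix x assume x: "x \<in> {x \<in> V_ss (Suc r) q. \<Psi> (\<pi> x) \<in> D}"
      then obtain k where k: "k \<in> I" "x \<in> V_over k" using V_over_cover by blast
      show "\<exists>T. openin (Top ?V) T \<and> x \<in> T \<and> T \<subseteq> {x \<in> V_ss (Suc r) q. \<Psi> (\<pi> x) \<in> D} \<and>
          (\<lambda>x. h (\<Psi> (\<pi> x))) \<in> Reg ?V T"
        using pre_k[OF D k(1)] reg_k[OF D k(1) h] x k(2) over
        by (intro exI[of _ "{x \<in> V_over k. \<Psi> (\<pi> x) \<in> D}"]) auto
    qed
    then show "h \<circ> \<Psi> \<in> Reg Y {y \<in> pts Y. \<Psi> y \<in> D}"
      unfolding top.Reg_iff[OF preY[OF D]] V_space_facts(1) eq comp_def .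
  qed
qed

definition \<Psi>_inv :: "(nat \<times> 'z \<times> (nat \<Rightarrow> complex) set) set \<Rightarrow> 'y" where
  "\<Psi>_inv c = \<pi> (cell_pt (Suc r) q (SOME a. a \<in> params (Suc r) q \<and> cls a = c))"

lemma \<Psi>_inv_cls: assumes a: "a \<in> params (Suc r) q" shows "\<Psi>_inv (cls a) = \<pi> (cell_pt (Suc r) q a)"
proof -
  define b where "b = (SOME b. b \<in> params (Suc r) q \<and> cls b = cls a)"
  have "b \<in> params (Suc r) q \<and> cls b = cls a" unfolding b_def by (rule someI[of _ a]) (use a in simp)
  then have "\<exists>u. nonzero u \<and> b = act q u a" using cls_inj[OF a, of b] by simp
  then show ?thesis unfolding \<Psi>_inv_def b_def[symmetric] using top.\<pi>_act[OF a] by auto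
qed

text \<open>Over an affine piece the inverse is the local section \<open>lift\<close> followed by
  the cell map and \<pi>, hence a morphism; gluing reduces openness and regularity to these
  pieces.\<close>

lemma \<Psi>_inv_morphism: "fs_morphism PE Y \<Psi>_inv"
proof -
  let ?V = "V_space (Suc r) q"
  let ?s = "\<lambda>k e p. \<pi> (cell_pt (Suc r) q (lift k e p))"
  have im: "c \<in> pts PE \<Longrightarrow> \<Psi>_inv c \<in> pts Y" for c
    using PE_cls[of c] \<Psi>_inv_cls top.\<pi>_pts by metis
  have s: "\<Psi>_inv (\<kappa> k p) = ?s k e p" if "k \<in> I" "e < m" "p \<in> affine_piece k e" for k e p
    using \<kappa>_lift[OF that] \<Psi>_inv_cls by simp
  have s_mor: "fs_morphism (open_subspace (piece k) (affine_piece k e)) Y (?s k e)" if "k \<in> I" "e < m" for k e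
    by (rule fs_morphism_comp[OF fs_morphism_lift[OF that] top.mor])
  have \<kappa>P: "k \<in> I \<Longrightarrow> p \<in> pts (piece k) \<Longrightarrow> \<kappa> k p \<in> pts PE" for k p
    unfolding PE_glue pts_glue by blast
  have loc: "openin (Top (piece k)) {p \<in> affine_piece k e. ?s k e p \<in> D}"
    "h \<in> Reg Y D \<Longrightarrow> (\<lambda>p. h (\<Psi>_inv (\<kappa> k p))) \<in> Reg (piece k) {p \<in> affine_piece k e. ?s k e p \<in> D}"
    if k: "k \<in> I" and e: "e < m" and D: "openin (Top Y) D" for k e D h
  proof -
    note O = affine_piece_open[OF e, of k]
    have "openin (Top (open_subspace (piece k) (affine_piece k e))) {p \<in> affine_piece k e. ?s k e p \<in> D}"
      using fs_morphismD(2)[OF s_mor[OF k e] D] unfolding pts_subspace[OF O] .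
    then show op: "openin (Top (piece k)) {p \<in> affine_piece k e. ?s k e p \<in> D}"
      unfolding openin_subspace[OF O] by simp
    assume h: "h \<in> Reg Y D"
    have "(\<lambda>p. h (?s k e p)) \<in> Reg (piece k) {p \<in> affine_piece k e. ?s k e p \<in> D}"
      using fs_morphismD(3)[OF s_mor[OF k e] D h] unfolding pts_subspace[OF O] Reg_subspace .
    then show "(\<lambda>p. h (\<Psi>_inv (\<kappa> k p))) \<in> Reg (piece k) {p \<in> affine_piece k e. ?s k e p \<in> D}"
      by (rule swf_cong[OF piece_facts(2) op]) (use s[OF k e] in auto)
  qed
  have near: "\<exists>T. openin (Top (piece k)) T \<and> p \<in> T \<and>
      T \<subseteq> {p \<in> pts (piece k). \<kappa> k p \<in> {c \<in> pts PE. \<Psi>_inv c \<in> D}} \<and>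
      (\<forall>h\<in>Reg Y D. (\<lambda>p. h (\<Psi>_inv (\<kappa> k p))) \<in> Reg (piece k) T)"
    if k: "k \<in> I" and D: "openin (Top Y) D"
      and p: "p \<in> {p \<in> pts (piece k). \<kappa> k p \<in> {c \<in> pts PE. \<Psi>_inv c \<in> D}}" for k D p
  proof -
    obtain e where e: "e < m" "p \<in> affine_piece k e" using affine_piece_cover[of p k] p by blast
    have "affine_piece k e \<subseteq> pts (piece k)" by (rule openin_subset[OF affine_piece_open[OF e(1)]])
    then have "{p \<in> affine_piece k e. ?s k e p \<in> D} \<subseteq> {p \<in> pts (piece k). \<kappa> k p \<in> {c \<in> pts PE. \<Psi>_inv c \<in> D}}"
      using s[OF k e(1)] \<kappa>P[OF k] by auto
    moreover have "p \<in> {p \<in> affine_piece k e. ?s k e p \<in> D}" using e p s[OF k e] by simp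
    ultimately show ?thesis using loc[OF k e(1) D] by (intro exI[of _ "{p \<in> affine_piece k e. ?s k e p \<in> D}"]) simp
  qed
  have op: "openin (Top (piece k)) {p \<in> pts (piece k). \<kappa> k p \<in> {c \<in> pts PE. \<Psi>_inv c \<in> D}}"
    if k: "k \<in> I" and D: "openin (Top Y) D" for k D
    by (subst openin_subopen) (use near[OF k D] in meson)
  show ?thesis unfolding fs_morphism_def continuous_map_def
  proof (intro conjI allI impI)
    show "\<Psi>_inv \<in> pts PE \<rightarrow> pts Y" using im by blast
    show "openin (Top PE) {c \<in> pts PE. \<Psi>_inv c \<in> D}" if D: "openin (Top Y) D" for D
    proof -
      have "\<forall>k\<in>I. openin (Top (piece k)) {p \<in> pts (piece k). \<kappa> k p \<in> {c \<in> pts PE. \<Psi>_inv c \<in> D}}"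
        using op[OF _ D] by blast
      moreover have "{c \<in> pts PE. \<Psi>_inv c \<in> D} \<subseteq> pts PE" by blast
      ultimately show ?thesis unfolding PE_glue openin_glue by simp
    qed
    fix D h assume D: "openin (Top Y) D" and h: "h \<in> Reg Y D"
    have "(\<lambda>p. h (\<Psi>_inv (\<kappa> k p))) \<in> Reg (piece k) {p \<in> pts (piece k). \<kappa> k p \<in> {c \<in> pts PE. \<Psi>_inv c \<in> D}}"
      if k: "k \<in> I" for k
      by (rule swf_local[OF piece_facts(2) op[OF k D]]) (use near[OF k D] h in meson)
    then show "h \<circ> \<Psi>_inv \<in> Reg PE {c \<in> pts PE. \<Psi>_inv c \<in> D}"
      unfolding PE_glue Reg_glue by simp
  qed
qed

lemma \<Psi>_isomorphism: "fs_isomorphism Y PE \<Psi>"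
  unfolding fs_isomorphism_def
proof (intro conjI exI[of _ \<Psi>_inv] ballI \<Psi>_morphism \<Psi>_inv_morphism)
  fix y assume y: "y \<in> pts Y"
  show "\<Psi>_inv (\<Psi> y) = y" unfolding \<Psi>_def \<Psi>_inv_cls[OF top.rep(1)[OF y]] by (rule top.rep(2)[OF y])
next
  fix c assume "c \<in> pts PE"
  then obtain a where a: "a \<in> params (Suc r) q" "c = cls a" by (rule PE_cls)
  show "\<Psi> (\<Psi>_inv c) = c" unfolding a(2) \<Psi>_inv_cls[OF a(1)] by (rule \<Psi>_\<pi>[OF a(1)])
qed

section \<open>Compatibility with the map to the base\<close>

lemma pb_proj_cls: assumes a: "a \<in> params (Suc r) q" shows "pb_proj (cls a) = base_pt a"
proof -
  obtain k where "k \<in> I" "tr a \<in> sel_dom r q (sel k)" using cover[OF tr_params[OF a]] by blast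
  then have "(k, base_pt a, line (fibre k a)) \<in> cls a" unfolding cls_def by blast
  then show ?thesis unfolding pb_proj_def by (intro the_equality) (auto simp: cls_def)
qed

text \<open>The definite description in \<open>phi\<close> has a unique value because two parameter
  families with the same image in Y differ by the torus, and truncation commutes with the torus
  action.\<close>

lemma phi_eq:
  assumes a: "a \<in> params (Suc r) q"
  shows "phi (Suc r) q \<pi> \<pi>' (\<pi> (cell_pt (Suc r) q a)) = base_pt a"
  unfolding phi_def
proof (rule the_equality)
  show "\<exists>b. cell_pt (Suc r) q b \<in> V_ss (Suc r) q \<and> \<pi> (cell_pt (Suc r) q b) = \<pi> (cell_pt (Suc r) q a) \<and>
      base_pt a = \<pi>' (cell_pt (Suc r - 1) q b)"
    using top.cell_in_V[OF a] by (intro exI[of _ a]) (simp add: base_pt_def cell_pt_restrict[OF q])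
  fix z assume "\<exists>b. cell_pt (Suc r) q b \<in> V_ss (Suc r) q \<and> \<pi> (cell_pt (Suc r) q b) = \<pi> (cell_pt (Suc r) q a) \<and>
      z = \<pi>' (cell_pt (Suc r - 1) q b)"
  then obtain b where b: "cell_pt (Suc r) q b \<in> V_ss (Suc r) q"
    "\<pi> (cell_pt (Suc r) q b) = \<pi> (cell_pt (Suc r) q a)" "z = \<pi>' (cell_pt r q b)" by auto
  define c where "c = co (cell_pt (Suc r) q b)"
  have c: "c \<in> params (Suc r) q" "cell_pt (Suc r) q c = cell_pt (Suc r) q b"
    using coord_params[OF q b(1)] by (simp_all add: c_def)
  \<comment> \<open>The family b may be arbitrary off the free positions, so it is compared with the
    normalized parameters c of the same point at the free positions only.\<close>
  have cb: "c i j = b i j" if j: "1 \<le> j" "j \<le> Suc r" and i: "i \<in> C_set q j" for i j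
  proof -
    obtain v where v: "v \<in> cell_pt (Suc r) q c" unfolding cell_pt_eq[OF q] using in_line_self by blast
    show ?thesis
      using cell_coordinate[OF q j i v] cell_coordinate(1)[OF q j i v[unfolded c(2)]] sign_nonzero(1)[OF q j i]
      by simp
  qed
  have "cell_pt r q b = cell_pt r q (tr c)"
    by (rule cell_pt_cong[OF q]) (simp add: restrict_params_def cb)
  then have z: "z = base_pt c" using b(3) by (simp add: base_pt_def)
  obtain u where u: "nonzero u" "c = act q u a"
    using top.\<pi>_eq_iff[OF a c(1)] b(2) c(2) by auto
  show "z = base_pt a" unfolding z u(2) base_pt_def tr_act by (rule base.\<pi>_act[OF tr_params[OF a] u(1)])
qed

lemma pb_proj_\<Psi>: assumes y: "y \<in> pts Y" shows "pb_proj (\<Psi> y) = phi (Suc r) q \<pi> \<pi>' y"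
  using phi_eq[OF top.rep(1)[OF y]] pb_proj_cls[OF top.rep(1)[OF y]] top.rep(2)[OF y] by (simp add: \<Psi>_def)

lemma E_direct_sum:
  "E = direct_sum (replicate q (L 0) @ concat (map (\<lambda>j. replicate (q - 1) (L j)) [1..<Suc r]))"
  unfolding E_def last_blocks_def by (simp add: map_concat comp_def)

end

theorem theorem1p2:
  fixes r q :: nat
    and Y :: "'y fspace" and \<pi> :: "(nat set \<Rightarrow> complex) set \<Rightarrow> 'y"
    and Y' :: "'z fspace" and \<pi>' :: "(nat set \<Rightarrow> complex) set \<Rightarrow> 'z"
  assumes "r \<ge> 2" and "q \<ge> 2"
    and "GIT_quotient r q Y \<pi>"
    and "GIT_quotient (r - 1) q Y' \<pi>'"
  shows "\<exists>(I :: nat set) U (L :: nat \<Rightarrow> 'z transition) \<E> \<Psi>.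
     (\<forall>j<r. line_bundle Y' I U (L j)) \<and>
     \<E> = direct_sum (replicate q (L 0) @ concat (map (\<lambda>j. replicate (q - 1) (L j)) [1..<r])) \<and>
     fs_isomorphism Y (proj_bundle Y' I U (q + (r - 1) * (q - 1)) \<E>) \<Psi> \<and>
     (\<forall>y\<in>pts Y. pb_proj (\<Psi> y) = phi r q \<pi> \<pi>' y)"
proof -
  define s where "s = r - 1"
  have r: "r = Suc s" using assms(1) by (simp add: s_def)
  obtain I :: "nat set" and sel where sel: "\<And>k. k \<in> I \<Longrightarrow> sel k \<in> selections s q"
    "\<And>a. a \<in> params s q \<Longrightarrow> \<exists>k\<in>I. a \<in> sel_dom s q (sel k)"
    using finite_selections[of s q] by metis
  interpret tower s q Y \<pi> Y' \<pi>' I sel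
    by unfold_locales (use assms sel in \<open>simp_all add: r\<close>)
  have "\<forall>j<r. line_bundle Y' I U (L j)" using line_bundle_L by (simp add: r)
  moreover have "fs_isomorphism Y (proj_bundle Y' I U (q + (r - 1) * (q - 1)) E) \<Psi>"
    using \<Psi>_isomorphism by (simp add: PE_def r)
  moreover have "\<forall>y\<in>pts Y. pb_proj (\<Psi> y) = phi r q \<pi> \<pi>' y" using pb_proj_\<Psi> by (simp add: r)
  ultimately show ?thesis using E_direct_sum unfolding r
    by (intro exI[of _ I] exI[of _ U] exI[of _ L] exI[of _ E] exI[of _ \<Psi>]) simp
qed

end
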